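(* Let $\mathcal{A}=\sum_{i=1}^N A^{(i)}\frac{\partial}{\partial x_i}$, with $A^{(i)}\in\mathbb{R}^{m\times d}$, be a first order linear differential operator satisfying $\mathrm{rank}\left(\sum_{i=1}^N A^{(i)}w_i\right)=m$ for every $w\in\mathbb{R}^N\setminus\{0\}$. Let $E\subset\mathbb{R}^d$ be a compact set with $\mathrm{int}\,\Lambda\mathrm{co}E\neq\emptyset$, and suppose that there exists a family $(E_\delta)_{\delta>0}$ of subsets of $\mathbb{R}^d$ such that: (i) for every $\varepsilon>0$ there exists $\delta_0=\delta_0(\varepsilon)>0$ such that $E_\delta\subset\{\xi:\mathrm{dist}(\xi;E)\le\varepsilon\}$ for every $\delta\in(0,\delta_0]$; (ii) $\Lambda\mathrm{co}E_\delta\subset\mathrm{int}\,\Lambda\mathrm{co}E$ for every $\delta>0$; (iii) for every $\xi\in\mathrm{int}\,\Lambda\mathrm{co}E$ we have $\xi\in\Lambda\mathrm{co}E_\delta$ for all $\delta>0$ small enough. Then $\Lambda\mathrm{co}E$ has the relaxation property with respect to $E$.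
   Context: The characteristic cone of $\mathcal{A}$ is $\Lambda=\{v\in\mathbb{R}^d:\exists w\in\mathbb{R}^N\setminus\{0\},\ (\sum_{i=1}^N A^{(i)}w_i)v=0\}$. A function $G:\mathbb{R}^d\to\mathbb{R}\cup\{+\infty\}$ is $\Lambda$-convex if it is convex along the directions of $\Lambda$, i.e. $G(ta+(1-t)b)\le tG(a)+(1-t)G(b)$ for all $t\in[0,1]$ and all $a,b\in\mathbb{R}^d$ with $b-a\in\Lambda$. For $E\subset\mathbb{R}^d$, $$\Lambda\mathrm{co}E=\{\xi\in\mathbb{R}^d: G(\xi)\le0\text{ for every }\Lambda\text{-convex } G:\mathbb{R}^d\to\mathbb{R}\cup\{+\infty\}\text{ with }G=0\text{ on }E\}.$$ $\mathrm{int}$ denotes the interior and $\mathrm{dist}(\cdot;E)$ the Euclidean distance to $E$. $L^\infty_{\rm piec}(\mathbb{R}^N;\mathbb{R}^d)$ is the set of bounded piecewise constant functions, i.e. bounded functions for which there are at most countably many pairwise disjoint open sets, covering $\mathbb{R}^N$ up to a null set, on each of which the function is constant. Relaxation property: $K\subset\mathbb{R}^d$ has the relaxation property with respect to $E\subset\mathbb{R}^d$ if for every bounded open set $\Omega\subset\mathbb{R}^N$ and every $\xi\in\mathrm{int}\,K$ there exists a sequence $\{u_n\}\subset L^\infty_{\rm piec}(\mathbb{R}^N;\mathbb{R}^d)$ such that $u_n\stackrel{*}{\rightharpoonup}\xi$ weakly* in $L^\infty$; $u_n=\xi$ in $\mathbb{R}^N\setminus\Omega$; $\mathcal{A}u_n=0$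 in $\mathcal{D}'(\mathbb{R}^N;\mathbb{R}^m)$; $u_n(x)\in E\cup\mathrm{int}\,K$ for a.e. $x\in\Omega$; and $\int_\Omega\mathrm{dist}(u_n(x);E)\,dx\to0$ as $n\to\infty$. *)

theory Defs
  imports "HOL-Analysis.Analysis"
begin

text \<open>
  A constant-coefficient operator \<open>\<A> = \<Sum>i A\<^sup>(\<^sup>i\<^sup>) \<partial>/\<partial>x\<^sub>i\<close> is given by its family of coefficient
  matrices \<open>A :: 'n \<Rightarrow> real^'d^'m\<close>, where \<open>N = CARD('n)\<close>, \<open>d = CARD('d)\<close>, \<open>m = CARD('m)\<close>;
  an element of \<open>real^'d^'m\<close> has \<open>m\<close> rows and \<open>d\<close> columns.
\<close>

definition op_symbol :: "('n::finite \<Rightarrow> real^'d^'m) \<Rightarrow> real^'n \<Rightarrow> real^'d^'m" where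
  "op_symbol A w = (\<Sum>i\<in>UNIV. (w $ i) *\<^sub>R A i)"

definition char_cone :: "('n::finite \<Rightarrow> real^'d^'m) \<Rightarrow> (real^'d) set" where
  "char_cone A = {v. \<exists>w. w \<noteq> 0 \<and> op_symbol A w *v v = 0}"

text \<open>
  The first clause excludes the value \<open>-\<infinity>\<close>. In \<open>ereal\<close> we have \<open>0 * \<infinity> = 0\<close>, so the inequality
  is trivial at \<open>t = 0\<close> and \<open>t = 1\<close>.
\<close>

definition Lam_convex :: "(real^'d) set \<Rightarrow> (real^'d \<Rightarrow> ereal) \<Rightarrow> bool" where
  "Lam_convex \<Lambda> G \<longleftrightarrow>
     (\<forall>\<xi>. G \<xi> \<noteq> -\<infinity>) \<and>
     (\<forall>a b t. 0 \<le> t \<and> t \<le> 1 \<and> b - a \<in> \<Lambda> \<longrightarrow>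
        G (t *\<^sub>R a + (1 - t) *\<^sub>R b) \<le> ereal t * G a + ereal (1 - t) * G b)"

definition Lam_hull :: "(real^'d) set \<Rightarrow> (real^'d) set \<Rightarrow> (real^'d) set" where
  "Lam_hull \<Lambda> E = {\<xi>. \<forall>G. Lam_convex \<Lambda> G \<and> (\<forall>\<eta>\<in>E. G \<eta> = 0) \<longrightarrow> G \<xi> \<le> 0}"

definition Linf_piec :: "(real^'n \<Rightarrow> real^'d) set" where
  "Linf_piec = {u. bounded (range u) \<and>
     (\<exists>\<U>. countable \<U> \<and> disjoint \<U> \<and> (\<forall>U\<in>\<U>. open U \<and> u constant_on U) \<and>
          negligible (- \<Union>\<U>))}"

text \<open>
  Weak* convergence in \<open>L\<^sup>\<infinity>\<close> as the dual of \<open>L\<^sup>1\<close>; it is meaningful for sequences and limits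
  in \<open>L\<^sup>\<infinity>\<close>, where all the integrals exist.
\<close>

definition weak_star_Linf :: "(nat \<Rightarrow> real^'n \<Rightarrow> real^'d) \<Rightarrow> (real^'n \<Rightarrow> real^'d) \<Rightarrow> bool" where
  "weak_star_Linf u v \<longleftrightarrow>
     (\<forall>g :: real^'n \<Rightarrow> real^'d. integrable lebesgue g \<longrightarrow>
        (\<lambda>n. LINT x|lebesgue. g x \<bullet> u n x) \<longlonglongrightarrow> (LINT x|lebesgue. g x \<bullet> v x))"

definition partial :: "'n::finite \<Rightarrow> (real^'n \<Rightarrow> 'b::real_normed_vector) \<Rightarrow> real^'n \<Rightarrow> 'b" where
  "partial i \<phi> = (\<lambda>x. frechet_derivative \<phi> (at x) (axis i 1))"

fun C_order :: "nat \<Rightarrow> (real^'n::finite \<Rightarrow> 'b::real_normed_vector) \<Rightarrow> bool" where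
  "C_order 0 \<phi> = continuous_on UNIV \<phi>"
| "C_order (Suc k) \<phi> = ((\<forall>x. \<phi> differentiable (at x)) \<and> (\<forall>i. C_order k (partial i \<phi>)))"

definition test_function :: "(real^'n::finite \<Rightarrow> 'b::real_normed_vector) \<Rightarrow> bool" where
  "test_function \<phi> \<longleftrightarrow> (\<forall>k. C_order k \<phi>) \<and> compact (closure {x. \<phi> x \<noteq> 0})"

text \<open>
  The value of the distribution \<open>\<A> u \<in> D'(R\<^sup>N; R\<^sup>m)\<close> at a test function \<open>\<phi>\<close> with values in \<open>R\<^sup>m\<close>,
  for \<open>u\<close> locally integrable.
\<close>

definition distr_op ::
    "('n::finite \<Rightarrow> real^'d^'m) \<Rightarrow> (real^'n \<Rightarrow> real^'d) \<Rightarrow> (real^'n \<Rightarrow> real^'m) \<Rightarrow> real" where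
  "distr_op A u \<phi> = - (LINT x|lebesgue. (\<Sum>i\<in>UNIV. (A i *v u x) \<bullet> partial i \<phi> x))"

definition distr_free :: "('n::finite \<Rightarrow> real^'d^'m) \<Rightarrow> (real^'n \<Rightarrow> real^'d) \<Rightarrow> bool" where
  "distr_free A u \<longleftrightarrow> (\<forall>\<phi>. test_function \<phi> \<longrightarrow> distr_op A u \<phi> = 0)"

text \<open>
  \<open>infdist \<xi> {} = 0\<close> by convention, so the last clause is meaningful for nonempty \<open>E\<close> only.
\<close>

definition relaxation_property ::
    "('n::finite \<Rightarrow> real^'d^'m) \<Rightarrow> (real^'d) set \<Rightarrow> (real^'d) set \<Rightarrow> bool" where
  "relaxation_property A K E \<longleftrightarrow>
     (\<forall>\<Omega> :: (real^'n) set. \<forall>\<xi>. bounded \<Omega> \<and> open \<Omega> \<and> \<xi> \<in> interior K \<longrightarrow>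
       (\<exists>u :: nat \<Rightarrow> real^'n \<Rightarrow> real^'d.
          (\<forall>n. u n \<in> Linf_piec) \<and>
          weak_star_Linf u (\<lambda>_. \<xi>) \<and>
          (\<forall>n. \<forall>x. x \<notin> \<Omega> \<longrightarrow> u n x = \<xi>) \<and>
          (\<forall>n. distr_free A (u n)) \<and>
          (\<forall>n. AE x in lebesgue. x \<in> \<Omega> \<longrightarrow> u n x \<in> E \<union> interior K) \<and>
          (\<lambda>n. LINT x:\<Omega>|lebesgue. infdist (u n x) E) \<longlonglongrightarrow> 0))"

end

theory Submission
  imports Defs
begin

text \<open>
  By the rank condition, Cramer's rule yields for every \<open>w0 \<noteq> 0\<close> and \<open>v\<close> in the kernel of \<open>A(w0)\<close> a
  homogeneous polynomial \<open>b\<close> of degree \<open>m\<close> with \<open>A(w)b(w) = 0\<close> for all \<open>w\<close> and \<open>b(w0) = v\<close>. Hence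
  \<open>b(D)\<phi>\<close> solves the equation for every scalar potential \<open>\<phi>\<close>. A cut-off plane wave as potential gives
  fields with compact support that oscillate between two values \<open>a\<close> and \<open>b\<close> with \<open>b - a \<in> \<Lambda>\<close>. Replacing
  \<open>\<phi>\<close> on ever smaller balls by its Taylor polynomial of degree \<open>m\<close> makes \<open>b(D)\<phi>\<close> piecewise constant at the
  cost of an arbitrarily small uniform error, and without touching the regions where the values are already
  exactly \<open>a\<close> or \<open>b\<close>; there the construction can be iterated. So the set of values that relax to \<open>E\<^sub>\<delta>\<close>
  is closed under \<open>\<Lambda>\<close>-segments, and its indicator function (with values \<open>0\<close> and \<open>\<infinity>\<close>) is admissible in
  the definition of the hull of \<open>E\<^sub>\<delta>\<close>. All fields have mean zero deviation from their boundary value, so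
  working on small balls gives weak* convergence.
\<close>

section \<open>Iterated partial derivatives\<close>

text \<open>Two demands compete: the fields must be piecewise constant and must satisfy the equation
  exactly. Cutting off a field destroys the equation, so every change is made to the scalar
  potential, which is subject to no constraint; for a potential of compact support the field also
  has mean zero at no cost. Only derivatives of order m enter the field, so potentials of class C^m
  suffice throughout, and a Taylor polynomial of degree m produces a constant field. Exhausting a
  region takes infinitely many modifications, and nothing makes the potentials converge together
  with their derivatives. The weak equation is therefore passed to the limit of the fields, which
  are uniformly bounded. Uniform errors in the values are harmless because the target set int
  \<Lambda>co E is open and, by \<open>inner\<close>, contains the compact segments met by the
  construction. Errors in a and b would not be harmless, since the next oscillation has to start
  from exactly these values; hence a wave profile with flat plateaus.\<close>

lemma partial_has_derivative:
  "(f has_derivative D) (at x) \<Longrightarrow> partial i f x = D (axis i 1)"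
  unfolding partial_def by (metis frechet_derivative_at)

lemma partial_cong_open:
  assumes "open U" "x \<in> U" "\<And>y. y \<in> U \<Longrightarrow> f y = g y"
  shows "partial i f x = partial i g x"
proof -
  have "(f has_derivative D) (at x) \<longleftrightarrow> (g has_derivative D) (at x)" for D
    using has_derivative_transform_within_open[OF _ assms(1,2)] assms(3) by metis
  then show ?thesis
    unfolding partial_def frechet_derivative_def by presburger
qed

lemma partial_const [simp]: "partial i (\<lambda>x. c) = (\<lambda>x. 0)"
  by (rule ext) (simp add: partial_def)

lemma has_derivative_frechet:
  "f differentiable (at x) \<Longrightarrow> (f has_derivative frechet_derivative f (at x)) (at x)"
  by (simp add: frechet_derivative_works)

lemma has_derivative_partials:
  fixes f :: "real^'n \<Rightarrow> 'b::real_normed_vector"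
  assumes "f differentiable (at x)"
  shows "(f has_derivative (\<lambda>h. \<Sum>i\<in>UNIV. (h $ i) *\<^sub>R partial i f x)) (at x)"
proof -
  let ?D = "frechet_derivative f (at x)"
  have lin: "linear ?D"
    using assms by (rule linear_frechet_derivative)
  have "?D h = (\<Sum>i\<in>UNIV. (h $ i) *\<^sub>R partial i f x)" for h
  proof -
    have "?D h = ?D (\<Sum>i\<in>UNIV. (h $ i) *\<^sub>R axis i 1)"
      by (subst basis_expansion[symmetric, of h]) (simp add: scalar_mult_eq_scaleR)
    then show ?thesis
      by (simp add: linear_sum[OF lin] linear_scale[OF lin] partial_def)
  qed
  then have "?D = (\<lambda>h. \<Sum>i\<in>UNIV. (h $ i) *\<^sub>R partial i f x)" by blast
  then show ?thesis using has_derivative_frechet[OF assms] by simp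
qed

lemma C_order_differentiable: "C_order (Suc k) f \<Longrightarrow> f differentiable (at x)"
  by simp

lemma C_order_continuous:
  fixes f :: "real^'n \<Rightarrow> 'b::real_normed_vector"
  shows "C_order k f \<Longrightarrow> continuous_on UNIV f"
  by (cases k) (auto simp: differentiable_imp_continuous_within continuous_at_imp_continuous_on)

lemma C_order_Suc_imp:
  fixes f :: "real^'n \<Rightarrow> 'b::real_normed_vector"
  shows "C_order (Suc k) f \<Longrightarrow> C_order k f"
proof (induction k arbitrary: f)
  case 0
  then show ?case using C_order_continuous[OF 0] by simp
next
  case (Suc k)
  then show ?case by simp
qed

lemma C_order_mono:
  fixes f :: "real^'n \<Rightarrow> 'b::real_normed_vector"
  assumes "C_order k f" "j \<le> k"
  shows "C_order j f"
  using assms(2,1)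
proof (induction k rule: dec_induct)
  case (step n)
  then show ?case using C_order_Suc_imp[of n f] by blast
qed simp

lemma C_order_partial: "C_order (Suc k) f \<Longrightarrow> C_order k (partial i f)"
  by simp

lemma C_order_const [simp]: "C_order k (\<lambda>x. c)"
  by (induction k arbitrary: c) simp_all

lemma partial_add:
  assumes "f differentiable (at x)" "g differentiable (at x)"
  shows "partial i (\<lambda>x. f x + g x) x = partial i f x + partial i g x"
  using partial_has_derivative[OF has_derivative_add[OF assms[THEN has_derivative_frechet]]]
  by (simp add: partial_def)

lemma partial_bounded_linear:
  assumes "bounded_linear h" "f differentiable (at x)"
  shows "partial i (\<lambda>x. h (f x)) x = h (partial i f x)"
  using partial_has_derivative[OF bounded_linear.has_derivative[OF assms(1) has_derivative_frechet[OF assms(2)]]]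
  by (simp add: partial_def)

lemma partial_mult:
  fixes f g :: "real^'n \<Rightarrow> real"
  assumes "f differentiable (at x)" "g differentiable (at x)"
  shows "partial i (\<lambda>x. f x * g x) x = f x * partial i g x + partial i f x * g x"
  using partial_has_derivative[OF has_derivative_mult[OF assms[THEN has_derivative_frechet]]]
  by (simp add: partial_def)

lemma C_order_add:
  fixes f g :: "real^'n \<Rightarrow> 'b::real_normed_vector"
  shows "C_order k f \<Longrightarrow> C_order k g \<Longrightarrow> C_order k (\<lambda>x. f x + g x)"
proof (induction k arbitrary: f g)
  case 0 then show ?case by (simp add: continuous_on_add)
next
  case (Suc k)
  then have "partial i (\<lambda>x. f x + g x) = (\<lambda>x. partial i f x + partial i g x)" for i
    by (auto simp: partial_add)
  with Suc show ?case by simp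
qed

lemma C_order_bounded_linear:
  fixes f :: "real^'n \<Rightarrow> 'b::real_normed_vector"
  assumes h: "bounded_linear h"
  shows "C_order k f \<Longrightarrow> C_order k (\<lambda>x. h (f x))"
proof (induction k arbitrary: f)
  case 0 then show ?case by (simp add: bounded_linear.continuous_on[OF h])
next
  case (Suc k)
  then have "partial i (\<lambda>x. h (f x)) = (\<lambda>x. h (partial i f x))" for i
    by (auto simp: partial_bounded_linear[OF h])
  moreover have "(\<lambda>x. h (f x)) differentiable (at x)" for x
    using bounded_linear.has_derivative[OF h] Suc.prems
    unfolding differentiable_def C_order.simps by blast
  ultimately show ?case using Suc by simp
qed

lemma C_order_mult:
  fixes f g :: "real^'n \<Rightarrow> real"
  shows "C_order k f \<Longrightarrow> C_order k g \<Longrightarrow> C_order k (\<lambda>x. f x * g x)"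
proof (induction k arbitrary: f g)
  case 0 then show ?case by (simp add: continuous_on_mult)
next
  case (Suc k)
  then have *: "partial i (\<lambda>x. f x * g x) = (\<lambda>x. f x * partial i g x + partial i f x * g x)" for i
    by (auto simp: partial_mult)
  have "C_order k (\<lambda>x. f x * partial i g x + partial i f x * g x)" for i
    using Suc C_order_Suc_imp[OF Suc.prems(1)] C_order_Suc_imp[OF Suc.prems(2)]
    by (intro C_order_add) auto
  with Suc.prems show ?case by (simp add: *)
qed

lemma C_order_cmult:
  fixes f :: "real^'n \<Rightarrow> real"
  shows "C_order k f \<Longrightarrow> C_order k (\<lambda>x. c * f x)"
  by (intro C_order_mult) simp_all

lemma C_order_diff:
  fixes f g :: "real^'n \<Rightarrow> real"
  shows "C_order k f \<Longrightarrow> C_order k g \<Longrightarrow> C_order k (\<lambda>x. f x - g x)"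
  using C_order_add[of k f "\<lambda>x. (-1) * g x"] C_order_cmult[of k g "-1"] by simp

lemma C_order_sum:
  fixes f :: "'a \<Rightarrow> real^'n \<Rightarrow> 'b::real_normed_vector"
  shows "(\<And>j. j \<in> S \<Longrightarrow> C_order k (f j)) \<Longrightarrow> C_order k (\<lambda>x. \<Sum>j\<in>S. f j x)"
  by (induction S rule: infinite_finite_induct) (auto intro: C_order_add)

lemma partial_cmult:
  fixes f :: "real^'n \<Rightarrow> real"
  shows "f differentiable (at x) \<Longrightarrow> partial i (\<lambda>x. c * f x) x = c * partial i f x"
  by (simp add: partial_mult)

lemma partial_diff:
  fixes f g :: "real^'n \<Rightarrow> real"
  assumes "f differentiable (at x)" "g differentiable (at x)"
  shows "partial i (\<lambda>x. f x - g x) x = partial i f x - partial i g x"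
  using partial_has_derivative[OF has_derivative_diff[OF assms[THEN has_derivative_frechet]]]
  by (simp add: partial_def)

lemma partial_sum:
  fixes f :: "'a \<Rightarrow> real^'n \<Rightarrow> 'b::real_normed_vector"
  assumes "\<And>j. j \<in> S \<Longrightarrow> f j differentiable (at x)"
  shows "partial i (\<lambda>x. \<Sum>j\<in>S. f j x) x = (\<Sum>j\<in>S. partial i (f j) x)"
proof -
  have "((\<lambda>x. \<Sum>j\<in>S. f j x) has_derivative (\<lambda>h. \<Sum>j\<in>S. frechet_derivative (f j) (at x) h)) (at x)"
    using assms by (intro has_derivative_sum has_derivative_frechet)
  then show ?thesis by (simp add: partial_has_derivative) (simp add: partial_def)
qed

lemma partial_affine:
  fixes f :: "real^'n \<Rightarrow> real"
  assumes "f differentiable (at (r *\<^sub>R (x - x0)))"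
  shows "partial i (\<lambda>x. f (r *\<^sub>R (x - x0))) x = r * partial i f (r *\<^sub>R (x - x0))"
proof -
  let ?D = "frechet_derivative f (at (r *\<^sub>R (x - x0)))"
  have "((\<lambda>x. f (r *\<^sub>R (x - x0))) has_derivative (\<lambda>h. ?D (r *\<^sub>R h))) (at x)"
    by (rule has_derivative_compose[where f = "\<lambda>x. r *\<^sub>R (x - x0)" and g = f, OF _ has_derivative_frechet[OF assms]])
      (auto intro!: derivative_eq_intros)
  then show ?thesis
    by (simp add: partial_has_derivative linear_scale[OF linear_frechet_derivative[OF assms]])
      (simp add: partial_def)
qed

lemma differentiable_affine:
  fixes f :: "real^'n \<Rightarrow> real"
  assumes "f differentiable (at (r *\<^sub>R (x - x0)))"
  shows "(\<lambda>x. f (r *\<^sub>R (x - x0))) differentiable (at x)"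
  by (rule differentiable_compose[where f = f and g = "\<lambda>x. r *\<^sub>R (x - x0)", OF assms]) simp

lemma C_order_affine:
  fixes f :: "real^'n \<Rightarrow> real"
  shows "C_order k f \<Longrightarrow> C_order k (\<lambda>x. f (r *\<^sub>R (x - x0)))"
proof (induction k arbitrary: f)
  case 0
  then show ?case by (auto intro!: continuous_on_compose2[of UNIV f] continuous_intros)
next
  case (Suc k)
  then have *: "partial i (\<lambda>x. f (r *\<^sub>R (x - x0))) = (\<lambda>x. r * partial i f (r *\<^sub>R (x - x0)))" for i
    by (auto simp: partial_affine)
  show ?case
    using Suc by (auto simp: * differentiable_affine intro!: C_order_cmult)
qed

section \<open>Functions of one variable of class C^k\<close>

fun Ck :: "nat \<Rightarrow> (real \<Rightarrow> real) \<Rightarrow> bool" where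
  "Ck 0 f = continuous_on UNIV f"
| "Ck (Suc k) f = (\<exists>f'. (\<forall>x. (f has_real_derivative f' x) (at x)) \<and> Ck k f')"

lemma Ck_continuous: "Ck k f \<Longrightarrow> continuous_on UNIV f"
  by (cases k) (auto intro!: continuous_at_imp_continuous_on intro: DERIV_isCont)

lemma Ck_Suc_imp: "Ck (Suc k) f \<Longrightarrow> Ck k f"
proof (induction k arbitrary: f)
  case 0 then show ?case using Ck_continuous[OF 0] by simp
next
  case (Suc k)
  then obtain f' where "\<forall>x. (f has_real_derivative f' x) (at x)" "Ck (Suc k) f'" by auto
  with Suc.IH[of f'] show ?case by (simp only: Ck.simps) blast
qed

lemma partial_compose:
  fixes g :: "real^'n \<Rightarrow> real"
  assumes "(f has_real_derivative d) (at (g x))" "g differentiable (at x)"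
  shows "(\<lambda>x. f (g x)) differentiable (at x)"
    and "partial i (\<lambda>x. f (g x)) x = d * partial i g x"
proof -
  have "((\<lambda>x. f (g x)) has_derivative (\<lambda>h. d * frechet_derivative g (at x) h)) (at x)"
    using has_derivative_compose[OF has_derivative_frechet[OF assms(2)]
        assms(1)[unfolded has_field_derivative_def]] by simp
  then show "(\<lambda>x. f (g x)) differentiable (at x)"
    and "partial i (\<lambda>x. f (g x)) x = d * partial i g x"
    by (auto simp: partial_has_derivative differentiable_def) (simp add: partial_def)
qed

lemma C_order_compose:
  fixes g :: "real^'n \<Rightarrow> real"
  shows "Ck k f \<Longrightarrow> C_order k g \<Longrightarrow> C_order k (\<lambda>x. f (g x))"
proof (induction k arbitrary: f)
  case 0
  then show ?case by (auto intro: continuous_on_compose2)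
next
  case (Suc k)
  then obtain f' where f': "\<And>x. (f has_real_derivative f' x) (at x)" "Ck k f'" by auto
  have "partial i (\<lambda>x. f (g x)) = (\<lambda>x. f' (g x) * partial i g x)" for i
    using Suc.prems(2) by (intro ext partial_compose(2)[OF f'(1)]) simp
  moreover have "C_order k (\<lambda>x. f' (g x) * partial i g x)" for i
    using Suc.IH[OF f'(2)] C_order_Suc_imp[OF Suc.prems(2)] Suc.prems(2) by (intro C_order_mult) auto
  ultimately show ?case
    using partial_compose(1)[where f = f, OF f'(1)] Suc.prems(2) by (simp only: C_order.simps) blast
qed

lemma partial_component: "partial i (\<lambda>x::real^'n. x $ j) = (\<lambda>x. if i = j then 1 else 0)"
proof
  fix x :: "real^'n"
  have "((\<lambda>x::real^'n. x $ j) has_derivative (\<lambda>x. x $ j)) (at x)"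
    by (intro bounded_linear_imp_has_derivative bounded_linear_vec_nth)
  then show "partial i (\<lambda>x. x $ j) x = (if i = j then 1 else (0::real))"
    by (simp add: partial_has_derivative axis_def)
qed

lemma C_order_component: "C_order k (\<lambda>x::real^'n. x $ j)"
  by (cases k)
    (simp_all add: partial_component continuous_on_component
      bounded_linear_imp_differentiable[OF bounded_linear_vec_nth])

lemma C_order_inner: "C_order k (\<lambda>x::real^'n. w \<bullet> x)"
  unfolding inner_vec_def by (auto intro!: C_order_sum C_order_mult C_order_component)

lemma partial_inner: "partial i (\<lambda>x::real^'n. w \<bullet> x) x = w $ i"
proof -
  have "((\<lambda>x. w \<bullet> x) has_derivative (\<lambda>x. w \<bullet> x)) (at x)"
    by (intro bounded_linear_imp_has_derivative bounded_linear_inner_right)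
  then show ?thesis by (simp add: partial_has_derivative inner_axis)
qed

section \<open>Mean value estimates and symmetry of second derivatives\<close>

lemma partial_bound_imp:
  fixes f :: "real^'n \<Rightarrow> real" and r B :: real
  assumes d: "\<And>x. f differentiable (at x)" and r: "x \<in> cball x0 r"
    and B: "\<And>x i. x \<in> cball x0 r \<Longrightarrow> \<bar>partial i f x\<bar> \<le> B"
  shows "\<bar>f x - f x0\<bar> \<le> real CARD('n) * B * r"
proof -
  have r0: "r \<ge> 0" using r zero_le_dist[of x0 x] by (auto simp del: zero_le_dist)
  have B0: "0 \<le> B" using B[of x0] r0 by (meson abs_ge_zero centre_in_cball order_trans)
  have "norm (f x - f x0) \<le> (CARD('n) * B) * norm (x - x0)"
  proof (rule differentiable_bound[of "cball x0 r" f "\<lambda>x h. \<Sum>i\<in>UNIV. (h $ i) *\<^sub>R partial i f x"])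
    fix y assume y: "y \<in> cball x0 r"
    show "(f has_derivative (\<lambda>h. \<Sum>i\<in>UNIV. (h $ i) *\<^sub>R partial i f y)) (at y within cball x0 r)"
      by (rule has_derivative_at_withinI[OF has_derivative_partials[OF d]])
    show "onorm (\<lambda>h. \<Sum>i\<in>UNIV. (h $ i) *\<^sub>R partial i f y) \<le> real CARD('n) * B"
    proof (rule onorm_bound)
      fix h :: "real^'n"
      have "norm (\<Sum>i\<in>UNIV. (h $ i) *\<^sub>R partial i f y) \<le> (\<Sum>i\<in>(UNIV::'n set). norm h * B)"
        by (intro order.trans[OF norm_sum] sum_mono)
          (use B[OF y] B0 in \<open>auto simp: abs_mult intro!: mult_mono component_le_norm_cart\<close>)
      then show "norm (\<Sum>i\<in>UNIV. (h $ i) *\<^sub>R partial i f y) \<le> real CARD('n) * B * norm h"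
        by (simp add: mult_ac)
    qed (use B0 in simp)
  qed (use r r0 in auto)
  also have "\<dots> \<le> CARD('n) * B * r"
    using r B0 by (intro mult_left_mono) (auto simp: dist_norm norm_minus_commute)
  finally show ?thesis by simp
qed

lemma partial_line:
  fixes f :: "real^'n \<Rightarrow> real"
  assumes "f differentiable (at (a + s *\<^sub>R axis i 1))"
  shows "((\<lambda>s. f (a + s *\<^sub>R axis i 1)) has_real_derivative partial i f (a + s *\<^sub>R axis i 1)) (at s)"
proof -
  let ?D = "frechet_derivative f (at (a + s *\<^sub>R axis i 1))"
  have "((\<lambda>s. f (a + s *\<^sub>R axis i 1)) has_derivative (\<lambda>h. ?D (h *\<^sub>R axis i 1))) (at s)"
    by (rule has_derivative_compose[where f = "\<lambda>s. a + s *\<^sub>R axis i 1" and g = f, OF _ has_derivative_frechet[OF assms]])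
      (auto intro!: derivative_eq_intros)
  moreover have "(\<lambda>h. ?D (h *\<^sub>R axis i 1)) = (*) (partial i f (a + s *\<^sub>R axis i 1))"
    by (auto simp: linear_scale[OF linear_frechet_derivative[OF assms]] partial_def mult.commute)
  ultimately show ?thesis
    unfolding has_field_derivative_def by simp
qed

text \<open>The mean value theorem is used twice: in direction i for \<open>g\<close>, the increment
  of \<open>f\<close> in direction j, and then in direction j for the partial derivative. The second
  difference on the left is symmetric in i and j, while the order of differentiation on the right is
  not.\<close>

lemma second_difference:
  fixes f :: "real^'n \<Rightarrow> real"
  assumes "C_order 2 f" "h > 0"
  shows "\<exists>s t. 0 < s \<and> s < h \<and> 0 < t \<and> t < h \<and>
     f (x + h *\<^sub>R axis i 1 + h *\<^sub>R axis j 1) - f (x + h *\<^sub>R axis i 1) - f (x + h *\<^sub>R axis j 1) + f x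
      = h * h * partial j (partial i f) (x + s *\<^sub>R axis i 1 + t *\<^sub>R axis j 1)"
proof -
  have d1: "f differentiable (at y)" for y using assms(1) by (simp add: numeral_2_eq_2)
  have d2: "partial i f differentiable (at y)" for y using assms(1) by (simp add: numeral_2_eq_2)
  define g where "g = (\<lambda>s. f ((x + h *\<^sub>R axis j 1) + s *\<^sub>R axis i 1) - f (x + s *\<^sub>R axis i 1))"
  define g' where "g' = (\<lambda>s. partial i f ((x + h *\<^sub>R axis j 1) + s *\<^sub>R axis i 1) - partial i f (x + s *\<^sub>R axis i 1))"
  have "(g has_real_derivative g' s) (at s)" for s
    unfolding g_def g'_def by (intro DERIV_diff partial_line d1)
  then obtain s where s: "0 < s" "s < h" "g h - g 0 = h * g' s"
    using MVT2[of 0 h g g'] assms(2) by auto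
  have "((\<lambda>t. partial i f ((x + s *\<^sub>R axis i 1) + t *\<^sub>R axis j 1)) has_real_derivative
      partial j (partial i f) ((x + s *\<^sub>R axis i 1) + t *\<^sub>R axis j 1)) (at t)" for t
    by (intro partial_line d2)
  then obtain t where t: "0 < t" "t < h"
    "partial i f ((x + s *\<^sub>R axis i 1) + h *\<^sub>R axis j 1) - partial i f ((x + s *\<^sub>R axis i 1) + 0 *\<^sub>R axis j 1)
      = (h - 0) * partial j (partial i f) ((x + s *\<^sub>R axis i 1) + t *\<^sub>R axis j 1)"
    using MVT2[of 0 h "\<lambda>t. partial i f ((x + s *\<^sub>R axis i 1) + t *\<^sub>R axis j 1)"
      "\<lambda>t. partial j (partial i f) ((x + s *\<^sub>R axis i 1) + t *\<^sub>R axis j 1)"] assms(2) by auto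
  have "g' s = h * partial j (partial i f) ((x + s *\<^sub>R axis i 1) + t *\<^sub>R axis j 1)"
    using t(3) by (simp add: g'_def add_ac)
  with s t show ?thesis
    by (intro exI[of _ s] exI[of _ t]) (simp add: g_def add_ac algebra_simps)
qed

lemma partial_commute:
  fixes f :: "real^'n \<Rightarrow> real"
  assumes f: "C_order 2 f"
  shows "partial i (partial j f) = partial j (partial i f)"
proof
  fix x
  have cont: "isCont (partial a (partial b f)) x" for a b
    using f by (simp add: numeral_2_eq_2 continuous_on_eq_continuous_at)
  show "partial i (partial j f) x = partial j (partial i f) x"
  proof (rule ccontr)
    assume ne: "\<not> ?thesis"
    define e where "e = \<bar>partial i (partial j f) x - partial j (partial i f) x\<bar> / 2"
    have e: "e > 0" using ne by (simp add: e_def)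
    obtain d1 where d1: "d1 > 0" "\<And>y. dist y x < d1 \<Longrightarrow> \<bar>partial i (partial j f) y - partial i (partial j f) x\<bar> < e"
      using cont[of i j] e unfolding continuous_at_eps_delta dist_real_def by blast
    obtain d2 where d2: "d2 > 0" "\<And>y. dist y x < d2 \<Longrightarrow> \<bar>partial j (partial i f) y - partial j (partial i f) x\<bar> < e"
      using cont[of j i] e unfolding continuous_at_eps_delta dist_real_def by blast
    \<comment> \<open>Intermediate points are displaced by less than h along each of two axes, so by
      less than 2h in total.\<close>
    define h where "h = min d1 d2 / 2"
    have h: "h > 0" using d1 d2 by (simp add: h_def)
    have near: "dist (x + s *\<^sub>R axis a 1 + t *\<^sub>R axis b 1) x < min d1 d2"
      if "0 < s" "s < h" "0 < t" "t < h" for s t a b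
    proof -
      have "dist (x + s *\<^sub>R axis a 1 + t *\<^sub>R axis b 1) x = norm (s *\<^sub>R axis a 1 + t *\<^sub>R axis b (1::real))"
        by (simp add: dist_norm add_ac)
      also have "\<dots> \<le> s + t" using norm_triangle_ineq[of "s *\<^sub>R axis a 1" "t *\<^sub>R axis b (1::real)"] that by simp
      also have "\<dots> < min d1 d2" using that by (simp add: h_def)
      finally show ?thesis .
    qed
    obtain s t where st: "0 < s" "s < h" "0 < t" "t < h" and
      1: "f (x + h *\<^sub>R axis i 1 + h *\<^sub>R axis j 1) - f (x + h *\<^sub>R axis i 1) - f (x + h *\<^sub>R axis j 1) + f x
        = h * h * partial j (partial i f) (x + s *\<^sub>R axis i 1 + t *\<^sub>R axis j 1)"
      using second_difference[OF f h, of x i j] by blast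
    obtain s' t' where st': "0 < s'" "s' < h" "0 < t'" "t' < h" and
      2: "f (x + h *\<^sub>R axis j 1 + h *\<^sub>R axis i 1) - f (x + h *\<^sub>R axis j 1) - f (x + h *\<^sub>R axis i 1) + f x
        = h * h * partial i (partial j f) (x + s' *\<^sub>R axis j 1 + t' *\<^sub>R axis i 1)"
      using second_difference[OF f h, of x j i] by blast
    have "h * h * partial j (partial i f) (x + s *\<^sub>R axis i 1 + t *\<^sub>R axis j 1)
      = h * h * partial i (partial j f) (x + s' *\<^sub>R axis j 1 + t' *\<^sub>R axis i 1)"
      using 1 2 by (simp add: add_ac algebra_simps)
    then have eq: "partial j (partial i f) (x + s *\<^sub>R axis i 1 + t *\<^sub>R axis j 1)
      = partial i (partial j f) (x + s' *\<^sub>R axis j 1 + t' *\<^sub>R axis i 1)" using h by simp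
    have "\<bar>partial i (partial j f) (x + s' *\<^sub>R axis j 1 + t' *\<^sub>R axis i 1) - partial i (partial j f) x\<bar> < e"
      using near[OF st', of j i] by (intro d1(2)) simp
    moreover have "\<bar>partial j (partial i f) (x + s *\<^sub>R axis i 1 + t *\<^sub>R axis j 1) - partial j (partial i f) x\<bar> < e"
      using near[OF st, of i j] by (intro d2(2)) simp
    ultimately have "\<bar>partial i (partial j f) x - partial j (partial i f) x\<bar> < 2 * e"
      using eq by linarith
    then show False by (simp add: e_def)
  qed
qed

section \<open>Homogeneous differential operators\<close>

text \<open>A homogeneous polynomial of degree k with values in a vector space, given by one
  coefficient for each word of length k in the coordinates. Words keep the order of their letters,
  so the representation is redundant, but peeling off the first letter gives simple
  recursions.\<close>

fun symb :: "nat \<Rightarrow> ('n list \<Rightarrow> 'b) \<Rightarrow> real^'n::finite \<Rightarrow> 'b::real_normed_vector" where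
  "symb 0 c w = c []"
| "symb (Suc k) c w = (\<Sum>i\<in>UNIV. (w $ i) *\<^sub>R symb k (\<lambda>J. c (i # J)) w)"

text \<open>The operator obtained from \<open>symb k c\<close> by replacing w with the gradient; it
  maps a scalar potential to a vector field.\<close>

fun Dop :: "nat \<Rightarrow> ('n list \<Rightarrow> 'b) \<Rightarrow> (real^'n::finite \<Rightarrow> real) \<Rightarrow> real^'n \<Rightarrow> 'b::real_normed_vector" where
  "Dop 0 c \<phi> x = \<phi> x *\<^sub>R c []"
| "Dop (Suc k) c \<phi> x = (\<Sum>i\<in>UNIV. Dop k (\<lambda>J. c (i # J)) (partial i \<phi>) x)"

lemma symb_add: "symb k (\<lambda>J. c J + d J) w = symb k c w + symb k d w"
  by (induction k arbitrary: c d) (simp_all add: scaleR_add_right sum.distrib)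

lemma symb_linear:
  assumes "bounded_linear h"
  shows "symb k (\<lambda>J. h (c J)) w = h (symb k c w)"
proof -
  interpret bounded_linear h by fact
  show ?thesis by (induction k arbitrary: c) (simp_all add: sum scaleR)
qed

lemma symb_zero: "symb k (\<lambda>J. 0) w = 0"
  by (induction k) simp_all

lemma symb_sum: "symb k (\<lambda>J. \<Sum>l\<in>S. c l J) w = (\<Sum>l\<in>S. symb k (c l) w)"
  by (induction S rule: infinite_finite_induct) (simp_all add: symb_zero symb_add)

lemma Dop_add_coeff: "Dop k (\<lambda>J. c J + d J) \<phi> x = Dop k c \<phi> x + Dop k d \<phi> x"
  by (induction k arbitrary: c d \<phi>) (simp_all add: scaleR_add_right sum.distrib)

lemma Dop_linear_coeff:
  assumes "bounded_linear h"
  shows "Dop k (\<lambda>J. h (c J)) \<phi> x = h (Dop k c \<phi> x)"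
proof -
  interpret bounded_linear h by fact
  show ?thesis by (induction k arbitrary: c \<phi>) (simp_all add: sum scaleR)
qed

lemma Dop_add:
  "C_order k f \<Longrightarrow> C_order k g \<Longrightarrow> Dop k c (\<lambda>x. f x + g x) x = Dop k c f x + Dop k c g x"
proof (induction k arbitrary: c f g)
  case (Suc k)
  then have "partial i (\<lambda>x. f x + g x) = (\<lambda>x. partial i f x + partial i g x)" for i
    by (auto simp: partial_add)
  with Suc show ?case by (simp add: sum.distrib)
qed (simp add: scaleR_add_left)

lemma Dop_cmult:
  "C_order k f \<Longrightarrow> Dop k c (\<lambda>x. a * f x) x = a *\<^sub>R Dop k c f x"
proof (induction k arbitrary: c f)
  case (Suc k)
  then have "partial i (\<lambda>x. a * f x) = (\<lambda>x. a * partial i f x)" for i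
    by (auto simp: partial_cmult)
  with Suc show ?case by (simp add: scaleR_sum_right)
qed simp

lemma Dop_sum:
  "(\<And>j. j \<in> S \<Longrightarrow> C_order k (f j)) \<Longrightarrow> Dop k c (\<lambda>x. \<Sum>j\<in>S. f j x) x = (\<Sum>j\<in>S. Dop k c (f j) x)"
proof (induction S rule: infinite_finite_induct)
  case (insert a S)
  then have "Dop k c (\<lambda>x. f a x + (\<Sum>j\<in>S. f j x)) x = Dop k c (f a) x + Dop k c (\<lambda>x. \<Sum>j\<in>S. f j x) x"
    by (intro Dop_add C_order_sum) auto
  with insert show ?case by simp
next
  case empty
  show ?case using Dop_cmult[of k "\<lambda>_. 0" c 0 x] by simp
next
  case (infinite S)
  then show ?case using Dop_cmult[of k "\<lambda>_. 0" c 0 x] by simp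
qed

lemma Dop_cong_open:
  assumes "open U" "x \<in> U" "\<And>y. y \<in> U \<Longrightarrow> f y = g y"
  shows "Dop k c f x = Dop k c g x"
  using assms(2,3)
proof (induction k arbitrary: c f g x)
  case (Suc k)
  show ?case
    unfolding Dop.simps
    by (intro sum.cong refl Suc.IH[OF Suc.prems(1)] partial_cong_open[OF assms(1) _ Suc.prems(2)])
qed simp

lemma continuous_Dop:
  "C_order k f \<Longrightarrow> continuous_on UNIV (Dop k c f)"
proof (induction k arbitrary: c f)
  case 0
  have "Dop 0 c f = (\<lambda>x. f x *\<^sub>R c [])" by (rule ext) simp
  then show ?case using 0 by (auto intro!: continuous_intros)
next
  case (Suc k)
  have "Dop (Suc k) c f = (\<lambda>x. \<Sum>i\<in>UNIV. Dop k (\<lambda>J. c (i # J)) (partial i f) x)" by (rule ext) simp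
  then show ?case using Suc by (auto intro!: continuous_intros)
qed

lemma C_order_Dop:
  fixes c :: "'n::finite list \<Rightarrow> real"
  shows "C_order (k + j) f \<Longrightarrow> C_order j (Dop k c f)"
proof (induction k arbitrary: c f)
  case 0
  have "Dop 0 c f = (\<lambda>x. c [] * f x)" by (rule ext) simp
  then show ?case using 0 by (auto intro!: C_order_cmult)
next
  case (Suc k)
  have "Dop (Suc k) c f = (\<lambda>x. \<Sum>i\<in>UNIV. Dop k (\<lambda>J. c (i # J)) (partial i f) x)" by (rule ext) simp
  then show ?case using Suc by (auto intro!: C_order_sum)
qed

lemma partial_Dop:
  fixes c :: "'n::finite list \<Rightarrow> real"
  shows "C_order (Suc k) f \<Longrightarrow> partial i (Dop k c f) = Dop k c (partial i f)"
proof (induction k arbitrary: c f)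
  case 0
  have "Dop 0 c f = (\<lambda>x. c [] * f x)" by (rule ext) simp
  then show ?case using 0 by (auto simp: partial_cmult)
next
  case (Suc k)
  have eq: "Dop (Suc k) c f = (\<lambda>x. \<Sum>i\<in>UNIV. Dop k (\<lambda>J. c (i # J)) (partial i f) x)" by (rule ext) simp
  have "C_order 1 (Dop k (\<lambda>J. c (j # J)) (partial j f))" for j
    using Suc.prems by (intro C_order_Dop) simp
  then have d: "Dop k (\<lambda>J. c (j # J)) (partial j f) differentiable (at x)" for x j
    by simp
  have "C_order 2 f" using C_order_mono[OF Suc.prems, of 2] by simp
  then have comm: "partial i (partial j f) = partial j (partial i f)" for j
    by (rule partial_commute)
  show ?case
  proof
    fix x
    have "partial i (Dop (Suc k) c f) x = (\<Sum>j\<in>UNIV. partial i (Dop k (\<lambda>J. c (j # J)) (partial j f)) x)"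
      unfolding eq by (rule partial_sum[OF d])
    also have "\<dots> = (\<Sum>j\<in>UNIV. Dop k (\<lambda>J. c (j # J)) (partial j (partial i f)) x)"
      using Suc by (simp add: comm)
    finally show "partial i (Dop (Suc k) c f) x = Dop (Suc k) c (partial i f) x" by simp
  qed
qed

text \<open>Coefficients of the \<open>j\<close>-th partial derivative of a symbol: \<open>j\<close> is inserted at every position of the word.\<close>

fun dcoeff :: "'n \<Rightarrow> ('n list \<Rightarrow> 'b) \<Rightarrow> 'n list \<Rightarrow> 'b::real_normed_vector" where
  "dcoeff j c [] = c [j]"
| "dcoeff j c (i # J) = c (j # i # J) + dcoeff j (\<lambda>K. c (i # K)) J"

section \<open>Euler's identity, and operators with vanishing symbol\<close>

lemma has_derivative_symb:
  fixes c :: "'n::finite list \<Rightarrow> 'b::real_normed_vector"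
  shows "symb (Suc k) c differentiable (at w) \<and> partial j (symb (Suc k) c) w = symb k (dcoeff j c) w"
proof (induction k arbitrary: c)
  case 0
  have eq: "symb (Suc 0) c = (\<lambda>w. \<Sum>i\<in>UNIV. (w $ i) *\<^sub>R c [i])" by (rule ext) simp
  have "((\<lambda>w. \<Sum>i\<in>UNIV. (w $ i) *\<^sub>R c [i]) has_derivative (\<lambda>w. \<Sum>i\<in>UNIV. (w $ i) *\<^sub>R c [i])) (at w)"
    by (intro has_derivative_sum bounded_linear.has_derivative[OF bounded_linear_scaleR_left]
      bounded_linear_imp_has_derivative bounded_linear_vec_nth)
  then show ?case
    unfolding eq
    by (auto simp: partial_has_derivative differentiable_def axis_def if_distrib[of "\<lambda>a. a *\<^sub>R _"] cong: if_cong)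
next
  case (Suc k)
  let ?s = "\<lambda>i. symb (Suc k) (\<lambda>J. c (i # J))"
  have eq: "symb (Suc (Suc k)) c = (\<lambda>w. \<Sum>i\<in>UNIV. (w $ i) *\<^sub>R ?s i w)" by (rule ext) simp
  have "((\<lambda>w. \<Sum>i\<in>UNIV. (w $ i) *\<^sub>R ?s i w) has_derivative
     (\<lambda>h. \<Sum>i\<in>UNIV. (w $ i) *\<^sub>R frechet_derivative (?s i) (at w) h + (h $ i) *\<^sub>R ?s i w)) (at w)"
    using Suc by (intro has_derivative_sum has_derivative_scaleR has_derivative_frechet
      bounded_linear_imp_has_derivative bounded_linear_vec_nth) blast+
  note d = this
  have "partial j (symb (Suc (Suc k)) c) w
     = (\<Sum>i\<in>UNIV. (w $ i) *\<^sub>R partial j (?s i) w + (axis j 1 $ i) *\<^sub>R ?s i w)"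
    unfolding eq by (subst partial_has_derivative[OF d]) (simp add: partial_def)
  also have "\<dots> = (\<Sum>i\<in>UNIV. (w $ i) *\<^sub>R symb k (dcoeff j (\<lambda>J. c (i # J))) w) + ?s j w"
    using Suc by (simp add: sum.distrib axis_def if_distrib[of "\<lambda>a. a *\<^sub>R _"] cong: if_cong del: symb.simps)
  also have "\<dots> = (\<Sum>i\<in>UNIV. (w $ i) *\<^sub>R symb k (\<lambda>J. dcoeff j c (i # J)) w)"
    by (simp add: symb_add sum.distrib scaleR_add_right)
  finally show ?case
    using d unfolding eq by (auto simp: differentiable_def)
qed

text \<open>Euler's identity for homogeneous polynomials of degree \<open>Suc k\<close>, read for
  operators: \<open>dcoeff\<close> inserts j at each of \<open>Suc k\<close> positions, and since
  partial derivatives commute each position yields the same operator.\<close>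

lemma Dop_dcoeff:
  assumes "C_order (Suc k) \<psi>"
  shows "(\<Sum>j\<in>UNIV. Dop k (dcoeff j c) (partial j \<psi>) x) = real (Suc k) *\<^sub>R Dop (Suc k) c \<psi> x"
  using assms
proof (induction k arbitrary: c \<psi>)
  case (Suc k)
  have "C_order 2 \<psi>" using C_order_mono[OF Suc.prems, of 2] by simp
  then have comm: "partial i (partial j \<psi>) = partial j (partial i \<psi>)" for i j
    by (rule partial_commute)
  have "(\<Sum>j\<in>UNIV. Dop (Suc k) (dcoeff j c) (partial j \<psi>) x)
     = (\<Sum>j\<in>UNIV. \<Sum>i\<in>UNIV. Dop k (\<lambda>J. c (j # i # J)) (partial i (partial j \<psi>)) x)
       + (\<Sum>j\<in>UNIV. \<Sum>i\<in>UNIV. Dop k (dcoeff j (\<lambda>K. c (i # K))) (partial i (partial j \<psi>)) x)"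
    by (simp add: Dop_add_coeff sum.distrib)
  also have "(\<Sum>j\<in>UNIV. \<Sum>i\<in>UNIV. Dop k (\<lambda>J. c (j # i # J)) (partial i (partial j \<psi>)) x) = Dop (Suc (Suc k)) c \<psi> x"
    by simp
  also have "(\<Sum>j\<in>UNIV. \<Sum>i\<in>UNIV. Dop k (dcoeff j (\<lambda>K. c (i # K))) (partial i (partial j \<psi>)) x)
     = (\<Sum>i\<in>UNIV. \<Sum>j\<in>UNIV. Dop k (dcoeff j (\<lambda>K. c (i # K))) (partial j (partial i \<psi>)) x)"
    by (subst sum.swap) (simp add: comm)
  also have "\<dots> = (\<Sum>i\<in>UNIV. real (Suc k) *\<^sub>R Dop (Suc k) (\<lambda>K. c (i # K)) (partial i \<psi>) x)"
    using Suc.prems by (intro sum.cong refl Suc.IH) simp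
  also have "\<dots> = real (Suc k) *\<^sub>R Dop (Suc (Suc k)) c \<psi> x"
    by (simp only: Dop.simps(2)[of "Suc k"] scaleR_sum_right)
  finally show ?case by (simp add: scaleR_add_left scaleR_2 del: Dop.simps)
qed simp

text \<open>Coefficients need not vanish with their polynomial: c [i, j] = - c [j, i] has symbol 0.
  The derivatives of the zero polynomial are zero, so induction applies to the families
  \<open>dcoeff j c\<close> of lower degree, and Euler's identity divides out the factor
  \<open>Suc k\<close>.\<close>

lemma Dop_eq_0_if_symb_eq_0:
  assumes "\<And>w. symb k c w = 0" "C_order k \<psi>"
  shows "Dop k c \<psi> x = 0"
  using assms
proof (induction k arbitrary: c \<psi>)
  case (Suc k)
  have "symb (Suc k) c = (\<lambda>w. 0)" using Suc.prems(1) by blast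
  then have "symb k (dcoeff j c) w = 0" for j w
    using has_derivative_symb[of k c w j] by simp
  then have "(\<Sum>j\<in>UNIV. Dop k (dcoeff j c) (partial j \<psi>) x) = 0"
    using Suc.prems(2) by (intro sum.neutral ballI Suc.IH) auto
  then show ?case
    using Dop_dcoeff[OF Suc.prems(2), of c x] by (simp del: Dop.simps)
qed simp

section \<open>Integration by parts and the weak formulation\<close>

definition vanishes_off :: "'a set \<Rightarrow> ('a \<Rightarrow> 'b::zero) \<Rightarrow> bool" where
  "vanishes_off S f \<longleftrightarrow> (\<forall>x. x \<notin> S \<longrightarrow> f x = 0)"

lemma partial_vanishes_off:
  assumes "closed S" "vanishes_off S f"
  shows "vanishes_off S (partial i f)"
  unfolding vanishes_off_def
proof (intro allI impI)
  fix x assume "x \<notin> S"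
  then have "partial i f x = partial i (\<lambda>_. 0) x"
    using assms by (intro partial_cong_open[of "- S"]) (auto simp: vanishes_off_def)
  then show "partial i f x = 0" by simp
qed

lemma Dop_vanishes_off:
  assumes "closed S"
  shows "vanishes_off S f \<Longrightarrow> vanishes_off S (Dop k c f)"
proof (induction k arbitrary: c f)
  case (Suc k)
  have "vanishes_off S (Dop k (\<lambda>J. c (i # J)) (partial i f))" for i
    by (rule Suc.IH[OF partial_vanishes_off[OF assms Suc.prems]])
  then show ?case by (simp add: vanishes_off_def)
qed (simp add: vanishes_off_def)

lemma integrable_continuous_vanishes_off:
  fixes f :: "'a::euclidean_space \<Rightarrow> 'b::euclidean_space"
  assumes "continuous_on UNIV f" "vanishes_off S f" "compact S"
  shows "integrable lebesgue f"
proof -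
  have "integrable lborel (\<lambda>x. indicator S x *\<^sub>R f x)"
    using assms by (intro borel_integrable_compact) (auto intro: continuous_on_subset)
  also have "(\<lambda>x. indicator S x *\<^sub>R f x) = f"
    using assms(2) by (auto simp: vanishes_off_def indicator_def)
  finally have "integrable lborel f" .
  then show ?thesis by (simp add: integrable_completion borel_measurable_integrable)
qed

lemma continuous_borel_lebesgue:
  fixes f :: "'a::euclidean_space \<Rightarrow> 'b::euclidean_space"
  assumes "continuous_on UNIV f"
  shows "f \<in> borel_measurable lebesgue"
  using borel_measurable_continuous_onI[OF assms] by (simp add: measurable_completion)

lemma bounded_continuous_vanishes_off:
  fixes f :: "'a::euclidean_space \<Rightarrow> 'b::real_normed_vector"
  assumes "continuous_on UNIV f" "vanishes_off S f" "compact S"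
  obtains M where "M > 0" "\<And>x. norm (f x) \<le> M"
proof -
  have "compact (f ` S)"
    using assms by (intro compact_continuous_image) (auto intro: continuous_on_subset)
  then obtain M where "M > 0" "\<And>y. y \<in> f ` S \<Longrightarrow> norm y \<le> M"
    using bounded_pos compact_imp_bounded by metis
  then show thesis
    using assms(2) that[of M] unfolding vanishes_off_def by (metis image_eqI less_imp_le norm_zero)
qed

lemma integral_lebesgue_translation:
  fixes f :: "'a::euclidean_space \<Rightarrow> 'b::euclidean_space"
  assumes "f \<in> borel_measurable borel"
  shows "(LINT x|lebesgue. f (x + a)) = (LINT x|lebesgue. f x)"
proof -
  have "(LINT x|lborel. f x) = (LINT x|distr lborel borel ((+) a). f x)"
    by (simp add: lborel_distr_plus)
  also have "\<dots> = (LINT x|lborel. f (a + x))"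
    using assms by (subst integral_distr) auto
  finally have "(LINT x|lborel. f x) = (LINT x|lborel. f (x + a))" by (simp add: add.commute)
  moreover have "(\<lambda>x. f (x + a)) \<in> borel_measurable borel"
    using assms by measurable
  ultimately show ?thesis using assms by (simp add: integral_completion)
qed

text \<open>Difference quotients have integral zero by translation invariance, and they converge to
  the partial derivative under a fixed integrable bound from the mean value theorem. No iterated
  integration is involved.\<close>

lemma integral_partial_eq_0:
  fixes f :: "real^'n::finite \<Rightarrow> real"
  assumes f: "C_order 1 f" and v: "vanishes_off (cball 0 R) f"
  shows "(LINT x|lebesgue. partial i f x) = 0"
proof -
  have cf: "continuous_on UNIV f" using C_order_continuous[OF f] .
  have cp: "continuous_on UNIV (partial j f)" for j using f by simp
  have d: "f differentiable (at x)" for x using f by simp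
  have int: "integrable lebesgue f"
    by (rule integrable_continuous_vanishes_off[OF cf v compact_cball])
  obtain M where M: "M > 0" "\<And>x. norm (partial i f x) \<le> M"
    using bounded_continuous_vanishes_off[OF cp partial_vanishes_off[OF closed_cball v] compact_cball] by metis
  \<comment> \<open>Steps of at most 1 keep all quotients supported in the ball of radius R +
    1.\<close>
  define h where "h n = 1 / real (Suc n)" for n
  have h: "h n > 0" "h n \<le> 1" for n by (auto simp: h_def divide_simps)
  have h0: "h \<longlonglongrightarrow> 0" unfolding h_def using LIMSEQ_inverse_real_of_nat by (simp add: inverse_eq_divide)
  define q where "q n x = (f (x + h n *\<^sub>R axis i 1) - f x) / h n" for n x
  have cfs: "continuous_on UNIV (\<lambda>x. f (x + a))" for a
    by (intro continuous_on_compose2[OF cf] continuous_intros) auto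
  have vs: "vanishes_off (cball 0 (R + 1)) (\<lambda>x. f (x + h n *\<^sub>R axis i 1))" for n
    unfolding vanishes_off_def
  proof (intro allI impI)
    fix x :: "real^'n" assume "x \<notin> cball 0 (R + 1)"
    then have "norm x > R + 1" by simp
    moreover have "norm x \<le> norm (x + h n *\<^sub>R axis i 1) + norm (h n *\<^sub>R axis i (1::real) :: real^'n)"
      by (metis add_diff_cancel_right' norm_triangle_ineq4)
    ultimately have "norm (x + h n *\<^sub>R axis i 1) > R" using h[of n] by simp
    then show "f (x + h n *\<^sub>R axis i 1) = 0" using v by (simp add: vanishes_off_def)
  qed
  have ints: "integrable lebesgue (\<lambda>x. f (x + h n *\<^sub>R axis i 1))" for n
    by (rule integrable_continuous_vanishes_off[OF cfs vs compact_cball])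
  have q0: "(LINT x|lebesgue. q n x) = 0" for n
  proof -
    have "(LINT x|lebesgue. f (x + h n *\<^sub>R axis i 1)) = (LINT x|lebesgue. f x)"
      by (rule integral_lebesgue_translation) (use cf in \<open>auto intro: borel_measurable_continuous_onI\<close>)
    then show ?thesis unfolding q_def using int ints[of n] by simp
  qed
  have "(\<lambda>n. LINT x|lebesgue. q n x) \<longlonglongrightarrow> (LINT x|lebesgue. partial i f x)"
  proof (rule integral_dominated_convergence)
    show "partial i f \<in> borel_measurable lebesgue" by (rule continuous_borel_lebesgue[OF cp])
    show "q n \<in> borel_measurable lebesgue" for n
      unfolding q_def using continuous_borel_lebesgue[OF cf] continuous_borel_lebesgue[OF cfs] by measurable
    show "integrable lebesgue (\<lambda>x::real^'n. M * indicator (cball 0 (R + 1)) x :: real)"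
      using emeasure_lborel_cball_finite[of "0 :: real^'n" "R + 1"]
      by (intro integrable_mult_right) (simp add: integrable_indicator_iff)
    show "AE x in lebesgue. (\<lambda>n. q n x) \<longlonglongrightarrow> partial i f x"
    proof (rule AE_I2)
      fix x
      have "((\<lambda>s. f (x + s *\<^sub>R axis i 1)) has_real_derivative partial i f x) (at 0)"
        using partial_line[of f x 0 i] d by simp
      then have "((\<lambda>s. (f (x + s *\<^sub>R axis i 1) - f x) / s) \<longlongrightarrow> partial i f x) (at 0)"
        by (simp add: has_field_derivative_iff)
      then show "(\<lambda>n. q n x) \<longlonglongrightarrow> partial i f x"
        unfolding q_def
        by (rule filterlim_compose[where g = "\<lambda>s. (f (x + s *\<^sub>R axis i 1) - f x) / s"])
          (use h0 h in \<open>auto simp: filterlim_at less_imp_neq[symmetric]\<close>)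
    qed
    show "AE x in lebesgue. norm (q n x) \<le> M * indicator (cball 0 (R + 1)) x" for n
    proof (rule AE_I2)
      fix x
      show "norm (q n x) \<le> M * indicator (cball 0 (R + 1)) x"
      proof (cases "x \<in> cball 0 (R + 1)")
        case False
        then have "f (x + h n *\<^sub>R axis i 1) = 0" "f x = 0"
          using vs[of n] v by (auto simp: vanishes_off_def)
        with False show ?thesis by (simp add: q_def)
      next
        case True
        have "\<exists>z. z > 0 \<and> z < h n \<and> f (x + h n *\<^sub>R axis i 1) - f (x + 0 *\<^sub>R axis i 1)
            = (h n - 0) * partial i f (x + z *\<^sub>R axis i 1)"
          by (rule MVT2[OF h(1)[of n]]) (rule partial_line[OF d])
        then obtain z where "f (x + h n *\<^sub>R axis i 1) - f x = h n * partial i f (x + z *\<^sub>R axis i 1)" by auto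
        then have "q n x = partial i f (x + z *\<^sub>R axis i 1)" using h(1)[of n] by (simp add: q_def)
        then show ?thesis using M True by simp
      qed
    qed
  qed
  then show ?thesis using q0 by (simp add: LIMSEQ_const_iff)
qed

lemma integral_by_parts_partial:
  fixes f g :: "real^'n::finite \<Rightarrow> real"
  assumes f: "C_order 1 f" and g: "C_order 1 g" and v: "vanishes_off (cball 0 R) g"
  shows "(LINT x|lebesgue. partial i f x * g x) = - (LINT x|lebesgue. f x * partial i g x)"
proof -
  have d: "f differentiable (at x)" "g differentiable (at x)" for x using f g by auto
  have c: "continuous_on UNIV f" "continuous_on UNIV g" by (rule C_order_continuous[OF f], rule C_order_continuous[OF g])
  have c': "continuous_on UNIV (partial i f)" "continuous_on UNIV (partial i g)" using f g by auto
  have v': "vanishes_off (cball 0 R) (partial i g)" by (rule partial_vanishes_off[OF closed_cball v])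
  have i1: "integrable lebesgue (\<lambda>x. partial i f x * g x)"
    by (rule integrable_continuous_vanishes_off[of _ "cball 0 R"])
      (use c c' v in \<open>auto simp: vanishes_off_def intro: continuous_on_mult\<close>)
  have i2: "integrable lebesgue (\<lambda>x. f x * partial i g x)"
    by (rule integrable_continuous_vanishes_off[of _ "cball 0 R"])
      (use c c' v' in \<open>auto simp: vanishes_off_def intro: continuous_on_mult\<close>)
  have "(LINT x|lebesgue. partial i (\<lambda>x. f x * g x) x) = 0"
    by (rule integral_partial_eq_0[of _ R])
      (use v in \<open>auto simp: vanishes_off_def simp del: C_order.simps One_nat_def intro!: C_order_mult f g\<close>)
  moreover have "partial i (\<lambda>x. f x * g x) = (\<lambda>x. f x * partial i g x + partial i f x * g x)"
    using partial_mult[OF d] by blast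
  ultimately show ?thesis using i1 i2 by simp
qed

lemma Dop_by_parts:
  fixes e :: "'n::finite list \<Rightarrow> real"
  assumes "C_order k f" "C_order k g" "vanishes_off (cball 0 R) g"
  shows "(LINT x|lebesgue. Dop k e f x * g x) = (-1) ^ k * (LINT x|lebesgue. f x * Dop k e g x)"
  using assms
proof (induction k arbitrary: e f g)
  case 0
  then show ?case by (simp add: mult_ac)
next
  case (Suc k)
  let ?e = "\<lambda>i J. e (i # J)"
  have gk: "C_order k g" by (rule C_order_Suc_imp[OF Suc.prems(2)])
  have f1: "C_order 1 f" using C_order_mono[OF Suc.prems(1), of 1] by simp
  have D1: "C_order 1 (Dop k (?e i) g)" for i by (rule C_order_Dop) (use Suc.prems in simp)
  have vD: "vanishes_off (cball 0 R) (Dop k (?e i) g)" for i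
    by (rule Dop_vanishes_off[OF closed_cball Suc.prems(3)])
  have c1: "continuous_on UNIV (Dop k (?e i) (partial i f))" for i
    using Suc.prems(1) by (intro continuous_Dop) simp
  have cg: "continuous_on UNIV g" by (rule C_order_continuous[OF gk])
  have cf: "continuous_on UNIV f" by (rule C_order_continuous[OF f1])
  have int1: "integrable lebesgue (\<lambda>x. Dop k (?e i) (partial i f) x * g x)" for i
    by (rule integrable_continuous_vanishes_off[of _ "cball 0 R"])
      (use c1 cg Suc.prems(3) in \<open>auto simp: vanishes_off_def intro: continuous_on_mult\<close>)
  have c2: "continuous_on UNIV (Dop k (?e i) (partial i g))" for i
    using Suc.prems(2) by (intro continuous_Dop) simp
  have v2: "vanishes_off (cball 0 R) (Dop k (?e i) (partial i g))" for i
    by (intro Dop_vanishes_off partial_vanishes_off closed_cball Suc.prems(3))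
  have int2: "integrable lebesgue (\<lambda>x. f x * Dop k (?e i) (partial i g) x)" for i
    by (rule integrable_continuous_vanishes_off[of _ "cball 0 R"])
      (use c2 cf v2 in \<open>auto simp: vanishes_off_def intro: continuous_on_mult\<close>)
  have "(LINT x|lebesgue. Dop k (?e i) (partial i f) x * g x)
     = (-1) ^ Suc k * (LINT x|lebesgue. f x * Dop k (?e i) (partial i g) x)" for i
  proof -
    have "(LINT x|lebesgue. Dop k (?e i) (partial i f) x * g x)
       = (-1) ^ k * (LINT x|lebesgue. partial i f x * Dop k (?e i) g x)"
      using Suc.prems(1) by (intro Suc.IH gk Suc.prems(3)) simp
    also have "\<dots> = (-1) ^ Suc k * (LINT x|lebesgue. f x * partial i (Dop k (?e i) g) x)"
      by (simp add: integral_by_parts_partial[OF f1 D1 vD])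
    also have "partial i (Dop k (?e i) g) = Dop k (?e i) (partial i g)"
      by (rule partial_Dop[OF Suc.prems(2)])
    finally show ?thesis .
  qed
  then show ?case
    using int1 int2 by (simp add: sum_distrib_right sum_distrib_left Bochner_Integration.integral_sum
      sum_negf del: power_Suc)
qed

text \<open>Source of the mean-zero property of all constructed fields. In the application the order
  of the operator is m, the number of rows, hence positive.\<close>

lemma integral_Dop_eq_0:
  fixes c :: "'n::finite list \<Rightarrow> 'b::euclidean_space"
  assumes "C_order (Suc k) f" "vanishes_off (cball 0 R) f"
  shows "(LINT x|lebesgue. Dop (Suc k) c f x) = 0"
  using assms
proof (induction k arbitrary: c f)
  case 0
  have "integrable lebesgue (partial i f)" for i
    using 0 by (intro integrable_continuous_vanishes_off[of _ "cball 0 R"] partial_vanishes_off) auto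
  moreover have "(LINT x|lebesgue. partial i f x) = 0" for i
    using 0 by (intro integral_partial_eq_0[of f R]) simp_all
  ultimately show ?case by simp
next
  case (Suc k)
  have c: "continuous_on UNIV (Dop (Suc k) (\<lambda>J. c (i # J)) (partial i f))" for i
    by (intro continuous_Dop C_order_partial[OF Suc.prems(1)])
  have "integrable lebesgue (Dop (Suc k) (\<lambda>J. c (i # J)) (partial i f))" for i
    by (intro integrable_continuous_vanishes_off[OF c, of "cball 0 R"] Dop_vanishes_off
        partial_vanishes_off Suc.prems(2) closed_cball compact_cball)
  moreover have "(LINT x|lebesgue. Dop (Suc k) (\<lambda>J. c (i # J)) (partial i f) x) = 0" for i
    by (intro Suc.IH partial_vanishes_off closed_cball Suc.prems(2) C_order_partial[OF Suc.prems(1)])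
  ultimately show ?case by (subst Dop.simps) (simp del: Dop.simps)
qed

lemma test_function_vanishes_off:
  assumes "test_function \<psi>"
  obtains R where "vanishes_off (cball 0 R) \<psi>"
proof -
  have "bounded {x. \<psi> x \<noteq> 0}"
    by (rule bounded_subset[OF compact_imp_bounded closure_subset])
      (use assms in \<open>simp add: test_function_def\<close>)
  then obtain R where "\<And>x. \<psi> x \<noteq> 0 \<Longrightarrow> norm x \<le> R" by (auto simp: bounded_iff)
  then show thesis by (intro that[of R]) (auto simp: vanishes_off_def)
qed

lemma test_function_C_order: "test_function \<psi> \<Longrightarrow> C_order k \<psi>"
  by (simp add: test_function_def)

lemma integrable_partial_test_function:
  fixes \<psi> :: "real^'n::finite \<Rightarrow> real^'m::finite"
  assumes "test_function \<psi>"
  shows "integrable lebesgue (partial i \<psi>)"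
proof -
  obtain R where "vanishes_off (cball 0 R) \<psi>" using test_function_vanishes_off[OF assms] .
  moreover have "continuous_on UNIV (partial i \<psi>)"
    using test_function_C_order[OF assms, of 1] by simp
  ultimately show ?thesis
    by (intro integrable_continuous_vanishes_off[of _ "cball 0 R"] partial_vanishes_off) auto
qed

section \<open>Stability of the weak equation under sums and limits\<close>

definition bounded_measurable :: "('a::euclidean_space \<Rightarrow> 'b::euclidean_space) \<Rightarrow> bool" where
  "bounded_measurable u \<longleftrightarrow> u \<in> borel_measurable lebesgue \<and> bounded (range u)"

lemma bounded_measurable_add: "bounded_measurable u \<Longrightarrow> bounded_measurable v \<Longrightarrow> bounded_measurable (\<lambda>x. u x + v x)"
  unfolding bounded_measurable_def by (auto intro!: bounded_plus_comp)

lemma bounded_measurable_diff: "bounded_measurable u \<Longrightarrow> bounded_measurable v \<Longrightarrow> bounded_measurable (\<lambda>x. u x - v x)"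
  unfolding bounded_measurable_def by (auto intro!: bounded_minus_comp)

lemma bounded_measurable_const [simp]: "bounded_measurable (\<lambda>x. c)"
  unfolding bounded_measurable_def by simp

lemma norm_matrix_vector_le: "norm (A *v x) \<le> onorm ((*v) A) * norm (x :: real^'d)"
  by (rule onorm[OF matrix_vector_mul_bounded_linear])

lemma onorm_matrix_nonneg: "0 \<le> onorm ((*v) (A :: real^'d^'m))"
  by (rule onorm_pos_le[OF matrix_vector_mul_bounded_linear])

lemma measurable_matrix_vector:
  fixes A :: "real^'d^'m"
  assumes "u \<in> borel_measurable M"
  shows "(\<lambda>x. A *v u x) \<in> borel_measurable M"
  by (rule measurable_compose[OF assms borel_measurable_continuous_onI[OF matrix_vector_mult_linear_continuous_on]])

lemma distr_integrand_bound:
  fixes A :: "'n::finite \<Rightarrow> real^'d^'m" and u :: "real^'d"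
  assumes "norm u \<le> M"
  shows "norm (\<Sum>i\<in>UNIV. (A i *v u) \<bullet> p i) \<le> (\<Sum>i\<in>UNIV. onorm ((*v) (A i)) * M * norm (p i))"
proof (rule sum_norm_le)
  fix i
  have "norm ((A i *v u) \<bullet> p i) \<le> norm (A i *v u) * norm (p i)" by (simp add: Cauchy_Schwarz_ineq2)
  also have "\<dots> \<le> onorm ((*v) (A i)) * M * norm (p i)"
    by (rule mult_right_mono[OF order_trans[OF norm_matrix_vector_le mult_left_mono[OF assms onorm_matrix_nonneg]]]) simp
  finally show "norm ((A i *v u) \<bullet> p i) \<le> onorm ((*v) (A i)) * M * norm (p i)" .
qed

lemma distr_dominant_integrable:
  fixes A :: "'n::finite \<Rightarrow> real^'d^'m" and \<psi> :: "real^'n \<Rightarrow> real^'m"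
  assumes "test_function \<psi>"
  shows "integrable lebesgue (\<lambda>x. \<Sum>i\<in>UNIV. onorm ((*v) (A i)) * M * norm (partial i \<psi> x))"
  by (intro Bochner_Integration.integrable_sum integrable_mult_right
      integrable_norm[OF integrable_partial_test_function[OF assms]])

lemma distr_integrand_measurable:
  fixes A :: "'n::finite \<Rightarrow> real^'d^'m"
  assumes "test_function \<psi>" "u \<in> borel_measurable lebesgue"
  shows "(\<lambda>x. \<Sum>i\<in>UNIV. (A i *v u x) \<bullet> partial i \<psi> x) \<in> borel_measurable lebesgue"
  by (intro borel_measurable_sum borel_measurable_inner measurable_matrix_vector assms(2)
      borel_measurable_integrable integrable_partial_test_function assms(1))

lemma distr_integrand_integrable:
  fixes A :: "'n::finite \<Rightarrow> real^'d^'m"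
  assumes "test_function \<psi>" "bounded_measurable u"
  shows "integrable lebesgue (\<lambda>x. \<Sum>i\<in>UNIV. (A i *v u x) \<bullet> partial i \<psi> x)"
proof -
  obtain M where M: "\<And>x. norm (u x) \<le> M"
    using assms(2) unfolding bounded_measurable_def bounded_iff by auto
  show ?thesis
  proof (rule Bochner_Integration.integrable_bound[OF distr_dominant_integrable[OF assms(1), of A M]])
    show "(\<lambda>x. \<Sum>i\<in>UNIV. (A i *v u x) \<bullet> partial i \<psi> x) \<in> borel_measurable lebesgue"
      using assms by (intro distr_integrand_measurable) (auto simp: bounded_measurable_def)
    show "AE x in lebesgue. norm (\<Sum>i\<in>UNIV. (A i *v u x) \<bullet> partial i \<psi> x)
       \<le> norm (\<Sum>i\<in>UNIV. onorm ((*v) (A i)) * M * norm (partial i \<psi> x))"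
      by (rule AE_I2, rule order_trans[OF distr_integrand_bound[OF M]]) (simp only: real_norm_def abs_ge_self)
  qed
qed

lemma distr_free_add:
  fixes A :: "'n::finite \<Rightarrow> real^'d^'m"
  assumes "bounded_measurable u" "bounded_measurable v" "distr_free A u" "distr_free A v"
  shows "distr_free A (\<lambda>x. u x + v x)"
  unfolding distr_free_def
proof (intro allI impI)
  fix \<psi> :: "real^'n \<Rightarrow> real^'m" assume \<psi>: "test_function \<psi>"
  have "(\<Sum>i\<in>UNIV. (A i *v (u x + v x)) \<bullet> partial i \<psi> x)
     = (\<Sum>i\<in>UNIV. (A i *v u x) \<bullet> partial i \<psi> x) + (\<Sum>i\<in>UNIV. (A i *v v x) \<bullet> partial i \<psi> x)" for x
    by (simp add: matrix_vector_right_distrib inner_add_left sum.distrib)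
  then have "distr_op A (\<lambda>x. u x + v x) \<psi> = distr_op A u \<psi> + distr_op A v \<psi>"
    unfolding distr_op_def
    using distr_integrand_integrable[OF \<psi> assms(1), of A] distr_integrand_integrable[OF \<psi> assms(2), of A]
    by simp
  then show "distr_op A (\<lambda>x. u x + v x) \<psi> = 0"
    using assms \<psi> by (simp add: distr_free_def)
qed

lemma distr_free_const:
  fixes A :: "'n::finite \<Rightarrow> real^'d^'m"
  shows "distr_free A (\<lambda>x. \<xi>)"
  unfolding distr_free_def
proof (intro allI impI)
  fix \<psi> :: "real^'n \<Rightarrow> real^'m" assume \<psi>: "test_function \<psi>"
  obtain R where R: "vanishes_off (cball 0 R) \<psi>" using test_function_vanishes_off[OF \<psi>] .
  have C: "C_order 1 \<psi>" by (rule test_function_C_order[OF \<psi>])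
  have 0: "(LINT x|lebesgue. a \<bullet> partial i \<psi> x) = 0" for a i
  proof -
    have "(LINT x|lebesgue. partial i (\<lambda>x. a \<bullet> \<psi> x) x) = 0"
      by (rule integral_partial_eq_0[of _ R], rule C_order_bounded_linear[OF bounded_linear_inner_right C])
        (use R in \<open>simp add: vanishes_off_def\<close>)
    moreover have "partial i (\<lambda>x. a \<bullet> \<psi> x) x = a \<bullet> partial i \<psi> x" for x
      using C by (intro partial_bounded_linear[OF bounded_linear_inner_right]) simp
    ultimately show ?thesis by simp
  qed
  have "integrable lebesgue (\<lambda>x. a \<bullet> partial i \<psi> x)" for a i
    by (intro integrable_inner_right integrable_partial_test_function \<psi>)
  then show "distr_op A (\<lambda>x. \<xi>) \<psi> = 0"
    unfolding distr_op_def using 0 by (simp add: Bochner_Integration.integral_sum)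
qed

text \<open>Pointwise convergence and a uniform bound suffice, because the weak formulation puts all
  derivatives on the test function. This takes the place of any convergence of potentials.\<close>

lemma distr_free_limit:
  fixes A :: "'n::finite \<Rightarrow> real^'d^'m"
  assumes u: "\<And>n. u n \<in> borel_measurable lebesgue" "\<And>n x. norm (u n x) \<le> M"
    and free: "\<And>n. distr_free A (u n)" and lim: "\<And>x. (\<lambda>n. u n x) \<longlonglongrightarrow> v x"
  shows "distr_free A v"
  unfolding distr_free_def
proof (intro allI impI)
  fix \<psi> :: "real^'n \<Rightarrow> real^'m" assume \<psi>: "test_function \<psi>"
  have v: "v \<in> borel_measurable lebesgue" by (rule borel_measurable_LIMSEQ_metric[OF u(1) lim])
  have "(\<lambda>n. LINT x|lebesgue. (\<Sum>i\<in>UNIV. (A i *v u n x) \<bullet> partial i \<psi> x))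
      \<longlonglongrightarrow> (LINT x|lebesgue. (\<Sum>i\<in>UNIV. (A i *v v x) \<bullet> partial i \<psi> x))"
  proof (rule integral_dominated_convergence[OF _ _ distr_dominant_integrable[OF \<psi>, of A M]])
    show "AE x in lebesgue. (\<lambda>n. \<Sum>i\<in>UNIV. (A i *v u n x) \<bullet> partial i \<psi> x)
       \<longlonglongrightarrow> (\<Sum>i\<in>UNIV. (A i *v v x) \<bullet> partial i \<psi> x)"
      by (intro AE_I2 tendsto_sum tendsto_inner tendsto_const
          bounded_linear.tendsto[OF matrix_vector_mul_bounded_linear] lim)
  qed (intro AE_I2 distr_integrand_bound u(2) distr_integrand_measurable \<psi> u(1) v)+
  moreover have "(LINT x|lebesgue. (\<Sum>i\<in>UNIV. (A i *v u n x) \<bullet> partial i \<psi> x)) = 0" for n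
    using free[of n] \<psi> by (simp add: distr_free_def distr_op_def)
  ultimately show "distr_op A v \<psi> = 0"
    by (simp add: LIMSEQ_const_iff distr_op_def)
qed

lemma op_symbol_mult: "op_symbol A w *v x = (\<Sum>i\<in>UNIV. (w $ i) *\<^sub>R (A i *v x))"
proof -
  have "(\<Sum>i\<in>S. (w $ i) *\<^sub>R A i) *v x = (\<Sum>i\<in>S. (w $ i) *\<^sub>R (A i *v x))" for S
    by (induction S rule: infinite_finite_induct)
      (simp_all add: matrix_vector_mult_add_rdistrib scaleR_matrix_vector_assoc)
  then show ?thesis by (simp add: op_symbol_def)
qed

text \<open>The potential is only C^k, so A(D)b(D)\<phi> has no classical meaning. All k derivatives
  are therefore moved to the test function; what falls on its l-th component is the operator whose
  symbol is the l-th component of A(w)b(w), which vanishes identically.\<close>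

lemma distr_free_Dop:
  fixes A :: "'n::finite \<Rightarrow> real^'d^'m"
  assumes sym: "\<And>w. op_symbol A w *v symb k c w = 0" and \<phi>: "C_order k \<phi>"
  shows "distr_free A (Dop k c \<phi>)"
  unfolding distr_free_def
proof (intro allI impI)
  fix \<psi> :: "real^'n \<Rightarrow> real^'m" assume \<psi>: "test_function \<psi>"
  obtain R where R: "vanishes_off (cball 0 R) \<psi>" using test_function_vanishes_off[OF \<psi>] .
  define p where "p = (\<lambda>l x. \<psi> x $ l)"
  have Cp: "C_order j (p l)" for j l
    unfolding p_def by (rule C_order_bounded_linear[OF bounded_linear_vec_nth test_function_C_order[OF \<psi>]])
  have Cp': "C_order j (partial i (p l))" for j l i
    using Cp[of "Suc j"] by simp
  have vp: "vanishes_off (cball 0 R) (partial i (p l))" for i l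
    using R by (intro partial_vanishes_off closed_cball) (simp add: p_def vanishes_off_def)
  have pp: "partial i \<psi> x $ l = partial i (p l) x" for i l x
    unfolding p_def using test_function_C_order[OF \<psi>, of 1]
    by (subst partial_bounded_linear[OF bounded_linear_vec_nth]) simp_all
  define e where "e = (\<lambda>i l J. (A i *v c J) $ l)"
  have bl: "bounded_linear (\<lambda>x. (A i *v x) $ l)" for i l
    by (rule bounded_linear_compose[OF bounded_linear_vec_nth matrix_vector_mul_bounded_linear])
  have De: "(A i *v Dop k c \<phi> x) $ l = Dop k (e i l) \<phi> x" for i l x
    unfolding e_def by (rule Dop_linear_coeff[OF bl, symmetric])
  have eq: "(\<Sum>i\<in>UNIV. (A i *v Dop k c \<phi> x) \<bullet> partial i \<psi> x)
     = (\<Sum>i\<in>UNIV. \<Sum>l\<in>UNIV. Dop k (e i l) \<phi> x * partial i (p l) x)" for x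
    by (simp add: inner_vec_def De pp)
  have c1: "continuous_on UNIV (Dop k (e i l) \<phi>)" for i l by (rule continuous_Dop[OF \<phi>])
  have c2: "continuous_on UNIV (partial i (p l))" for i l by (rule C_order_continuous[OF Cp'])
  have c3: "continuous_on UNIV (Dop k (e i l) (partial i (p l)))" for i l by (rule continuous_Dop[OF Cp'])
  have cph: "continuous_on UNIV \<phi>" by (rule C_order_continuous[OF \<phi>])
  have v3: "vanishes_off (cball 0 R) (Dop k (e i l) (partial i (p l)))" for i l
    by (rule Dop_vanishes_off[OF closed_cball vp])
  have i1: "integrable lebesgue (\<lambda>x. Dop k (e i l) \<phi> x * partial i (p l) x)" for i l
    by (rule integrable_continuous_vanishes_off[of _ "cball 0 R"])
      (use c1 c2 vp in \<open>auto simp: vanishes_off_def intro: continuous_on_mult\<close>)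
  have i2: "integrable lebesgue (\<lambda>x. \<phi> x * Dop k (e i l) (partial i (p l)) x)" for i l
    by (rule integrable_continuous_vanishes_off[of _ "cball 0 R"])
      (use c3 cph v3 in \<open>auto simp: vanishes_off_def intro: continuous_on_mult\<close>)
  \<comment> \<open>Prepending the index i of the derivative in A to the word J multiplies the
    symbols, so \<open>d l\<close> represents the l-th component of A(w)b(w).\<close>
  define d where "d = (\<lambda>l I. case I of [] \<Rightarrow> 0 | i # J \<Rightarrow> e i l J)"
  have "symb (Suc k) (d l) w = 0" for l w
  proof -
    have "symb (Suc k) (d l) w = (\<Sum>i\<in>UNIV. w $ i * (A i *v symb k c w) $ l)"
      by (simp add: d_def e_def symb_linear[OF bl])
    also have "\<dots> = (op_symbol A w *v symb k c w) $ l"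
      by (simp add: op_symbol_mult sum_component)
    finally show ?thesis by (simp add: sym)
  qed
  then have D0: "Dop (Suc k) (d l) (p l) x = 0" for l x
    by (rule Dop_eq_0_if_symb_eq_0[OF _ Cp])
  have "(LINT x|lebesgue. (\<Sum>i\<in>UNIV. \<Sum>l\<in>UNIV. Dop k (e i l) \<phi> x * partial i (p l) x))
     = (\<Sum>i\<in>UNIV. \<Sum>l\<in>UNIV. (-1) ^ k * (LINT x|lebesgue. \<phi> x * Dop k (e i l) (partial i (p l)) x))"
    by (simp add: Bochner_Integration.integral_sum i1 Dop_by_parts[OF \<phi> Cp' vp])
  also have "\<dots> = (-1) ^ k * (LINT x|lebesgue. (\<Sum>l\<in>UNIV. \<Sum>i\<in>UNIV. \<phi> x * Dop k (e i l) (partial i (p l)) x))"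
    by (subst sum.swap) (simp add: Bochner_Integration.integral_sum i2 sum_distrib_left)
  also have "(\<lambda>x. \<Sum>l\<in>UNIV. \<Sum>i\<in>UNIV. \<phi> x * Dop k (e i l) (partial i (p l)) x)
     = (\<lambda>x. \<Sum>l\<in>UNIV. \<phi> x * Dop (Suc k) (d l) (p l) x)"
    by (simp add: d_def sum_distrib_left)
  also have "\<dots> = (\<lambda>x. 0)" by (simp add: D0 del: Dop.simps)
  finally show "distr_op A (Dop k c \<phi>) \<psi> = 0"
    by (simp add: distr_op_def eq)
qed

section \<open>Taylor polynomials and local modification\<close>

fun derivs_le :: "nat \<Rightarrow> real \<Rightarrow> (real^'n::finite \<Rightarrow> real) \<Rightarrow> (real^'n) set \<Rightarrow> bool" where
  "derivs_le 0 M f S = (\<forall>x\<in>S. \<bar>f x\<bar> \<le> M)"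
| "derivs_le (Suc k) M f S = ((\<forall>x\<in>S. \<bar>f x\<bar> \<le> M) \<and> (\<forall>i. derivs_le k M (partial i f) S))"

lemma derivs_le_bound: "derivs_le k M f S \<Longrightarrow> x \<in> S \<Longrightarrow> \<bar>f x\<bar> \<le> M"
  by (cases k) simp_all

lemma derivs_le_partial: "derivs_le (Suc k) M f S \<Longrightarrow> derivs_le k M (partial i f) S"
  by simp

lemma derivs_le_Suc_imp: "derivs_le (Suc k) M f S \<Longrightarrow> derivs_le k M f S"
proof (induction k arbitrary: f)
  case (Suc k)
  have "derivs_le k M (partial i f) S" for i
    by (rule Suc.IH[OF derivs_le_partial[OF Suc.prems]])
  with Suc.prems show ?case by simp
qed simp

lemma derivs_le_mono: "derivs_le k M f S \<Longrightarrow> M \<le> M' \<Longrightarrow> T \<subseteq> S \<Longrightarrow> derivs_le k M' f T"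
proof (induction k arbitrary: f)
  case (Suc k)
  have "derivs_le k M' (partial i f) T" for i
    using Suc.prems by (intro Suc.IH) simp_all
  with Suc.prems show ?case by force
qed force

lemma derivs_le_add:
  "C_order k f \<Longrightarrow> C_order k g \<Longrightarrow> derivs_le k M f S \<Longrightarrow> derivs_le k M' g S \<Longrightarrow> derivs_le k (M + M') (\<lambda>x. f x + g x) S"
proof (induction k arbitrary: f g)
  case 0
  then show ?case by (force intro: abs_triangle_ineq[THEN order_trans])
next
  case (Suc k)
  have eq: "partial i (\<lambda>x. f x + g x) = (\<lambda>x. partial i f x + partial i g x)" for i
    using Suc.prems(1,2) by (auto simp: partial_add)
  have "derivs_le k (M + M') (partial i (\<lambda>x. f x + g x)) S" for i
    unfolding eq using Suc.prems by (intro Suc.IH) simp_all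
  moreover have "\<bar>f x + g x\<bar> \<le> M + M'" if "x \<in> S" for x
    using derivs_le_bound[OF Suc.prems(3) that] derivs_le_bound[OF Suc.prems(4) that] by linarith
  ultimately show ?case by simp
qed

text \<open>Each differentiation splits a product into two products, which doubles the bound: hence
  2 ^ k.\<close>

lemma derivs_le_mult:
  "C_order k f \<Longrightarrow> C_order k g \<Longrightarrow> derivs_le k M f S \<Longrightarrow> derivs_le k M' g S \<Longrightarrow> 0 \<le> M \<Longrightarrow> 0 \<le> M' \<Longrightarrow>
   derivs_le k (2 ^ k * M * M') (\<lambda>x. f x * g x) S"
proof (induction k arbitrary: f g)
  case 0
  then show ?case by (auto simp: abs_mult intro: mult_mono)
next
  case (Suc k)
  have eq: "partial i (\<lambda>x. f x * g x) = (\<lambda>x. f x * partial i g x + partial i f x * g x)" for i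
    using Suc.prems(1,2) by (auto simp: partial_mult)
  have f: "C_order k f" and g: "C_order k g"
    by (rule C_order_Suc_imp[OF Suc.prems(1)], rule C_order_Suc_imp[OF Suc.prems(2)])
  have f': "C_order k (partial i f)" and g': "C_order k (partial i g)" for i
    using Suc.prems by simp_all
  have "derivs_le k (2 ^ k * M * M' + 2 ^ k * M * M') (partial i (\<lambda>x. f x * g x)) S" for i
    unfolding eq
    using Suc.prems f g f' g' derivs_le_Suc_imp[OF Suc.prems(3)] derivs_le_Suc_imp[OF Suc.prems(4)]
    by (intro derivs_le_add C_order_mult Suc.IH) simp_all
  moreover have "\<bar>f x * g x\<bar> \<le> 2 ^ Suc k * M * M'" if x: "x \<in> S" for x
  proof -
    have "\<bar>f x * g x\<bar> \<le> M * M'"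
      unfolding abs_mult
      by (rule mult_mono) (use derivs_le_bound[OF Suc.prems(3) x] derivs_le_bound[OF Suc.prems(4) x] Suc.prems in auto)
    also have "\<dots> \<le> 2 ^ Suc k * (M * M')"
      using mult_right_mono[OF one_le_power[of "2::real" "Suc k"] mult_nonneg_nonneg[OF Suc.prems(5,6)]] by simp
    finally show ?thesis by (simp add: mult_ac)
  qed
  ultimately show ?case by (simp add: mult_ac)
qed

text \<open>The l^1 norm of the coefficients over all words of length k.\<close>

fun Dnorm :: "nat \<Rightarrow> ('n::finite list \<Rightarrow> 'b::real_normed_vector) \<Rightarrow> real" where
  "Dnorm 0 c = norm (c [])"
| "Dnorm (Suc k) c = (\<Sum>i\<in>UNIV. Dnorm k (\<lambda>J. c (i # J)))"

lemma Dnorm_nonneg: "0 \<le> Dnorm k c"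
  by (induction k arbitrary: c) (simp_all add: sum_nonneg)

lemma Dop_bound: "derivs_le k M f S \<Longrightarrow> x \<in> S \<Longrightarrow> norm (Dop k c f x) \<le> Dnorm k c * M"
proof (induction k arbitrary: c f)
  case 0
  then have "\<bar>f x\<bar> \<le> M" by simp
  then show ?case by (simp add: mult.commute[of _ M] mult_right_mono)
next
  case (Suc k)
  then show ?case by (auto simp: sum_distrib_right intro!: sum_norm_le)
qed

lemma derivs_le_exists:
  "C_order k f \<Longrightarrow> vanishes_off S f \<Longrightarrow> compact S \<Longrightarrow> \<exists>M>0. derivs_le k M f UNIV"
proof (induction k arbitrary: f)
  case 0
  obtain M where "M > 0" "\<And>x. norm (f x) \<le> M"
    using bounded_continuous_vanishes_off[OF C_order_continuous[OF 0(1)] 0(2,3)] by blast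
  then show ?case by (intro exI[of _ M]) simp
next
  case (Suc k)
  obtain M0 where M0: "M0 > 0" "\<And>x. norm (f x) \<le> M0"
    using bounded_continuous_vanishes_off[OF C_order_continuous[OF Suc.prems(1)] Suc.prems(2,3)] by blast
  have "\<exists>M>0. derivs_le k M (partial i f) UNIV" for i
    by (intro Suc.IH C_order_partial[OF Suc.prems(1)] Suc.prems(3)
        partial_vanishes_off[OF compact_imp_closed[OF Suc.prems(3)] Suc.prems(2)])
  then have "\<forall>i. \<exists>M. M > 0 \<and> derivs_le k M (partial i f) UNIV" by blast
  then obtain M where "\<forall>i. M i > 0 \<and> derivs_le k (M i) (partial i f) UNIV" by (rule choice[THEN exE])
  then have M: "M i > 0" "derivs_le k (M i) (partial i f) UNIV" for i by blast+
  define K where "K = M0 + (\<Sum>i\<in>UNIV. M i)"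
  have nn: "(\<Sum>i\<in>UNIV. M i) \<ge> 0" using M(1) by (intro sum_nonneg) (auto intro: less_imp_le)
  have "M i \<le> K" for i
    using M0(1) member_le_sum[of i UNIV M] less_imp_le[OF M(1)] by (simp add: K_def)
  then have "derivs_le k K (partial i f) UNIV" for i by (intro derivs_le_mono[OF M(2)]) auto
  moreover have "\<bar>f x\<bar> \<le> K" for x using M0(2)[of x] nn by (simp add: K_def)
  moreover have "K > 0" using M0(1) nn by (simp add: K_def)
  ultimately show ?case by (intro exI[of _ K]) (simp only: derivs_le.simps, blast)
qed

section \<open>Rescaling, Taylor polynomials and their remainders\<close>

lemma Dop_affine:
  "C_order k f \<Longrightarrow> Dop k c (\<lambda>x. f (s *\<^sub>R (x - x0))) x = s ^ k *\<^sub>R Dop k c f (s *\<^sub>R (x - x0))"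
proof (induction k arbitrary: c f)
  case (Suc k)
  have eq: "partial i (\<lambda>x. f (s *\<^sub>R (x - x0))) = (\<lambda>x. s * partial i f (s *\<^sub>R (x - x0)))" for i
    using Suc.prems by (auto simp: partial_affine)
  have "Dop k (\<lambda>J. c (i # J)) (\<lambda>x. s * partial i f (s *\<^sub>R (x - x0))) x
     = s *\<^sub>R s ^ k *\<^sub>R Dop k (\<lambda>J. c (i # J)) (partial i f) (s *\<^sub>R (x - x0))" for i
    using Suc.prems by (subst Dop_cmult) (auto intro!: C_order_affine simp: Suc.IH)
  then show ?case by (simp add: eq scaleR_sum_right)
qed simp

text \<open>The j-th derivative of \<phi> at x0, applied to j copies of y, without the factor
  1/j!.\<close>

fun taylor_part :: "nat \<Rightarrow> (real^'n::finite \<Rightarrow> real) \<Rightarrow> real^'n \<Rightarrow> real^'n \<Rightarrow> real" where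
  "taylor_part 0 \<phi> x0 y = \<phi> x0"
| "taylor_part (Suc j) \<phi> x0 y = (\<Sum>i\<in>UNIV. y $ i * taylor_part j (partial i \<phi>) x0 y)"

lemma C_order_taylor_part: "C_order m (taylor_part j \<phi> x0)"
proof (induction j arbitrary: \<phi>)
  case 0
  have "taylor_part 0 \<phi> x0 = (\<lambda>y. \<phi> x0)" by (rule ext) simp
  then show ?case by simp
next
  case (Suc j)
  have "taylor_part (Suc j) \<phi> x0 = (\<lambda>y. \<Sum>i\<in>UNIV. y $ i * taylor_part j (partial i \<phi>) x0 y)" by (rule ext) simp
  then show ?case by (auto intro!: C_order_sum C_order_mult C_order_component Suc.IH)
qed

lemma differentiable_taylor_part: "taylor_part j \<phi> x0 differentiable (at x)"
  using C_order_taylor_part[of 1 j \<phi> x0] by simp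

text \<open>The derivative of order \<open>Suc j\<close> is a symmetric multilinear form, so each of
  its \<open>Suc j\<close> slots contributes the same term.\<close>

lemma partial_taylor_part:
  "C_order (Suc j) \<phi> \<Longrightarrow> partial i (taylor_part (Suc j) \<phi> x0) y = real (Suc j) * taylor_part j (partial i \<phi>) x0 y"
proof (induction j arbitrary: \<phi>)
  case 0
  have eq: "taylor_part (Suc 0) \<phi> x0 = (\<lambda>y. \<Sum>l\<in>UNIV. partial l \<phi> x0 * y $ l)"
    by (rule ext) (simp add: mult.commute)
  have d: "(\<lambda>y::real^'a. y $ l) differentiable (at y)" for l
    by (rule C_order_differentiable[OF C_order_component])
  have "partial i (\<lambda>y. \<Sum>l\<in>UNIV. partial l \<phi> x0 * y $ l) y = (\<Sum>l\<in>UNIV. partial i (\<lambda>y. partial l \<phi> x0 * y $ l) y)"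
    by (rule partial_sum) (intro differentiable_mult differentiable_const d)
  also have "\<dots> = partial i \<phi> x0"
    by (simp add: partial_cmult[OF d] partial_component if_distrib cong: if_cong)
  finally show ?case unfolding eq by simp
next
  case (Suc j)
  have "C_order 2 \<phi>" by (rule C_order_mono[OF Suc.prems]) simp
  then have comm: "partial i (partial l \<phi>) = partial l (partial i \<phi>)" for l
    by (rule partial_commute)
  have eq: "taylor_part (Suc (Suc j)) \<phi> x0 = (\<lambda>y. \<Sum>l\<in>UNIV. y $ l * taylor_part (Suc j) (partial l \<phi>) x0 y)"
    by (rule ext) simp
  have d: "(\<lambda>y::real^'a. y $ l) differentiable (at y)" for l
    by (rule C_order_differentiable[OF C_order_component])
  have "partial i (taylor_part (Suc (Suc j)) \<phi> x0) y
     = (\<Sum>l\<in>UNIV. partial i (\<lambda>y. y $ l * taylor_part (Suc j) (partial l \<phi>) x0 y) y)"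
    unfolding eq by (rule partial_sum) (intro differentiable_mult d differentiable_taylor_part)
  also have "\<dots> = (\<Sum>l\<in>UNIV. y $ l * (real (Suc j) * taylor_part j (partial l (partial i \<phi>)) x0 y)
      + (if i = l then 1 else 0) * taylor_part (Suc j) (partial l \<phi>) x0 y)"
    using Suc.prems
    by (intro sum.cong refl)
      (simp only: partial_mult[OF d differentiable_taylor_part] partial_component Suc.IH[OF C_order_partial] comm)
  also have "\<dots> = (\<Sum>l\<in>UNIV. y $ l * (real (Suc j) * taylor_part j (partial l (partial i \<phi>)) x0 y))
      + taylor_part (Suc j) (partial i \<phi>) x0 y"
    by (simp add: sum.distrib if_distrib[of "\<lambda>a. a * _"] cong: if_cong del: taylor_part.simps)
  also have "(\<Sum>l\<in>UNIV. y $ l * (real (Suc j) * taylor_part j (partial l (partial i \<phi>)) x0 y))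
      = real (Suc j) * taylor_part (Suc j) (partial i \<phi>) x0 y"
    by (simp add: sum_distrib_left mult_ac)
  finally show ?case by (simp add: algebra_simps del: taylor_part.simps)
qed

definition taylor :: "nat \<Rightarrow> (real^'n::finite \<Rightarrow> real) \<Rightarrow> real^'n \<Rightarrow> real^'n \<Rightarrow> real" where
  "taylor k \<phi> x0 x = (\<Sum>j\<le>k. taylor_part j \<phi> x0 (x - x0) / fact j)"

lemma C_order_taylor: "C_order m (taylor k \<phi> x0)"
proof -
  have "taylor k \<phi> x0 = (\<lambda>x. \<Sum>j\<le>k. (1 / fact j) * taylor_part j \<phi> x0 (1 *\<^sub>R (x - x0)))"
    by (rule ext) (simp add: taylor_def)
  then show ?thesis
    by (simp only:) (intro C_order_sum C_order_cmult C_order_affine C_order_taylor_part)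
qed

text \<open>The factor \<open>Suc j\<close> from \<open>partial_taylor_part\<close> turns 1/(j+1)!
  into 1/j!. The inductions on the order below all peel off one derivative in this way.\<close>

lemma partial_taylor:
  assumes "C_order (Suc k) \<phi>"
  shows "partial i (taylor (Suc k) \<phi> x0) = taylor k (partial i \<phi>) x0"
proof
  fix x
  let ?g = "\<lambda>j x. (1 / fact j) * taylor_part j \<phi> x0 (1 *\<^sub>R (x - x0))"
  have eq: "taylor (Suc k) \<phi> x0 = (\<lambda>x. \<Sum>j\<le>Suc k. ?g j x)"
    by (rule ext) (simp add: taylor_def)
  have d: "(\<lambda>x. taylor_part j \<phi> x0 (1 *\<^sub>R (x - x0))) differentiable (at x)" for j
    by (rule differentiable_affine[OF differentiable_taylor_part])
  have "partial i (taylor (Suc k) \<phi> x0) x = (\<Sum>j\<le>Suc k. partial i (?g j) x)"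
    unfolding eq by (rule partial_sum) (intro differentiable_mult differentiable_const d)
  also have "\<dots> = (\<Sum>j\<le>Suc k. (1 / fact j) * partial i (taylor_part j \<phi> x0) (x - x0))"
    by (intro sum.cong refl, subst partial_cmult[OF d], subst partial_affine[OF differentiable_taylor_part]) simp
  also have "\<dots> = (\<Sum>j\<le>k. (1 / fact (Suc j)) * partial i (taylor_part (Suc j) \<phi> x0) (x - x0))"
  proof -
    have "taylor_part 0 \<phi> x0 = (\<lambda>y. \<phi> x0)" by (rule ext) simp
    then show ?thesis by (subst sum.atMost_Suc_shift) simp
  qed
  also have "\<dots> = (\<Sum>j\<le>k. taylor_part j (partial i \<phi>) x0 (x - x0) / fact j)"
  proof (rule sum.cong[OF refl])
    fix j assume "j \<in> {..k}"
    then have "C_order (Suc j) \<phi>" by (intro C_order_mono[OF assms]) simp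
    then have "partial i (taylor_part (Suc j) \<phi> x0) (x - x0) = real (Suc j) * taylor_part j (partial i \<phi>) x0 (x - x0)"
      by (rule partial_taylor_part)
    then show "1 / fact (Suc j) * partial i (taylor_part (Suc j) \<phi> x0) (x - x0)
        = taylor_part j (partial i \<phi>) x0 (x - x0) / fact j"
      by (simp add: divide_simps del: taylor_part.simps of_nat_Suc)
  qed
  finally show "partial i (taylor (Suc k) \<phi> x0) x = taylor k (partial i \<phi>) x0 x"
    by (simp add: taylor_def)
qed

lemma taylor_0 [simp]: "taylor 0 \<phi> x0 x = \<phi> x0"
  by (simp add: taylor_def)

lemma taylor_centre [simp]: "taylor k \<phi> x0 x0 = \<phi> x0"
proof -
  have "taylor_part (Suc j) \<phi> x0 0 = 0" for j by simp
  then show ?thesis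
    by (cases k) (simp_all add: taylor_def sum.atMost_Suc_shift del: taylor_part.simps(2) sum.atMost_Suc)
qed

text \<open>After k derivatives only Taylor polynomials of degree 0 are left. This is what makes
  fields exactly constant on balls.\<close>

lemma Dop_taylor:
  "C_order k \<phi> \<Longrightarrow> Dop k c (taylor k \<phi> x0) x = Dop k c \<phi> x0"
proof (induction k arbitrary: c \<phi>)
  case (Suc k)
  then show ?case by (simp add: partial_taylor del: C_order.simps add: C_order_partial)
qed simp

text \<open>Only the derivatives of order exactly k are compared with their values at the centre:
  they alone control the Taylor remainder of degree k.\<close>

fun osc_le :: "nat \<Rightarrow> real \<Rightarrow> (real^'n::finite \<Rightarrow> real) \<Rightarrow> real^'n \<Rightarrow> real \<Rightarrow> bool" where
  "osc_le 0 \<delta> \<phi> x0 r = (\<forall>x\<in>cball x0 r. \<bar>\<phi> x0 - \<phi> x\<bar> \<le> \<delta>)"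
| "osc_le (Suc k) \<delta> \<phi> x0 r = (\<forall>i. osc_le k \<delta> (partial i \<phi>) x0 r)"

text \<open>The remainder vanishes at the centre, and its partial derivatives are remainders of the
  next lower degree; each use of the mean value inequality adds one factor CARD('n) * r.\<close>

lemma taylor_bound:
  fixes \<phi> :: "real^'n::finite \<Rightarrow> real"
  shows "C_order k \<phi> \<Longrightarrow> osc_le k \<delta> \<phi> x0 r \<Longrightarrow> x \<in> cball x0 r \<Longrightarrow>
    \<bar>taylor k \<phi> x0 x - \<phi> x\<bar> \<le> real CARD('n) ^ k * r ^ k * \<delta>"
proof (induction k arbitrary: \<phi> x)
  case (Suc k)
  have d1: "taylor (Suc k) \<phi> x0 differentiable (at x)" for x
    using C_order_taylor[of 1 "Suc k" \<phi> x0] by simp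
  have d2: "\<phi> differentiable (at x)" for x using Suc.prems(1) by simp
  have "\<bar>(taylor (Suc k) \<phi> x0 x - \<phi> x) - (taylor (Suc k) \<phi> x0 x0 - \<phi> x0)\<bar>
      \<le> real CARD('n) * (real CARD('n) ^ k * r ^ k * \<delta>) * r"
  proof (rule partial_bound_imp[OF _ Suc.prems(3)])
    show "(\<lambda>x. taylor (Suc k) \<phi> x0 x - \<phi> x) differentiable (at x)" for x
      using d1 d2 by (rule differentiable_diff)
    fix x i assume x: "x \<in> cball x0 r"
    have "partial i (\<lambda>x. taylor (Suc k) \<phi> x0 x - \<phi> x) x = taylor k (partial i \<phi>) x0 x - partial i \<phi> x"
      by (simp only: partial_diff[OF d1 d2] partial_taylor[OF Suc.prems(1)])
    then show "\<bar>partial i (\<lambda>x. taylor (Suc k) \<phi> x0 x - \<phi> x) x\<bar> \<le> real CARD('n) ^ k * r ^ k * \<delta>"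
      using Suc.IH[OF C_order_partial[OF Suc.prems(1)] _ x, of i] Suc.prems(2) by simp
  qed
  then show ?case by (simp add: mult_ac)
qed (simp add: dist_commute)

lemma affine_alt:
  fixes x0 y :: "'a::real_vector"
  assumes "r \<noteq> 0" shows "x0 + r *\<^sub>R y = r *\<^sub>R (y - (- (1 / r)) *\<^sub>R x0)"
  using assms by (simp add: algebra_simps)

text \<open>After blowing up \<open>cball x0 r\<close> to the unit ball and dividing by r ^ k, all
  derivatives up to order k are bounded independently of r. Multiplication by a fixed cut-off on the
  unit ball then costs only a constant, although the derivatives of that cut-off blow up at scale
  r.\<close>

lemma derivs_le_taylor_scaled:
  fixes \<phi> :: "real^'n::finite \<Rightarrow> real"
  assumes "r > 0"
  shows "C_order k \<phi> \<Longrightarrow> osc_le k \<delta> \<phi> x0 r \<Longrightarrow> 0 \<le> \<delta> \<Longrightarrow>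
    derivs_le k (real CARD('n) ^ k * \<delta>) (\<lambda>y. (1 / r ^ k) * (taylor k \<phi> x0 (x0 + r *\<^sub>R y) - \<phi> (x0 + r *\<^sub>R y))) (cball 0 1)"
proof (induction k arbitrary: \<phi>)
  case 0
  then show ?case using assms by (auto simp: dist_norm)
next
  case (Suc k)
  let ?g = "\<lambda>x. taylor (Suc k) \<phi> x0 x - \<phi> x"
  let ?x = "- (1 / r) *\<^sub>R x0"
  have d1: "taylor (Suc k) \<phi> x0 differentiable (at x)" for x
    using C_order_taylor[of 1 "Suc k" \<phi> x0] by simp
  have d2: "\<phi> differentiable (at x)" for x using Suc.prems(1) by simp
  have d: "?g differentiable (at x)" for x
    using d1 d2 by (rule differentiable_diff)
  have eq: "(\<lambda>y. (1 / r ^ Suc k) * ?g (x0 + r *\<^sub>R y)) = (\<lambda>y. (1 / r ^ Suc k) * ?g (r *\<^sub>R (y - ?x)))"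
    using assms by (simp only: affine_alt[of r x0])
  have "partial i (\<lambda>y. (1 / r ^ Suc k) * ?g (x0 + r *\<^sub>R y))
      = (\<lambda>y. (1 / r ^ k) * (taylor k (partial i \<phi>) x0 (x0 + r *\<^sub>R y) - partial i \<phi> (x0 + r *\<^sub>R y)))" for i
  proof
    fix y
    have "partial i (\<lambda>y. (1 / r ^ Suc k) * ?g (x0 + r *\<^sub>R y)) y = (1 / r ^ Suc k) * (r * partial i ?g (r *\<^sub>R (y - ?x)))"
      unfolding eq
      by (subst partial_cmult[OF differentiable_affine[OF d]], subst partial_affine[where f = ?g, OF d]) simp
    also have "\<dots> = (1 / r ^ k) * partial i ?g (x0 + r *\<^sub>R y)"
      using assms affine_alt[of r x0 y] by simp
    also have "partial i ?g (x0 + r *\<^sub>R y) = taylor k (partial i \<phi>) x0 (x0 + r *\<^sub>R y) - partial i \<phi> (x0 + r *\<^sub>R y)"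
      by (simp only: partial_diff[OF d1 d2] partial_taylor[OF Suc.prems(1)])
    finally show "partial i (\<lambda>y. (1 / r ^ Suc k) * ?g (x0 + r *\<^sub>R y)) y = (1 / r ^ k) * (taylor k (partial i \<phi>) x0 (x0 + r *\<^sub>R y) - partial i \<phi> (x0 + r *\<^sub>R y))" .
  qed
  note p = this
  have N1: "1 \<le> real CARD('n)" using zero_less_card_finite[where 'a = 'n] by linarith
  have "derivs_le k (real CARD('n) ^ Suc k * \<delta>) (partial i (\<lambda>y. (1 / r ^ Suc k) * ?g (x0 + r *\<^sub>R y))) (cball 0 1)" for i
  proof -
    have "derivs_le k (real CARD('n) ^ k * \<delta>) (partial i (\<lambda>y. (1 / r ^ Suc k) * ?g (x0 + r *\<^sub>R y))) (cball 0 1)"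
      unfolding p using Suc.prems by (intro Suc.IH) simp_all
    then show ?thesis
      by (rule derivs_le_mono) (use N1 Suc.prems(3) in \<open>auto intro!: mult_right_mono simp: mult_le_cancel_right1\<close>)
  qed
  moreover have "\<bar>(1 / r ^ Suc k) * ?g (x0 + r *\<^sub>R y)\<bar> \<le> real CARD('n) ^ Suc k * \<delta>" if "y \<in> cball 0 1" for y
  proof -
    have "\<bar>?g (x0 + r *\<^sub>R y)\<bar> \<le> real CARD('n) ^ Suc k * r ^ Suc k * \<delta>"
      using that assms by (intro taylor_bound Suc.prems) (auto simp: dist_norm mult_le_cancel_left1)
    then have "(1 / r ^ Suc k) * \<bar>?g (x0 + r *\<^sub>R y)\<bar> \<le> (1 / r ^ Suc k) * (real CARD('n) ^ Suc k * r ^ Suc k * \<delta>)"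
      using assms by (intro mult_left_mono) auto
    also have "\<dots> = real CARD('n) ^ Suc k * \<delta>" using assms by simp
    finally show ?thesis using assms by (simp only: abs_mult) (simp add: abs_mult)
  qed
  ultimately show ?case by simp
qed

lemma osc_le_exists:
  fixes K :: "(real^'n::finite) set"
  assumes "bounded K" "\<delta> > 0"
  shows "C_order k \<phi> \<Longrightarrow> \<exists>\<rho>>0. \<forall>x0\<in>K. \<forall>r. 0 < r \<and> r < \<rho> \<longrightarrow> osc_le k \<delta> \<phi> x0 r"
proof (induction k arbitrary: \<phi>)
  case 0
  obtain R where R: "\<And>x. x \<in> K \<Longrightarrow> norm x \<le> R" using assms(1) by (auto simp: bounded_iff)
  \<comment> \<open>The larger ball contains every \<open>cball x0 r\<close> with centre in K and r
    < 1, on which the oscillation is measured.\<close>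
  have "uniformly_continuous_on (cball 0 (R + 1)) \<phi>"
    using 0 by (intro compact_uniformly_continuous) (auto intro: continuous_on_subset)
  then obtain d where d: "d > 0" "\<And>x y. \<lbrakk>x \<in> cball 0 (R + 1); y \<in> cball 0 (R + 1); dist y x < d\<rbrakk> \<Longrightarrow> dist (\<phi> y) (\<phi> x) < \<delta>"
    using assms(2) unfolding uniformly_continuous_on_def by metis
  have "osc_le 0 \<delta> \<phi> x0 r" if "x0 \<in> K" "0 < r" "r < min d 1" for x0 r
  proof -
    have "\<bar>\<phi> x0 - \<phi> x\<bar> \<le> \<delta>" if x: "x \<in> cball x0 r" for x
    proof -
      have x1: "dist x0 x \<le> r" using x by simp
      have "norm x \<le> norm x0 + dist x0 x"
        by (metis dist_commute dist_norm norm_triangle_sub)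
      then have "x \<in> cball 0 (R + 1)" "x0 \<in> cball 0 (R + 1)"
        using R[OF \<open>x0 \<in> K\<close>] x1 \<open>r < min d 1\<close> by auto
      then have "dist (\<phi> x0) (\<phi> x) < \<delta>" using x1 \<open>r < min d 1\<close> by (intro d(2)) auto
      then show ?thesis by (simp add: dist_real_def)
    qed
    then show ?thesis by simp
  qed
  then show ?case using d(1) by (intro exI[of _ "min d 1"]) auto
next
  case (Suc k)
  have "\<exists>\<rho>>0. \<forall>x0\<in>K. \<forall>r. 0 < r \<and> r < \<rho> \<longrightarrow> osc_le k \<delta> (partial i \<phi>) x0 r" for i
    by (rule Suc.IH[OF C_order_partial[OF Suc.prems]])
  then obtain \<rho> where \<rho>: "\<And>i. \<rho> i > 0" "\<And>i x0 r. x0 \<in> K \<Longrightarrow> 0 < r \<Longrightarrow> r < \<rho> i \<Longrightarrow> osc_le k \<delta> (partial i \<phi>) x0 r"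
    by metis
  show ?case
  proof (intro exI[of _ "Min (range \<rho>)"] conjI ballI allI impI)
    show "0 < Min (range \<rho>)" using \<rho>(1) by (subst Min_gr_iff) auto
    fix x0 r assume "x0 \<in> K" "0 < r \<and> r < Min (range \<rho>)"
    then show "osc_le (Suc k) \<delta> \<phi> x0 r"
      using \<rho>(2)[of x0 r] by (simp add: Min_gr_iff)
  qed
qed

section \<open>Cut-off functions of finite smoothness\<close>

lemma ex_antiderivative:
  fixes f :: "real \<Rightarrow> real"
  assumes "continuous_on UNIV f"
  shows "\<exists>F. \<forall>x. (F has_real_derivative f x) (at x)"
proof -
  have "\<exists>F. \<forall>x. - \<infinity> < ereal x \<longrightarrow> ereal x < \<infinity> \<longrightarrow> (F has_vector_derivative f x) (at x)"
    using assms by (intro einterval_antiderivative) (auto simp: continuous_on_eq_continuous_at)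
  then show ?thesis by (simp add: has_real_derivative_iff_has_vector_derivative)
qed

lemma Ck_mult: "Ck k f \<Longrightarrow> Ck k g \<Longrightarrow> Ck k (\<lambda>x. f x * g x)"
proof (induction k arbitrary: f g)
  case (Suc k)
  obtain f' where f': "\<And>x. (f has_real_derivative f' x) (at x)" "Ck k f'" using Suc.prems(1) by auto
  obtain g' where g': "\<And>x. (g has_real_derivative g' x) (at x)" "Ck k g'" using Suc.prems(2) by auto
  have add: "Ck j p \<Longrightarrow> Ck j q \<Longrightarrow> Ck j (\<lambda>x. p x + q x)" for j p q
  proof (induction j arbitrary: p q)
    case (Suc j)
    obtain p' where p': "\<And>x. (p has_real_derivative p' x) (at x)" "Ck j p'" using Suc.prems(1) by auto
    obtain q' where q': "\<And>x. (q has_real_derivative q' x) (at x)" "Ck j q'" using Suc.prems(2) by auto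
    show ?case
      unfolding Ck.simps
      using DERIV_add[OF p'(1) q'(1)] Suc.IH[OF p'(2) q'(2)] by (intro exI[of _ "\<lambda>x. p' x + q' x"]) simp
  qed (auto intro: continuous_on_add)
  have "((\<lambda>x. f x * g x) has_real_derivative f' x * g x + f x * g' x) (at x)" for x
    using DERIV_mult'[OF f'(1) g'(1)] by (simp add: add.commute)
  moreover have "Ck k (\<lambda>x. f' x * g x + f x * g' x)"
    using Suc.IH[OF f'(2) Ck_Suc_imp[OF Suc.prems(2)]] Suc.IH[OF Ck_Suc_imp[OF Suc.prems(1)] g'(2)]
    by (rule add)
  ultimately show ?case
    unfolding Ck.simps by (intro exI[of _ "\<lambda>x. f' x * g x + f x * g' x"]) simp
qed (auto intro: continuous_on_mult)

lemma Ck_const: "Ck k (\<lambda>x. c)"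
proof (induction k arbitrary: c)
  case (Suc k)
  show ?case unfolding Ck.simps by (intro exI[of _ "\<lambda>x. 0"]) (simp add: Suc)
qed simp

lemma Ck_cmult: "Ck k f \<Longrightarrow> Ck k (\<lambda>x. c * f x)"
  by (intro Ck_mult Ck_const)

lemma Ck_reflect: "Ck k f \<Longrightarrow> Ck k (\<lambda>x. f (1 - x))"
proof (induction k arbitrary: f)
  case 0
  then show ?case by (auto intro!: continuous_on_compose2[of UNIV f] continuous_intros)
next
  case (Suc k)
  obtain f' where f': "\<And>x. (f has_real_derivative f' x) (at x)" "Ck k f'" using Suc.prems(1) by auto
  have "((\<lambda>x. f (1 - x)) has_real_derivative (-1) * f' (1 - x)) (at x)" for x
  proof -
    have "((\<lambda>x::real. 1 - x) has_real_derivative - 1) (at x)"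
      by (auto intro!: derivative_eq_intros)
    from DERIV_chain2[where f = f and g = "\<lambda>x. 1 - x", OF f'(1) this] show ?thesis by simp
  qed
  then show ?case
    unfolding Ck.simps using Ck_cmult[OF Suc.IH[OF f'(2)], of "-1"] by (intro exI[of _ "\<lambda>x. (-1) * f' (1 - x)"]) simp
qed

lemma DERIV_pos_part_power:
  "((\<lambda>x::real. max 0 x ^ Suc (Suc n)) has_real_derivative real (Suc (Suc n)) * max 0 x ^ Suc n) (at x)"
proof (cases x "0::real" rule: linorder_cases)
  case less
  have "((\<lambda>x::real. 0) has_real_derivative 0) (at x)" by simp
  then have "((\<lambda>x::real. max 0 x ^ Suc (Suc n)) has_real_derivative 0) (at x)"
    by (rule has_field_derivative_transform_within_open[of _ _ _ "{..<0}"]) (use less in auto)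
  then show ?thesis using less by simp
next
  case greater
  have "((\<lambda>x::real. x ^ Suc (Suc n)) has_real_derivative real (Suc (Suc n)) * x ^ Suc n) (at x)"
    using DERIV_pow[of "Suc (Suc n)" x] by simp
  then have "((\<lambda>x::real. max 0 x ^ Suc (Suc n)) has_real_derivative real (Suc (Suc n)) * x ^ Suc n) (at x)"
    by (rule has_field_derivative_transform_within_open[of _ _ _ "{0<..}"]) (use greater in auto)
  then show ?thesis using greater by simp
next
  case equal
  have "((\<lambda>y::real. max 0 y ^ Suc n) \<longlongrightarrow> max 0 0 ^ Suc n) (at 0)"
    by (intro tendsto_intros)
  then have "((\<lambda>y::real. max 0 y ^ Suc n) \<longlongrightarrow> 0) (at 0)" by simp
  then have "((\<lambda>y::real. (max 0 (0 + y) ^ Suc (Suc n) - max 0 0 ^ Suc (Suc n)) / y) \<longlongrightarrow> 0) (at 0)"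
  proof (rule Lim_null_comparison[rotated])
    show "\<forall>\<^sub>F y in at 0. norm ((max 0 (0 + y) ^ Suc (Suc n) - max 0 0 ^ Suc (Suc n)) / y) \<le> max 0 y ^ Suc n"
      by (rule always_eventually) (auto simp: max_def)
  qed
  then show ?thesis using equal by (simp add: DERIV_def)
qed

lemma Ck_pos_part_power: "Ck k (\<lambda>x. max 0 x ^ Suc k)"
proof (induction k)
  case 0
  show ?case by (auto intro!: continuous_intros)
next
  case (Suc k)
  show ?case
    unfolding Ck.simps(2)
    by (intro exI[of _ "\<lambda>x. real (Suc (Suc k)) * max 0 x ^ Suc k"] conjI allI DERIV_pos_part_power Ck_cmult Suc)
qed

text \<open>The normalised antiderivative of the bump max(0,x)^(k+1) max(0,1-x)^(k+1), which is of
  class C^k, positive on (0,1) and zero elsewhere.\<close>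

lemma step_function_exists:
  "\<exists>s :: real \<Rightarrow> real. Ck k s \<and> (\<forall>x\<le>0. s x = 0) \<and> (\<forall>x\<ge>1. s x = 1) \<and> (\<forall>x. 0 \<le> s x \<and> s x \<le> 1)"
proof -
  define p where "p = (\<lambda>x::real. max 0 x ^ Suc k * max 0 (1 - x) ^ Suc k)"
  have Cp: "Ck k p"
    unfolding p_def using Ck_mult[OF Ck_pos_part_power Ck_reflect[OF Ck_pos_part_power]] .
  have p0: "p x \<ge> 0" for x unfolding p_def by simp
  obtain F where F: "\<And>x. (F has_real_derivative p x) (at x)"
    using ex_antiderivative[OF Ck_continuous[OF Cp]] by blast
  have mono: "F x \<le> F y" if "x \<le> y" for x y
    by (rule DERIV_nonneg_imp_nondecreasing[OF that]) (rule exI, rule conjI, rule F, rule p0)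
  have cont: "continuous_on S F" for S
    by (intro continuous_at_imp_continuous_on ballI DERIV_isCont[OF F])
  have pos: "p x > 0" if "0 < x" "x < 1" for x
    unfolding p_def by (intro mult_pos_pos zero_less_power) (use that in auto)
  have lt: "F 0 < F 1"
  proof (rule DERIV_pos_imp_increasing_open[OF zero_less_one _ cont])
    show "\<exists>y. (F has_real_derivative y) (at x) \<and> 0 < y" if "0 < x" "x < 1" for x
      by (rule exI, rule conjI, rule F, rule pos[OF that])
  qed
  have left: "F x = F 0" if "x \<le> 0" for x
  proof (cases "x = 0")
    case False
    then have "x < 0" using that by simp
    then obtain z where "z < 0" "F 0 - F x = (0 - x) * p z"
      using MVT2[OF \<open>x < 0\<close> F] by blast
    moreover have "p z = 0" using \<open>z < 0\<close> by (simp add: p_def)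
    ultimately show ?thesis by simp
  qed simp
  have right: "F x = F 1" if "x \<ge> 1" for x
  proof (cases "x = 1")
    case False
    then have "1 < x" using that by simp
    then obtain z where "z > 1" "F x - F 1 = (x - 1) * p z"
      using MVT2[OF \<open>1 < x\<close> F] by blast
    moreover have "p z = 0" using \<open>z > 1\<close> by (simp add: p_def)
    ultimately show ?thesis by simp
  qed simp
  define s where "s = (\<lambda>x. (1 / (F 1 - F 0)) * (F x - F 0))"
  have ds: "((\<lambda>x. (1 / (F 1 - F 0)) * (F x - F 0)) has_real_derivative (1 / (F 1 - F 0)) * p x) (at x)" for x
    using DERIV_cmult[OF DERIV_diff[OF F DERIV_const], of "1 / (F 1 - F 0)" "F 0" x] by simp
  have "Ck (Suc k) s"
    unfolding Ck.simps s_def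
    by (rule exI, rule conjI, rule allI, rule ds, rule Ck_cmult, rule Cp)
  then have "Ck k s" by (rule Ck_Suc_imp)
  moreover have "F 0 \<le> F x" "F x \<le> F 1" for x
    using mono[of 0 x] mono[of x 1] left[of x] right[of x] lt by linarith+
  moreover have "s x = 0" if "x \<le> 0" for x using left[OF that] by (simp add: s_def)
  moreover have "s x = 1" if "x \<ge> 1" for x using right[OF that] lt by (simp add: s_def)
  moreover have "0 \<le> s x" "s x \<le> 1" for x
    using lt \<open>F 0 \<le> F x\<close> \<open>F x \<le> F 1\<close> by (simp_all add: s_def)
  ultimately show ?thesis by blast
qed

lemma cutoff_exists:
  assumes "0 < \<kappa>" "\<kappa> < 1"
  obtains \<eta> :: "real^'n::finite \<Rightarrow> real" where "C_order k \<eta>" "vanishes_off (cball 0 1) \<eta>"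
    "\<And>x. norm x ^ 2 \<le> 1 - \<kappa> \<Longrightarrow> \<eta> x = 1" "\<And>x. 0 \<le> \<eta> x" "\<And>x. \<eta> x \<le> 1"
proof -
  obtain s where s: "Ck k s" "\<And>x. x \<le> 0 \<Longrightarrow> s x = 0" "\<And>x. x \<ge> 1 \<Longrightarrow> s x = 1"
    "\<And>x. 0 \<le> s x" "\<And>x. s x \<le> 1" using step_function_exists[of k] by blast
  \<comment> \<open>The squared norm is a polynomial, so the radial cut-off is of class C^k at the
    origin as well. With this scaling \<open>g\<close> is at least 1 exactly where |x|^2 \<le> 1 -
    \<kappa>, and at most 0 outside the unit ball.\<close>
  define g where "g = (\<lambda>x::real^'n. (1 / \<kappa>) * (1 - (\<Sum>i\<in>UNIV. x $ i * x $ i)))"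
  have Cg: "C_order k g"
    unfolding g_def
    by (intro C_order_cmult C_order_diff C_order_const C_order_sum C_order_mult C_order_component)
  have g: "g x = (1 - norm x ^ 2) / \<kappa>" for x
    by (simp add: g_def power2_norm_eq_inner inner_vec_def)
  have g0: "g x \<le> 0" if "1 < norm x" for x
  proof -
    have "1 < (norm x)\<^sup>2" using that by (simp add: one_less_power)
    then show ?thesis using assms by (simp add: g divide_nonpos_pos)
  qed
  show thesis
  proof (rule that[of "\<lambda>x. s (g x)"])
    show "C_order k (\<lambda>x. s (g x))" by (rule C_order_compose[OF s(1) Cg])
    show "vanishes_off (cball 0 1) (\<lambda>x. s (g x))"
      unfolding vanishes_off_def using s(2) g0 by auto
    show "s (g x) = 1" if "norm x ^ 2 \<le> 1 - \<kappa>" for x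
      using that assms by (intro s(3)) (simp add: g)
  qed (use s in auto)
qed

text \<open>The correction is a cut-off times the Taylor remainder: where the cut-off is 1, the new
  potential is the Taylor polynomial of \<phi>. By scaling, C depends neither on the ball nor on the
  potential, so \<delta> can be fixed before the radius is known.\<close>

lemma ball_modification:
  fixes c :: "'n::finite list \<Rightarrow> 'b::real_normed_vector"
  obtains C where "C > 0"
    "\<And>\<phi> x0 r \<delta>. C_order k \<phi> \<Longrightarrow> r > 0 \<Longrightarrow> 0 \<le> \<delta> \<Longrightarrow> osc_le k \<delta> \<phi> x0 r \<Longrightarrow>
      \<exists>\<tau>. C_order k \<tau> \<and> vanishes_off (cball x0 r) \<tau> \<and> (\<forall>x. norm (Dop k c \<tau> x) \<le> C * \<delta>) \<and>
         (\<forall>x\<in>ball x0 (r / 2). Dop k c \<phi> x + Dop k c \<tau> x = Dop k c \<phi> x0)"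
proof -
  \<comment> \<open>With \<kappa> = 3/4 the cut-off equals 1 where |x|^2 \<le> 1/4, that is, on the
    half ball.\<close>
  obtain \<eta> :: "real^'n \<Rightarrow> real" where \<eta>: "C_order k \<eta>" "vanishes_off (cball 0 1) \<eta>"
    "\<And>x. norm x ^ 2 \<le> 1 - 3/4 \<Longrightarrow> \<eta> x = 1"
    by (rule cutoff_exists[of "3/4" k]) auto
  obtain M where M: "M > 0" "derivs_le k M \<eta> UNIV" using derivs_le_exists[OF \<eta>(1,2)] by auto
  let ?N = "real CARD('n) ^ k"
  \<comment> \<open>Factors: size of the operator, product rule for the cut-off, rescaled remainder;
    adding 1 makes C positive.\<close>
  define C where "C = Dnorm k c * (2 ^ k * M * ?N) + 1"
  have "C > 0" using Dnorm_nonneg[of k c] M(1) by (auto simp: C_def intro!: add_nonneg_pos)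
  show thesis
  proof (rule that[OF \<open>C > 0\<close>])
    fix \<phi> :: "real^'n \<Rightarrow> real" and x0 and r \<delta> :: real
    assume \<phi>: "C_order k \<phi>" and r: "r > 0" and \<delta>: "0 \<le> \<delta>" and osc: "osc_le k \<delta> \<phi> x0 r"
    let ?g = "\<lambda>x. taylor k \<phi> x0 x - \<phi> x"
    define f where "f = (\<lambda>y. (1 / r ^ k) * ?g (x0 + r *\<^sub>R y))"
    define T where "T = (\<lambda>y. \<eta> y * f y)"
    define \<tau> where "\<tau> = (\<lambda>x. \<eta> ((1 / r) *\<^sub>R (x - x0)) * ?g x)"
    have Cg: "C_order k ?g" by (intro C_order_diff C_order_taylor \<phi>)
    have Cf: "C_order k f"
    proof -
      have "f = (\<lambda>y. (1 / r ^ k) * ?g (r *\<^sub>R (y - (- (1 / r)) *\<^sub>R x0)))"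
        unfolding f_def using r by (simp only: affine_alt[of r x0])
      then show ?thesis by (simp only:) (rule C_order_cmult[OF C_order_affine[OF Cg]])
    qed
    have CT: "C_order k T" unfolding T_def by (rule C_order_mult[OF \<eta>(1) Cf])
    have nrm: "norm ((1 / r) *\<^sub>R (x - x0)) = dist x0 x / r" for x
      using r by (simp only: norm_scaleR dist_norm norm_minus_commute[of x0]) simp
    have C\<tau>: "C_order k \<tau>" unfolding \<tau>_def by (intro C_order_mult C_order_affine \<eta>(1) Cg)
    have vT: "vanishes_off (cball 0 1) T" using \<eta>(2) by (simp add: T_def vanishes_off_def)
    have bT: "derivs_le k (2 ^ k * M * (?N * \<delta>)) T (cball 0 1)"
      unfolding T_def
      by (rule derivs_le_mult[OF \<eta>(1) Cf derivs_le_mono[OF M(2)] derivs_le_taylor_scaled[OF r \<phi> osc \<delta>, folded f_def]])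
        (use M(1) \<delta> in auto)
    have \<tau>T: "\<tau> = (\<lambda>x. r ^ k * T ((1 / r) *\<^sub>R (x - x0)))"
      using r by (auto simp: \<tau>_def T_def f_def)
    have D: "Dop k c \<tau> x = Dop k c T ((1 / r) *\<^sub>R (x - x0))" for x
    proof -
      have "r ^ k *\<^sub>R (1 / r) ^ k *\<^sub>R Dop k c T ((1 / r) *\<^sub>R (x - x0)) = Dop k c T ((1 / r) *\<^sub>R (x - x0))"
        using r by (simp add: power_mult_distrib[symmetric])
      then show ?thesis
        unfolding \<tau>T by (subst Dop_cmult[OF C_order_affine[OF CT]], subst Dop_affine[OF CT])
    qed
    have bound: "norm (Dop k c T y) \<le> C * \<delta>" for y
    proof (cases "y \<in> cball 0 1")
      case True
      have "norm (Dop k c T y) \<le> Dnorm k c * (2 ^ k * M * (?N * \<delta>))" by (rule Dop_bound[OF bT True])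
      also have "\<dots> \<le> C * \<delta>" using \<delta> by (simp add: C_def algebra_simps)
      finally show ?thesis .
    next
      case False
      then have "Dop k c T y = 0" using Dop_vanishes_off[OF closed_cball vT, of k c] by (simp add: vanishes_off_def)
      then show ?thesis using \<open>C > 0\<close> \<delta> by simp
    qed
    show "\<exists>\<tau>. C_order k \<tau> \<and> vanishes_off (cball x0 r) \<tau> \<and> (\<forall>x. norm (Dop k c \<tau> x) \<le> C * \<delta>) \<and>
         (\<forall>x\<in>ball x0 (r / 2). Dop k c \<phi> x + Dop k c \<tau> x = Dop k c \<phi> x0)"
    proof (intro exI[of _ \<tau>] conjI C\<tau> allI ballI)
      show "vanishes_off (cball x0 r) \<tau>"
        unfolding vanishes_off_def
      proof (intro allI impI)
        fix x assume "x \<notin> cball x0 r"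
        then have "(1 / r) *\<^sub>R (x - x0) \<notin> cball 0 1"
          using r nrm[of x] by (simp only: mem_cball_0) (simp add: divide_simps)
        then show "\<tau> x = 0" using \<eta>(2) by (simp add: \<tau>_def vanishes_off_def)
      qed
      show "norm (Dop k c \<tau> x) \<le> C * \<delta>" for x unfolding D by (rule bound)
      fix x assume x: "x \<in> ball x0 (r / 2)"
      have eq: "\<phi> y + \<tau> y = taylor k \<phi> x0 y" if "y \<in> ball x0 (r / 2)" for y
      proof -
        have "norm ((1 / r) *\<^sub>R (y - x0)) \<le> 1 / 2"
          using that r unfolding nrm by (simp add: divide_simps)
        then have "norm ((1 / r) *\<^sub>R (y - x0)) ^ 2 \<le> (1 / 2) ^ 2"
          by (intro power_mono) auto
        then have "\<eta> ((1 / r) *\<^sub>R (y - x0)) = 1" by (intro \<eta>(3)) (simp add: power2_eq_square)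
        then show ?thesis by (simp add: \<tau>_def)
      qed
      have "Dop k c \<phi> x + Dop k c \<tau> x = Dop k c (\<lambda>x. \<phi> x + \<tau> x) x"
        by (rule Dop_add[OF \<phi> C\<tau>, symmetric])
      also have "\<dots> = Dop k c (taylor k \<phi> x0) x"
        by (rule Dop_cong_open[OF open_ball x eq])
      also have "\<dots> = Dop k c \<phi> x0" by (rule Dop_taylor[OF \<phi>])
      finally show "Dop k c \<phi> x + Dop k c \<tau> x = Dop k c \<phi> x0" .
    qed
  qed
qed

section \<open>An annihilating symbol\<close>

definition hom_poly :: "nat \<Rightarrow> (real^'n::finite \<Rightarrow> real) \<Rightarrow> bool" where
  "hom_poly k p \<longleftrightarrow> (\<exists>c. \<forall>w. p w = symb k c w)"

lemma hom_poly_const: "hom_poly 0 (\<lambda>w. a)"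
  unfolding hom_poly_def by (intro exI[of _ "\<lambda>_. a"]) simp

lemma hom_poly_cmult:
  assumes "hom_poly k p" shows "hom_poly k (\<lambda>w. a * p w)"
proof -
  obtain c where c: "\<And>w. p w = symb k c w" using assms unfolding hom_poly_def by blast
  show ?thesis
    unfolding hom_poly_def c by (intro exI[of _ "\<lambda>J. a * c J"]) (simp add: symb_linear bounded_linear_mult_right)
qed

lemma hom_poly_sum:
  assumes "\<And>s. s \<in> S \<Longrightarrow> hom_poly k (p s)"
  shows "hom_poly k (\<lambda>w. \<Sum>s\<in>S. p s w)"
proof -
  have "\<forall>s. \<exists>c. s \<in> S \<longrightarrow> (\<forall>w. p s w = symb k c w)" using assms unfolding hom_poly_def by blast
  then obtain c where c: "\<And>s w. s \<in> S \<Longrightarrow> p s w = symb k (c s) w" by metis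
  show ?thesis
    unfolding hom_poly_def
    by (intro exI[of _ "\<lambda>J. \<Sum>s\<in>S. c s J"]) (simp add: symb_sum c)
qed

definition linear_form :: "(real^'n::finite \<Rightarrow> real) \<Rightarrow> bool" where
  "linear_form f \<longleftrightarrow> (\<exists>a. \<forall>w. f w = (\<Sum>i\<in>UNIV. w $ i * a i))"

lemma hom_poly_linear_form_mult:
  assumes "linear_form f" "hom_poly k p"
  shows "hom_poly (Suc k) (\<lambda>w. f w * p w)"
proof -
  obtain c where c: "\<And>w. p w = symb k c w" using assms(2) unfolding hom_poly_def by blast
  obtain a where a: "\<And>w. f w = (\<Sum>i\<in>UNIV. w $ i * a i)" using assms(1) unfolding linear_form_def by blast
  show ?thesis
    unfolding hom_poly_def c a
    by (intro exI[of _ "\<lambda>I. case I of [] \<Rightarrow> 0 | i # J \<Rightarrow> a i * c J"])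
      (simp add: symb_linear[OF bounded_linear_mult_right] sum_distrib_left sum_distrib_right mult_ac)
qed

lemma hom_poly_prod:
  assumes "finite S" "\<And>s. s \<in> S \<Longrightarrow> linear_form (f s)"
  shows "hom_poly (card S) (\<lambda>w. \<Prod>s\<in>S. f s w)"
  using assms
proof (induction S rule: finite_induct)
  case (insert s S)
  then show ?case by (simp add: hom_poly_linear_form_mult)
qed (simp add: hom_poly_const)

lemma det_row_combination:
  fixes x :: "'j \<Rightarrow> real^'k::finite"
  assumes "finite S"
  shows "det (\<chi> p. if p = k then (\<Sum>j\<in>S. a j *s x j) else c p)
    = (\<Sum>j\<in>S. a j * det (\<chi> p. if p = k then x j else c p))"
  using det_linear_row_sum[OF assms, of k "\<lambda>_ j. a j *s x j" c]
  by (simp add: det_row_mul[of k _ "\<lambda>_. x _" c])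

lemma linear_form_op_symbol:
  "linear_form (\<lambda>w. (op_symbol A w ** B) $ i $ j)"
  unfolding linear_form_def
proof (intro exI allI)
  fix w
  show "(op_symbol A w ** B) $ i $ j = (\<Sum>l\<in>UNIV. w $ l * (\<Sum>k\<in>UNIV. A l $ i $ k * B $ k $ j))"
    by (simp add: op_symbol_def matrix_matrix_mult_def sum_component sum_distrib_left sum_distrib_right mult.assoc)
      (rule sum.swap)
qed

text \<open>The \<open>j\<close>-th component of the symbol is a determinant bordered by the \<open>j\<close>-th row of \<open>[v, C]\<close>, where \<open>C\<close> is
  a right inverse of \<open>A(w0)\<close>; by linearity in that row, the components of \<open>A(w)b(w)\<close> are determinants with
  two equal rows.\<close>

lemma annihilating_symbol_exists:
  fixes A :: "'n::finite \<Rightarrow> real^'d^'m"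
  assumes rk: "rank (op_symbol A w0) = CARD('m)" and v: "op_symbol A w0 *v v = 0"
  obtains c :: "'n list \<Rightarrow> real^'d"
  where "\<And>w. op_symbol A w *v symb CARD('m) c w = 0" "symb CARD('m) c w0 = v"
proof -
  have "surj ((*v) (op_symbol A w0))"
    using rk by (simp add: full_rank_surjective)
  then obtain C :: "real^'m^'d" where C: "op_symbol A w0 ** C = mat 1"
    by (metis matrix_right_invertible_surjective)
  \<comment> \<open>B = [v, C] has m + 1 columns; \<open>None\<close> labels the column v, and later
    also the bordering row.\<close>
  define B :: "real^('m option)^'d" where
    "B = (\<chi> j q. case q of None \<Rightarrow> v $ j | Some l \<Rightarrow> C $ j $ l)"
  define R where "R p w = (case p of None \<Rightarrow> 0 | Some i \<Rightarrow> (op_symbol A w ** B) $ i)" for p w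
  define b where "b j w = det (\<chi> p. if p = None then B $ j else R p w)" for j w
  have hom: "hom_poly CARD('m) (b j)" for j
  proof -
    \<comment> \<open>The bordering row does not depend on w and the other m rows are linear in w,
      so the Leibniz expansion consists of products of m linear forms.\<close>
    have eq: "b j w = (\<Sum>\<sigma> | \<sigma> permutes (UNIV :: 'm option set). (of_int (sign \<sigma>) * B $ j $ \<sigma> None) *
        (\<Prod>i\<in>UNIV. (op_symbol A w ** B) $ i $ \<sigma> (Some i)))" for w
    proof -
      have "(\<Prod>p\<in>UNIV. (\<chi> p. if p = None then B $ j else R p w) $ p $ \<sigma> p)
         = B $ j $ \<sigma> None * (\<Prod>i\<in>UNIV. (op_symbol A w ** B) $ i $ \<sigma> (Some i))" for \<sigma>
        by (simp add: UNIV_option_conv prod.reindex R_def)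
      then show ?thesis
        by (simp add: b_def det_def mult.assoc)
    qed
    have "hom_poly (card (UNIV :: 'm set)) (\<lambda>w. \<Prod>i\<in>UNIV. (op_symbol A w ** B) $ i $ \<sigma> (Some i))" for \<sigma>
      by (intro hom_poly_prod linear_form_op_symbol) simp
    then show ?thesis
      unfolding eq[abs_def] by (intro hom_poly_sum hom_poly_cmult)
  qed
  have Ab: "(\<Sum>j\<in>UNIV. op_symbol A w $ i $ j * b j w) = 0" for i w
  proof -
    let ?M = "\<chi> p. if p = None then (\<Sum>j\<in>UNIV. op_symbol A w $ i $ j *s B $ j) else R p w"
    have "(\<Sum>j\<in>UNIV. op_symbol A w $ i $ j *s B $ j) = (op_symbol A w ** B) $ i"
      by (simp add: vec_eq_iff matrix_matrix_mult_def sum_component)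
    then have "det ?M = 0"
      by (intro det_identical_rows[of None "Some i"]) (auto simp: row_def vec_eq_iff R_def)
    then show ?thesis
      by (simp add: b_def det_row_combination)
  qed
  \<comment> \<open>A(w0)B = [0, I], so at w0 the rows other than the bordering one are unit
    vectors, and the determinant is the \<open>None\<close> entry of the bordering row, which is
    \<open>v $ j\<close>.\<close>
  have "b j w0 = v $ j" for j
  proof -
    have R0: "R (Some i) w0 = axis (Some i) 1" for i
    proof -
      have "(op_symbol A w0 ** B) $ i $ q = axis (Some i) 1 $ q" for q
      proof (cases q)
        case None
        have "(op_symbol A w0 ** B) $ i $ q = (op_symbol A w0 *v v) $ i"
          by (simp add: None matrix_matrix_mult_def matrix_vector_mult_def B_def)
        then show ?thesis by (simp add: v None axis_def)
      next
        case (Some l)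
        have "(op_symbol A w0 ** B) $ i $ q = (op_symbol A w0 ** C) $ i $ l"
          by (simp add: Some matrix_matrix_mult_def B_def)
        then show ?thesis by (simp add: C Some axis_def mat_def)
      qed
      then show ?thesis by (simp add: R_def vec_eq_iff)
    qed
    have R0': "R p w0 = axis p 1" if "p \<noteq> None" for p
      using that R0 by (cases p) auto
    have "b j w0 = det (\<chi> p. if p = None then (\<Sum>q\<in>UNIV. B $ j $ q *s axis q 1) else R p w0)"
      by (simp only: b_def basis_expansion)
    also have "\<dots> = (\<Sum>q\<in>UNIV. B $ j $ q * det (\<chi> p. if p = None then axis q 1 else R p w0))"
      by (rule det_row_combination) simp
    also have "\<dots> = (\<Sum>q\<in>UNIV. if q = None then B $ j $ q else 0)"
    proof (rule sum.cong[OF refl])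
      fix q :: "'m option"
      show "B $ j $ q * det (\<chi> p. if p = None then axis q 1 else R p w0) = (if q = None then B $ j $ q else 0)"
      proof (cases q)
        case None
        have "(\<chi> p. if p = None then axis q 1 else R p w0) = (mat 1 :: real^('m option)^('m option))"
          using None R0' by (auto simp: vec_eq_iff mat_def axis_def)
        then show ?thesis using None by simp
      next
        case (Some l)
        have "det (\<chi> p. if p = None then axis q 1 else R p w0) = 0"
          using Some R0 by (intro det_identical_rows[of None "Some l"]) (auto simp: row_def vec_eq_iff)
        then show ?thesis using Some by simp
      qed
    qed
    also have "\<dots> = v $ j" by (simp add: B_def)
    finally show ?thesis .
  qed
  note bv = this
  have "\<forall>j. \<exists>c. \<forall>w. b j w = symb CARD('m) c w" using hom unfolding hom_poly_def by blast
  then obtain c where c: "\<And>j w. b j w = symb CARD('m) (c j) w" by metis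
  define d :: "'n list \<Rightarrow> real^'d" where "d J = (\<chi> j. c j J)" for J
  have d: "symb CARD('m) d w $ j = b j w" for w j
    using symb_linear[OF bounded_linear_vec_nth[of j], of "CARD('m)" d w] by (simp add: c d_def)
  show thesis
  proof (rule that[of d])
    show "op_symbol A w *v symb CARD('m) d w = 0" for w
      using Ab by (simp add: vec_eq_iff matrix_vector_mult_def d)
    show "symb CARD('m) d w0 = v" using bv by (simp add: vec_eq_iff d)
  qed
qed

section \<open>Approximation by piecewise constant fields\<close>

text \<open>Families are finite so that sums of corrections stay C^k and unions of closed balls stay
  closed.\<close>

definition packing :: "'a::euclidean_space set \<Rightarrow> real \<Rightarrow> ('a \<times> real) set \<Rightarrow> bool" where
  "packing U \<rho> F \<longleftrightarrow> finite F \<and> (\<forall>p\<in>F. 0 < snd p \<and> snd p < \<rho> \<and> cball (fst p) (snd p) \<subseteq> U) \<and>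
     disjoint_family_on (\<lambda>p. cball (fst p) (snd p)) F"

lemma packing_unique:
  "packing U \<rho> F \<Longrightarrow> p \<in> F \<Longrightarrow> q \<in> F \<Longrightarrow> x \<in> cball (fst p) (snd p) \<Longrightarrow> x \<in> cball (fst q) (snd q) \<Longrightarrow> p = q"
  unfolding packing_def disjoint_family_on_def by blast

lemma emeasure_cball_ne_top: "emeasure lborel (cball a r) \<noteq> top"
  using emeasure_lborel_cball_finite[of a r] by simp

text \<open>Vitali's theorem gives countably many disjoint balls that fill U up to a null set;
  continuity of the measure from above allows a finite truncation.\<close>

lemma packing_exists:
  fixes U :: "'a::euclidean_space set"
  assumes U: "open U" "bounded U" and "\<rho> > 0" "e > 0"
  obtains F where "packing U \<rho> F" "measure lebesgue (U - (\<Union>p\<in>F. cball (fst p) (snd p))) < e"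
proof -
  let ?K = "{p. 0 < snd p \<and> snd p < \<rho> \<and> cball (fst p) (snd p) \<subseteq> U}"
  let ?B = "\<lambda>p::'a \<times> real. cball (fst p) (snd p)"
  have cover: "\<exists>p. p \<in> ?K \<and> x \<in> ?B p \<and> snd p < d" if "x \<in> U" "0 < d" for x d
  proof -
    obtain s where s: "s > 0" "cball x s \<subseteq> U" using U(1) \<open>x \<in> U\<close> open_contains_cball by blast
    define r where "r = min s (min \<rho> d) / 2"
    have "0 < r" "r < \<rho>" "r < d" "r \<le> s" using s that \<open>\<rho> > 0\<close> by (auto simp: r_def)
    moreover have "cball x r \<subseteq> U"
      by (rule order_trans[OF subset_cball[OF \<open>r \<le> s\<close>] s(2)])
    ultimately show ?thesis by (intro exI[of _ "(x, r)"]) simp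
  qed
  obtain C where C: "countable C" "C \<subseteq> ?K"
    "pairwise (\<lambda>p q. disjnt (?B p) (?B q)) C" "negligible (U - (\<Union>p\<in>C. ?B p))"
  proof (rule Vitali_covering_theorem_cballs[of ?K snd U fst, OF _ cover])
    show "0 < snd p" if "p \<in> ?K" for p using that by simp
  qed
  have fin: "packing U \<rho> F" if "F \<subseteq> C" "finite F" for F
    unfolding packing_def
  proof (intro conjI that(2) ballI)
    show "0 < snd p" "snd p < \<rho>" "?B p \<subseteq> U" if "p \<in> F" for p
      using that \<open>F \<subseteq> C\<close> C(2) by blast+
    show "disjoint_family_on ?B F"
      unfolding disjoint_family_on_def
    proof (intro ballI impI)
      fix p q assume "p \<in> F" "q \<in> F" "p \<noteq> q"
      then have "disjnt (?B p) (?B q)" using \<open>F \<subseteq> C\<close> C(3) unfolding pairwise_def by blast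
      then show "?B p \<inter> ?B q = {}" by (simp add: disjnt_def)
    qed
  qed
  show thesis
  proof (cases "C = {}")
    case True
    then have "measure lebesgue U = 0" using C(4) by (simp add: negligible_imp_measure0)
    then show ?thesis using that[of "{}"] fin[of "{}"] \<open>e > 0\<close> by simp
  next
    case False
    define S where "S n = U - (\<Union>i\<le>n. ?B (from_nat_into C i))" for n
    have lm: "S n \<in> lmeasurable" for n
      unfolding S_def by (intro fmeasurable_Diff lmeasurable_open U sets.finite_UN) auto
    have "(\<lambda>n. measure lebesgue (S n)) \<longlonglongrightarrow> measure lebesgue (\<Inter>n. S n)"
    proof (rule Lim_measure_decseq)
      show "range S \<subseteq> sets lebesgue" using lm by (auto intro: fmeasurableD)
      show "decseq S" unfolding S_def decseq_def by (intro allI impI Diff_mono UN_mono) auto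
      show "emeasure lebesgue (S n) \<noteq> \<infinity>" for n using lm[of n] by (auto simp: fmeasurable_def)
    qed
    moreover have "(\<Inter>n. S n) = U - (\<Union>p\<in>C. ?B p)"
    proof -
      have "(\<Union>p\<in>range (from_nat_into C). ?B p) = (\<Union>n. ?B (from_nat_into C n))" by simp
      then have "(\<Union>p\<in>C. ?B p) = (\<Union>n. ?B (from_nat_into C n))"
        unfolding range_from_nat_into[OF False C(1)] .
      then show ?thesis unfolding S_def by auto
    qed
    ultimately have "(\<lambda>n. measure lebesgue (S n)) \<longlonglongrightarrow> 0"
      using C(4) by (simp add: negligible_imp_measure0)
    from order_tendstoD(2)[OF this \<open>e > 0\<close>]
    obtain n where n: "measure lebesgue (S n) < e" by (auto simp: eventually_sequentially)
    let ?F = "from_nat_into C ` {..n}"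
    have "?F \<subseteq> C" using from_nat_into[OF False] by auto
    then show ?thesis
      using that[of ?F] fin[of ?F] n by (simp add: S_def image_image)
  qed
qed

section \<open>Locally constant fields and repeated modification on balls\<close>

definition loc_const :: "('a::topological_space \<Rightarrow> 'b) \<Rightarrow> 'a \<Rightarrow> bool" where
  "loc_const u x \<longleftrightarrow> (\<exists>U. open U \<and> x \<in> U \<and> (\<forall>y\<in>U. u y = u x))"

lemma loc_constI: "open U \<Longrightarrow> x \<in> U \<Longrightarrow> (\<And>y. y \<in> U \<Longrightarrow> u y = a) \<Longrightarrow> loc_const u x"
  unfolding loc_const_def by blast

lemma loc_const_cong_open:
  assumes "open U" "x \<in> U" "\<And>y. y \<in> U \<Longrightarrow> u y = v y" "loc_const v x"
  shows "loc_const u x"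
proof -
  obtain V where V: "open V" "x \<in> V" "\<forall>y\<in>V. v y = v x"
    using assms(4) unfolding loc_const_def by blast
  show ?thesis
  proof (rule loc_constI)
    show "open (U \<inter> V)" using assms(1) V(1) by (rule open_Int)
    show "x \<in> U \<inter> V" using assms(2) V(2) by blast
    show "u y = v x" if "y \<in> U \<inter> V" for y
      using assms(3)[of y] V(3)[rule_format, of y] that by simp
  qed
qed

lemma loc_const_add:
  assumes "loc_const u x" "loc_const v x"
  shows "loc_const (\<lambda>x. u x + v x) x"
proof -
  obtain U where U: "open U" "x \<in> U" "\<forall>y\<in>U. u y = u x" using assms(1) unfolding loc_const_def by blast
  obtain V where V: "open V" "x \<in> V" "\<forall>y\<in>V. v y = v x" using assms(2) unfolding loc_const_def by blast
  show ?thesis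
  proof (rule loc_constI)
    show "open (U \<inter> V)" using U(1) V(1) by (rule open_Int)
    show "x \<in> U \<inter> V" using U(2) V(2) by blast
    show "u y + v y = u x + v x" if "y \<in> U \<inter> V" for y
      using U(3)[rule_format, of y] V(3)[rule_format, of y] that by simp
  qed
qed

lemma measure_cball_scale:
  fixes x :: "'a::euclidean_space"
  assumes "0 \<le> r" "0 \<le> a"
  shows "measure lebesgue (cball x (a * r)) = a ^ DIM('a) * measure lebesgue (cball x r)"
  using assms by (simp add: content_cball power_mult_distrib measure_completion)

text \<open>One round. Balls fill at least half of U, and each becomes a region of constancy on its
  concentric half, a fraction (1/2) ^ CARD('n) of its volume; this explains the factor 1 - (1/2) ^
  Suc CARD('n). The outer shells, where the field is perturbed by at most \<epsilon> without
  becoming constant, are left in U' for later rounds.\<close>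

lemma modification_step:
  fixes c :: "'n::finite list \<Rightarrow> 'b::real_normed_vector" and U :: "(real^'n) set"
  assumes \<phi>: "C_order k \<phi>" and U: "open U" "bounded U" and \<epsilon>: "\<epsilon> > 0"
  shows "\<exists>\<phi>' U' G. C_order k \<phi>' \<and> open U' \<and> U' \<subseteq> U \<and>
      measure lebesgue U' \<le> (1 - (1/2) ^ Suc CARD('n)) * measure lebesgue U \<and>
      (\<forall>x. norm (Dop k c \<phi>' x - Dop k c \<phi> x) \<le> \<epsilon>) \<and>
      (\<forall>x. x \<notin> U \<longrightarrow> \<phi>' x = \<phi> x \<and> Dop k c \<phi>' x = Dop k c \<phi> x) \<and>
      open G \<and> G \<inter> U' = {} \<and> (\<forall>x\<in>G. loc_const (Dop k c \<phi>') x) \<and> negligible (U - U' - G)"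
proof (cases "U = {}")
  case True
  then show ?thesis using \<phi> \<epsilon>
    by (intro exI[of _ \<phi>] exI[of _ "{}"]) simp
next
  case False
  let ?m = "measure lebesgue"
  have mU: "?m U > 0"
  proof -
    have "\<not> negligible U" using False U(1) open_not_negligible by blast
    then have "?m U \<noteq> 0" using lmeasurable_open[OF U(2,1)] by (simp add: negligible_iff_measure)
    then show ?thesis by (simp add: less_le)
  qed
  obtain C where C: "C > 0" and mod:
    "\<And>\<phi> x0 r \<delta>. C_order k \<phi> \<Longrightarrow> r > 0 \<Longrightarrow> 0 \<le> \<delta> \<Longrightarrow> osc_le k \<delta> \<phi> x0 r \<Longrightarrow>
      \<exists>\<tau>. C_order k \<tau> \<and> vanishes_off (cball x0 r) \<tau> \<and> (\<forall>x. norm (Dop k c \<tau> x) \<le> C * \<delta>) \<and>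
         (\<forall>x\<in>ball x0 (r / 2). Dop k c \<phi> x + Dop k c \<tau> x = Dop k c \<phi> x0)"
    using ball_modification[of k c] by blast
  define \<delta> where "\<delta> = \<epsilon> / C"
  have \<delta>: "\<delta> > 0" "C * \<delta> = \<epsilon>" using C \<epsilon> by (simp_all add: \<delta>_def)
  obtain \<rho> where \<rho>: "\<rho> > 0" "\<And>x0 r. x0 \<in> U \<Longrightarrow> 0 < r \<Longrightarrow> r < \<rho> \<Longrightarrow> osc_le k \<delta> \<phi> x0 r"
    using osc_le_exists[OF U(2) \<delta>(1) \<phi>] by blast
  have half: "?m U / 2 > 0" using mU by simp
  obtain F where F: "packing U \<rho> F" "?m (U - (\<Union>p\<in>F. cball (fst p) (snd p))) < ?m U / 2"
    using packing_exists[OF U \<rho>(1) half] by blast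
  let ?B = "\<lambda>p::(real^'n) \<times> real. cball (fst p) (snd p)"
  let ?H = "\<lambda>p::(real^'n) \<times> real. cball (fst p) (snd p / 2)"
  let ?I = "\<lambda>p::(real^'n) \<times> real. ball (fst p) (snd p / 2)"
  have fF: "finite F" and posF: "\<And>p. p \<in> F \<Longrightarrow> 0 < snd p" and BU: "\<And>p. p \<in> F \<Longrightarrow> ?B p \<subseteq> U"
    using F(1) by (auto simp: packing_def)
  have HB: "?H p \<subseteq> ?B p" if "p \<in> F" for p using posF[OF that] by auto
  have IB: "?I p \<subseteq> ?B p" if "p \<in> F" for p using posF[OF that] by auto
  have "\<forall>p\<in>F. \<exists>\<tau>. C_order k \<tau> \<and> vanishes_off (?B p) \<tau> \<and> (\<forall>x. norm (Dop k c \<tau> x) \<le> C * \<delta>) \<and>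
         (\<forall>x\<in>?I p. Dop k c \<phi> x + Dop k c \<tau> x = Dop k c \<phi> (fst p))"
  proof
    fix p assume p: "p \<in> F"
    have "fst p \<in> ?B p" using posF[OF p] by simp
    then have "fst p \<in> U" using BU[OF p] by blast
    moreover have "snd p < \<rho>" using F(1) p by (auto simp: packing_def)
    ultimately show "\<exists>\<tau>. C_order k \<tau> \<and> vanishes_off (?B p) \<tau> \<and> (\<forall>x. norm (Dop k c \<tau> x) \<le> C * \<delta>) \<and>
         (\<forall>x\<in>?I p. Dop k c \<phi> x + Dop k c \<tau> x = Dop k c \<phi> (fst p))"
      using \<delta>(1) posF[OF p] by (intro mod \<phi> \<rho>(2)) auto
  qed
  then obtain \<tau> where "\<forall>p\<in>F. C_order k (\<tau> p) \<and> vanishes_off (?B p) (\<tau> p) \<and> (\<forall>x. norm (Dop k c (\<tau> p) x) \<le> C * \<delta>) \<and>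
         (\<forall>x\<in>?I p. Dop k c \<phi> x + Dop k c (\<tau> p) x = Dop k c \<phi> (fst p))"
    by (rule bchoice[THEN exE])
  then have \<tau>: "\<And>p. p \<in> F \<Longrightarrow> C_order k (\<tau> p)" "\<And>p. p \<in> F \<Longrightarrow> vanishes_off (?B p) (\<tau> p)"
    "\<And>p x. p \<in> F \<Longrightarrow> norm (Dop k c (\<tau> p) x) \<le> \<epsilon>"
    "\<And>p x. p \<in> F \<Longrightarrow> x \<in> ?I p \<Longrightarrow> Dop k c \<phi> x + Dop k c (\<tau> p) x = Dop k c \<phi> (fst p)"
    unfolding \<delta>(2) by blast+
  define \<phi>' where "\<phi>' = (\<lambda>x. \<phi> x + (\<Sum>p\<in>F. \<tau> p x))"
  \<comment> \<open>The closed half balls are removed so that U' is open again; the points of U that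
    lie neither in U' nor in \<open>G\<close> are contained in finitely many spheres.\<close>
  define U' where "U' = U - (\<Union>p\<in>F. ?H p)"
  define G where "G = (\<Union>p\<in>F. ?I p)"
  have Cs: "C_order k (\<lambda>x. \<Sum>p\<in>F. \<tau> p x)" by (intro C_order_sum \<tau>(1))
  have C\<phi>': "C_order k \<phi>'" unfolding \<phi>'_def by (rule C_order_add[OF \<phi> Cs])
  have vD: "vanishes_off (?B p) (Dop k c (\<tau> p))" if "p \<in> F" for p
    by (rule Dop_vanishes_off[OF closed_cball \<tau>(2)[OF that]])
  have D: "Dop k c \<phi>' x = Dop k c \<phi> x + (\<Sum>p\<in>F. Dop k c (\<tau> p) x)" for x
    unfolding \<phi>'_def by (simp add: Dop_add[OF \<phi> Cs] Dop_sum[OF \<tau>(1)])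
  have single: "(\<Sum>q\<in>F. Dop k c (\<tau> q) x) = Dop k c (\<tau> p) x" if "p \<in> F" "x \<in> ?B p" for p x
  proof -
    have "Dop k c (\<tau> q) x = 0" if q: "q \<in> F - {p}" for q
      using vD[of q] q packing_unique[OF F(1) \<open>p \<in> F\<close> _ \<open>x \<in> ?B p\<close>, of q]
      unfolding vanishes_off_def by blast
    then show ?thesis using fF \<open>p \<in> F\<close> by (simp add: sum.remove[of F p])
  qed
  have none: "(\<Sum>q\<in>F. Dop k c (\<tau> q) x) = 0" if "\<And>p. p \<in> F \<Longrightarrow> x \<notin> ?B p" for x
    by (rule sum.neutral) (use vD that in \<open>unfold vanishes_off_def, blast\<close>)
  show ?thesis
  proof (intro exI conjI allI ballI impI)
    show "C_order k \<phi>'" by (rule C\<phi>')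
    show "open U'" unfolding U'_def using fF by (intro open_Diff U closed_UN) auto
    show "U' \<subseteq> U" by (auto simp: U'_def)
    show "norm (Dop k c \<phi>' x - Dop k c \<phi> x) \<le> \<epsilon>" for x
    proof (cases "\<exists>p\<in>F. x \<in> ?B p")
      case True
      then obtain p where p: "p \<in> F" "x \<in> ?B p" by blast
      then show ?thesis using D[of x] single[OF p] \<tau>(3)[OF p(1), of x] by simp
    next
      case False
      then have "(\<Sum>q\<in>F. Dop k c (\<tau> q) x) = 0" by (intro none) blast
      then show ?thesis using D[of x] \<epsilon> by simp
    qed
    fix x assume x: "x \<notin> U"
    have nB: "x \<notin> ?B p" if "p \<in> F" for p using BU[OF that] x by blast
    have "\<tau> p x = 0" if "p \<in> F" for p using \<tau>(2)[OF that] nB[OF that] by (simp add: vanishes_off_def)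
    then show "\<phi>' x = \<phi> x" by (simp add: \<phi>'_def)
    show "Dop k c \<phi>' x = Dop k c \<phi> x" using D[of x] none[OF nB] by simp
  next
    show "open G" unfolding G_def by blast
    have "?I p \<subseteq> ?H p" for p by auto
    then show "G \<inter> U' = {}" unfolding G_def U'_def by blast
    fix x assume "x \<in> G"
    then obtain p where p: "p \<in> F" "x \<in> ?I p" unfolding G_def by blast
    show "loc_const (Dop k c \<phi>') x"
    proof (rule loc_constI[OF open_ball p(2)])
      fix y assume y: "y \<in> ?I p"
      then have "y \<in> ?B p" using IB[OF p(1)] by blast
      then show "Dop k c \<phi>' y = Dop k c \<phi> (fst p)"
        using D[of y] single[OF p(1)] \<tau>(4)[OF p(1) y] by simp
    qed
  next
    have "negligible (\<Union>p\<in>F. sphere (fst p) (snd p / 2))"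
      using fF by (intro negligible_Union) (auto intro: negligible_sphere)
    moreover have "U - U' - G \<subseteq> (\<Union>p\<in>F. sphere (fst p) (snd p / 2))"
    proof
      fix x assume "x \<in> U - U' - G"
      then obtain p where "p \<in> F" "x \<in> ?H p" "x \<notin> ?I p" unfolding U'_def G_def by blast
      then show "x \<in> (\<Union>p\<in>F. sphere (fst p) (snd p / 2))" by (intro UN_I[of p]) auto
    qed
    ultimately show "negligible (U - U' - G)" by (rule negligible_subset)
  next
    have lmU: "U \<in> lmeasurable" by (rule lmeasurable_open[OF U(2,1)])
    have djB: "disjoint_family_on ?B F" using F(1) by (simp add: packing_def)
    have djH: "disjoint_family_on ?H F"
      using djB HB unfolding disjoint_family_on_def by blast
    have mB: "?m (\<Union>p\<in>F. ?B p) = (\<Sum>p\<in>F. ?m (?B p))"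
      using fF djB by (intro measure_finite_Union) (auto simp: emeasure_cball_ne_top)
    have mH: "?m (\<Union>p\<in>F. ?H p) = (\<Sum>p\<in>F. ?m (?H p))"
      using fF djH by (intro measure_finite_Union) (auto simp: emeasure_cball_ne_top)
    have "?m (?H p) = (1/2) ^ CARD('n) * ?m (?B p)" if "p \<in> F" for p
      using measure_cball_scale[of "snd p" "1/2" "fst p"] posF[OF that] by simp
    then have HBm: "?m (\<Union>p\<in>F. ?H p) = (1/2) ^ CARD('n) * ?m (\<Union>p\<in>F. ?B p)"
      by (simp add: mB mH sum_distrib_left)
    have "?m (U - (\<Union>p\<in>F. ?B p)) = ?m U - ?m (\<Union>p\<in>F. ?B p)"
    proof (intro measurable_measure_Diff lmU)
      show "(\<Union>p\<in>F. ?B p) \<in> sets lebesgue" using fF by (intro sets.finite_UN) auto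
      show "(\<Union>p\<in>F. ?B p) \<subseteq> U" using BU by blast
    qed
    then have "?m (\<Union>p\<in>F. ?B p) \<ge> ?m U / 2" using F(2) by simp
    then have "(1/2) ^ CARD('n) * (?m U / 2) \<le> ?m (\<Union>p\<in>F. ?H p)"
      unfolding HBm by (intro mult_left_mono) auto
    moreover have "?m U' = ?m U - ?m (\<Union>p\<in>F. ?H p)"
      unfolding U'_def
    proof (intro measurable_measure_Diff lmU)
      show "(\<Union>p\<in>F. ?H p) \<in> sets lebesgue" using fF by (intro sets.finite_UN) auto
      show "(\<Union>p\<in>F. ?H p) \<subseteq> U" using BU HB by blast
    qed
    ultimately show "?m U' \<le> (1 - (1/2) ^ Suc CARD('n)) * ?m U"
      by (simp add: algebra_simps)
  qed
qed

text \<open>Rounds of \<open>modification_step\<close> with errors \<epsilon> / 2 ^ Suc n. The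
  region still to be treated shrinks geometrically in measure, and outside it the fields no longer
  change. The limit u is not claimed to have a potential; the sequence \<psi> is part of the
  conclusion so that the equation and the mean can be passed to the limit.\<close>

lemma piecewise_constant_approximation:
  fixes c :: "'n::finite list \<Rightarrow> 'b::euclidean_space" and U :: "(real^'n) set"
  assumes \<phi>: "C_order k \<phi>" and U: "open U" "bounded U" and \<epsilon>: "\<epsilon> > 0"
  shows "\<exists>u \<psi>. (\<forall>n. C_order k (\<psi> n)) \<and> (\<forall>n x. x \<notin> U \<longrightarrow> \<psi> n x = \<phi> x) \<and>
    (\<forall>n x. norm (Dop k c (\<psi> n) x - Dop k c \<phi> x) \<le> \<epsilon>) \<and>
    (\<forall>x. (\<lambda>n. Dop k c (\<psi> n) x) \<longlonglongrightarrow> u x) \<and>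
    (\<forall>x. x \<notin> U \<longrightarrow> u x = Dop k c \<phi> x) \<and> negligible {x\<in>U. \<not> loc_const u x}"
proof -
  let ?m = "measure lebesgue"
  let ?\<theta> = "1 - (1/2) ^ Suc CARD('n) :: real"
  \<comment> \<open>The clause for n = 0 fixes the starting point of the dependent choice.\<close>
  define P where "P n s \<longleftrightarrow> C_order k (fst s) \<and> open (snd s) \<and> bounded (snd s) \<and> (n = (0::nat) \<longrightarrow> s = (\<phi>, U))"
    for n and s :: "(real^'n \<Rightarrow> real) \<times> (real^'n) set"
  define Q where "Q n s t \<longleftrightarrow> snd t \<subseteq> snd s \<and> ?m (snd t) \<le> ?\<theta> * ?m (snd s) \<and>
      (\<forall>x. norm (Dop k c (fst t) x - Dop k c (fst s) x) \<le> \<epsilon> / 2 ^ Suc n) \<and>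
      (\<forall>x. x \<notin> snd s \<longrightarrow> fst t x = fst s x \<and> Dop k c (fst t) x = Dop k c (fst s) x) \<and>
      (\<exists>G. open G \<and> G \<inter> snd t = {} \<and> (\<forall>x\<in>G. loc_const (Dop k c (fst t)) x) \<and> negligible (snd s - snd t - G))"
    for n :: nat and s t :: "(real^'n \<Rightarrow> real) \<times> (real^'n) set"
  have "\<exists>f. \<forall>n. P n (f n) \<and> Q n (f n) (f (Suc n))"
  proof (rule dependent_nat_choice)
    show "\<exists>s. P 0 s" using \<phi> U by (auto simp: P_def)
    fix s n assume s: "P n s"
    have "\<epsilon> / 2 ^ Suc n > 0" using \<epsilon> by simp
    from modification_step[OF _ _ _ this, of k "fst s" "snd s" c] s
    obtain \<phi>' U' G where *: "C_order k \<phi>'" "open U'" "U' \<subseteq> snd s"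
      "?m U' \<le> ?\<theta> * ?m (snd s)"
      "(\<forall>x. norm (Dop k c \<phi>' x - Dop k c (fst s) x) \<le> \<epsilon> / 2 ^ Suc n)"
      "(\<forall>x. x \<notin> snd s \<longrightarrow> \<phi>' x = fst s x \<and> Dop k c \<phi>' x = Dop k c (fst s) x)"
      "open G" "G \<inter> U' = {}" "(\<forall>x\<in>G. loc_const (Dop k c \<phi>') x)" "negligible (snd s - U' - G)"
      unfolding P_def by blast
    have "bounded U'" using *(3) s bounded_subset unfolding P_def by blast
    then have "P (Suc n) (\<phi>', U')" using *(1,2) by (simp add: P_def)
    moreover have "Q n s (\<phi>', U')"
      unfolding Q_def fst_conv snd_conv using * by blast
    ultimately show "\<exists>t. P (Suc n) t \<and> Q n s t" by blast
  qed
  then obtain f where f: "\<And>n. P n (f n)" "\<And>n. Q n (f n) (f (Suc n))" by blast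
  define \<psi> where "\<psi> n = fst (f n)" for n
  define V where "V n = snd (f n)" for n
  define d where "d n = Dop k c (\<psi> n)" for n
  have 0: "\<psi> 0 = \<phi>" "V 0 = U" using f(1)[of 0] by (simp_all add: P_def \<psi>_def V_def)
  have C\<psi>: "C_order k (\<psi> n)" and oV: "open (V n)" and bV: "bounded (V n)" for n
    using f(1)[of n] by (simp_all add: P_def \<psi>_def V_def)
  have VS: "V (Suc n) \<subseteq> V n" and mV: "?m (V (Suc n)) \<le> ?\<theta> * ?m (V n)"
    and dS: "norm (d (Suc n) x - d n x) \<le> \<epsilon> / 2 ^ Suc n" for n x
    using f(2)[of n] unfolding Q_def \<psi>_def V_def d_def by blast+
  have off: "\<psi> (Suc n) x = \<psi> n x" "d (Suc n) x = d n x" if "x \<notin> V n" for n x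
    using f(2)[of n] that unfolding Q_def \<psi>_def V_def d_def by blast+
  have "\<forall>n. \<exists>G. open G \<and> G \<inter> V (Suc n) = {} \<and> (\<forall>x\<in>G. loc_const (d (Suc n)) x) \<and> negligible (V n - V (Suc n) - G)"
    using f(2) unfolding Q_def \<psi>_def V_def d_def by blast
  then obtain G where G: "\<And>n. open (G n)" "\<And>n. G n \<inter> V (Suc n) = {}"
    "\<And>n x. x \<in> G n \<Longrightarrow> loc_const (d (Suc n)) x" "\<And>n. negligible (V n - V (Suc n) - G n)"
    by metis
  have Vmono: "V n \<subseteq> V m" if "m \<le> n" for m n
    using that VS by (induction n rule: dec_induct) blast+
  have dconst: "d n x = d m x" if "m \<le> n" "x \<notin> V m" for m n x
    using that(1)
  proof (induction n rule: dec_induct)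
    case (step n)
    have "x \<notin> V n" using Vmono[OF step.hyps(1)] that(2) by blast
    then show ?case using off(2)[of x n] step.IH by simp
  qed simp
  have offU: "\<psi> n x = \<phi> x" if "x \<notin> U" for n x
  proof (induction n)
    case (Suc n)
    have "x \<notin> V n" using Vmono[of 0 n] that 0 by blast
    then show ?case using off(1)[of x n] Suc by simp
  qed (simp add: 0)
  \<comment> \<open>The factor 1 - (1/2) ^ n is the partial sum of the error series, so the total
    stays below \<epsilon>.\<close>
  have bound: "norm (d n x - d 0 x) \<le> \<epsilon> * (1 - (1/2) ^ n)" for n x
  proof (induction n)
    case (Suc n)
    have "norm (d (Suc n) x - d 0 x) \<le> norm (d (Suc n) x - d n x) + norm (d n x - d 0 x)"
      using norm_triangle_ineq[of "d (Suc n) x - d n x" "d n x - d 0 x"] by simp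
    also have "\<dots> \<le> \<epsilon> / 2 ^ Suc n + \<epsilon> * (1 - (1/2) ^ n)" by (intro add_mono dS Suc)
    also have "\<dots> = \<epsilon> * (1 - (1/2) ^ Suc n)" by (simp add: field_simps)
    finally show ?case .
  qed simp
  have "\<exists>l. (\<lambda>n. d n x) \<longlonglongrightarrow> l" for x
  proof -
    have "summable (\<lambda>n. \<epsilon> * (1/2) ^ Suc n)"
      by (intro summable_mult) (simp add: summable_geometric)
    then have "summable (\<lambda>n. d (Suc n) x - d n x)"
      by (rule summable_comparison_test'[where N = 0]) (use dS in \<open>simp add: power_divide\<close>)
    then have "(\<lambda>n. \<Sum>i<n. d (Suc i) x - d i x) \<longlonglongrightarrow> (\<Sum>i. d (Suc i) x - d i x)"
      by (rule summable_LIMSEQ)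
    then have "(\<lambda>n. (d n x - d 0 x) + d 0 x) \<longlonglongrightarrow> (\<Sum>i. d (Suc i) x - d i x) + d 0 x"
      by (intro tendsto_add tendsto_const) (simp add: sum_lessThan_telescope[of "\<lambda>i. d i x"])
    then show ?thesis by auto
  qed
  then have "\<forall>x. \<exists>l. (\<lambda>n. d n x) \<longlonglongrightarrow> l" by blast
  then have "\<exists>u. \<forall>x. (\<lambda>n. d n x) \<longlonglongrightarrow> u x" by (rule choice)
  then obtain u where u: "\<And>x. (\<lambda>n. d n x) \<longlonglongrightarrow> u x" by blast
  have uV: "u x = d m x" if "x \<notin> V m" for m x
  proof -
    have "eventually (\<lambda>n. d n x = d m x) sequentially"
      using dconst[OF _ that] eventually_sequentially by blast
    then have "(\<lambda>n. d n x) \<longlonglongrightarrow> d m x" by (rule tendsto_eventually)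
    then show ?thesis using LIMSEQ_unique[OF u] by blast
  qed
  have loc: "loc_const u x" if "x \<in> G n" for x n
  proof (rule loc_const_cong_open[OF G(1) that _ G(3)[OF that]])
    fix y assume "y \<in> G n"
    then have "y \<notin> V (Suc n)" using G(2)[of n] by blast
    then show "u y = d (Suc n) y" by (rule uV)
  qed
  have lmV: "V n \<in> lmeasurable" for n by (rule lmeasurable_open[OF bV oV])
  have pow: "?m (V n) \<le> ?\<theta> ^ n * ?m U" for n
  proof (induction n)
    case (Suc n)
    have "(1/2::real) ^ Suc CARD('n) \<le> 1" by (rule power_le_one) auto
    then have "?\<theta> \<ge> 0" by simp
    then have "?\<theta> * ?m (V n) \<le> ?\<theta> * (?\<theta> ^ n * ?m U)" by (rule mult_left_mono[OF Suc])
    with mV[of n] show ?case by simp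
  qed (simp add: 0)
  have negV: "negligible (\<Inter>n. V n)"
    unfolding negligible_outer_le
  proof (intro allI impI)
    fix e :: real assume "e > 0"
    have "(1/2::real) ^ Suc CARD('n) \<le> 1" by (rule power_le_one) auto
    then have "(\<lambda>n. ?\<theta> ^ n * ?m U) \<longlonglongrightarrow> 0 * ?m U"
      by (intro tendsto_mult tendsto_const LIMSEQ_power_zero) simp
    then have "eventually (\<lambda>n. ?\<theta> ^ n * ?m U < e) sequentially"
      using \<open>e > 0\<close> by (intro order_tendstoD(2)[of _ "0 * ?m U"]) simp_all
    then obtain n where "?\<theta> ^ n * ?m U < e" using eventually_happens by fastforce
    then have "?m (V n) \<le> e" using pow[of n] by simp
    then show "\<exists>T. (\<Inter>n. V n) \<subseteq> T \<and> T \<in> lmeasurable \<and> ?m T \<le> e"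
      using lmV[of n] by blast
  qed
  have negR: "negligible (\<Union>n. V n - V (Suc n) - G n)"
    using G(4) by (intro negligible_countable_Union) auto
  \<comment> \<open>A point of U either survives all rounds or is removed in a definite round; in
    the second case u is constant near it unless it lies in the null set lost in that round.\<close>
  have "{x\<in>U. \<not> loc_const u x} \<subseteq> (\<Inter>n. V n) \<union> (\<Union>n. V n - V (Suc n) - G n)"
  proof
    fix x assume x: "x \<in> {x\<in>U. \<not> loc_const u x}"
    show "x \<in> (\<Inter>n. V n) \<union> (\<Union>n. V n - V (Suc n) - G n)"
    proof (cases "\<forall>n. x \<in> V n")
      case False
      define n where "n = (LEAST n. x \<notin> V n)"
      have n: "x \<notin> V n" using False unfolding n_def by (metis LeastI)
      have "x \<in> V 0" using x 0(2) by simp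
      then have "n \<noteq> 0" using n by metis
      then obtain j where j: "n = Suc j" by (cases n) auto
      have "x \<in> V j" using not_less_Least[of j "\<lambda>n. x \<notin> V n"] j unfolding n_def by auto
      moreover have "x \<notin> G j" using x loc by blast
      ultimately show ?thesis using n j by blast
    qed blast
  qed
  then have neg: "negligible {x\<in>U. \<not> loc_const u x}"
    by (rule negligible_subset[OF negligible_Un[OF negV negR]])
  show ?thesis
  proof (intro exI[of _ u] exI[of _ \<psi>] conjI allI impI C\<psi> neg)
    show "\<psi> n x = \<phi> x" if "x \<notin> U" for n x by (rule offU[OF that])
    show "norm (Dop k c (\<psi> n) x - Dop k c \<phi> x) \<le> \<epsilon>" for n x
    proof -
      have "\<epsilon> * (1 - (1/2) ^ n) \<le> \<epsilon>" using \<epsilon> by (simp add: mult_le_cancel_left1)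
      then show ?thesis using bound[of n x] 0 by (simp add: d_def)
    qed
    show "(\<lambda>n. Dop k c (\<psi> n) x) \<longlonglongrightarrow> u x" for x using u[of x] by (simp add: d_def)
    show "u x = Dop k c \<phi> x" if "x \<notin> U" for x using uV[of x 0] that 0 by (simp add: d_def)
  qed
qed

section \<open>Modulated plane waves\<close>

text \<open>Mean zero over a period is expressed by an antiderivative with equal values at 0 and 1,
  which is the form used for the next integration.\<close>

definition periodic_mean0 :: "(real \<Rightarrow> real) \<Rightarrow> bool" where
  "periodic_mean0 f \<longleftrightarrow> continuous_on UNIV f \<and> (\<forall>x. f (x + 1) = f x) \<and>
     (\<exists>F. (\<forall>x. (F has_real_derivative f x) (at x)) \<and> F 1 = F 0)"

text \<open>Mean zero makes the antiderivative F periodic; subtracting its own mean m restores mean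
  zero, so that the step can be repeated.\<close>

lemma periodic_mean0_antiderivative:
  assumes "periodic_mean0 f"
  shows "\<exists>g. (\<forall>x. (g has_real_derivative f x) (at x)) \<and> periodic_mean0 g"
proof -
  have per: "\<And>x. f (x + 1) = f x" using assms by (simp add: periodic_mean0_def)
  obtain F where F: "\<And>x. (F has_real_derivative f x) (at x)" "F 1 = F 0"
    using assms unfolding periodic_mean0_def by blast
  have shift: "((\<lambda>x. F (x + 1)) has_real_derivative f x) (at x)" for x
    using F(1)[of "x + 1"] per[of x] by (simp add: DERIV_shift)
  have "((\<lambda>x. F (x + 1) - F x) has_real_derivative 0) (at x)" for x
    using DERIV_diff[OF shift F(1), of x] by simp
  then have "F (x + 1) - F x = F (0 + 1) - F 0" for x
    using DERIV_isconst_all[of "\<lambda>x. F (x + 1) - F x" x 0] by blast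
  then have Fper: "F (x + 1) = F x" for x using F(2) by simp
  have Fc: "continuous_on UNIV F"
    by (intro continuous_at_imp_continuous_on ballI DERIV_isCont[OF F(1)])
  obtain \<Phi> where \<Phi>: "\<And>x. (\<Phi> has_real_derivative F x) (at x)"
    using ex_antiderivative[OF Fc] by blast
  define m where "m = \<Phi> 1 - \<Phi> 0"
  have D1: "((\<lambda>x. F x - m) has_real_derivative f x) (at x)" for x
    using DERIV_diff[OF F(1) DERIV_const, of m x] by simp
  have D2: "((\<lambda>x. \<Phi> x - m * x) has_real_derivative F x - m) (at x)" for x
    using DERIV_diff[OF \<Phi> DERIV_cmult_Id, of m x] by simp
  have "periodic_mean0 (\<lambda>x. F x - m)"
    unfolding periodic_mean0_def
  proof (intro conjI allI exI)
    show "continuous_on UNIV (\<lambda>x. F x - m)" using Fc by (intro continuous_intros)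
    show "F (x + 1) - m = F x - m" for x by (simp add: Fper)
    show "((\<lambda>x. \<Phi> x - m * x) has_real_derivative F x - m) (at x)" for x by (rule D2)
    show "\<Phi> 1 - m * 1 = \<Phi> 0 - m * 0" by (simp add: m_def)
  qed
  with D1 show ?thesis by blast
qed

lemma periodic_mean0_bounded:
  assumes "periodic_mean0 f"
  shows "\<exists>B>0. \<forall>x. \<bar>f x\<bar> \<le> B"
proof -
  have per: "\<And>x. f (x + 1) = f x" and c: "continuous_on UNIV f"
    using assms by (simp_all add: periodic_mean0_def)
  have pern: "f (x + real n) = f x" for x n
  proof (induction n)
    case (Suc n)
    then show ?case using per[of "x + real n"] by (simp add: add_ac)
  qed simp
  have peri: "f (x + of_int n) = f x" for x n
  proof (cases "n \<ge> 0")
    case True then show ?thesis using pern[of x "nat n"] by simp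
  next
    case False then show ?thesis using pern[of "x + of_int n" "nat (- n)"] by simp
  qed
  have "compact (f ` {0..1})"
    by (intro compact_continuous_image continuous_on_subset[OF c]) auto
  then obtain B where B: "B > 0" "\<And>y. y \<in> f ` {0..1} \<Longrightarrow> norm y \<le> B"
    using compact_imp_bounded bounded_pos by metis
  have "\<bar>f x\<bar> \<le> B" for x
  proof -
    have "f x = f (frac x)" using peri[of x "- \<lfloor>x\<rfloor>"] by (simp add: frac_def)
    moreover have "frac x \<in> {0..1}" using frac_lt_1[of x] by (auto intro: less_imp_le)
    ultimately show ?thesis using B(2)[of "f x"] by simp
  qed
  with B(1) show ?thesis by blast
qed

text \<open>The potential of a plane wave with given profile needs k antiderivatives of that
  profile. Subtracting the means keeps all of them bounded, which makes the potential small at high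
  frequency.\<close>

lemma iterated_antiderivatives:
  assumes "periodic_mean0 h"
  obtains g :: "nat \<Rightarrow> real \<Rightarrow> real" where "g 0 = h" "\<And>j x. (g (Suc j) has_real_derivative g j x) (at x)"
    "\<And>j. \<exists>B>0. \<forall>x. \<bar>g j x\<bar> \<le> B"
proof -
  have "\<exists>g. \<forall>n. (periodic_mean0 (g n) \<and> (n = (0::nat) \<longrightarrow> g n = h)) \<and> (\<forall>x. (g (Suc n) has_real_derivative g n x) (at x))"
  proof (rule dependent_nat_choice)
    show "\<exists>g. periodic_mean0 g \<and> ((0::nat) = 0 \<longrightarrow> g = h)" using assms by blast
    fix f and n :: nat assume "periodic_mean0 f \<and> (n = 0 \<longrightarrow> f = h)"
    then show "\<exists>g. (periodic_mean0 g \<and> (Suc n = 0 \<longrightarrow> g = h)) \<and> (\<forall>x. (g has_real_derivative f x) (at x))"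
      using periodic_mean0_antiderivative[of f] by blast
  qed
  then obtain g where g: "\<And>n. periodic_mean0 (g n)" "g 0 = h" "\<And>n x. (g (Suc n) has_real_derivative g n x) (at x)"
    by blast
  show thesis by (rule that[of g, OF g(2) g(3) periodic_mean0_bounded[OF g(1)]])
qed

section \<open>Square waves with two plateaus\<close>

definition clamp01 :: "real \<Rightarrow> real \<Rightarrow> real" where
  "clamp01 t y = max (t - 1) (min t y)"

lemma clamp01_range: "0 \<le> t \<Longrightarrow> t \<le> 1 \<Longrightarrow> t - 1 \<le> clamp01 t y \<and> clamp01 t y \<le> t"
  by (auto simp: clamp01_def)

lemma clamp01_lipschitz: "\<bar>clamp01 t y - clamp01 t z\<bar> \<le> \<bar>y - z\<bar>"
  by (auto simp: clamp01_def max_def min_def)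

text \<open>A continuous wave of period 1 with slopes of size K between the plateaus t - 1 and t.
  For \<xi> = t a + (1 - t) b and v = b - a these are the values with \<xi> + (t - 1) v = a and
  \<xi> + t v = b. The level q governs the widths of the plateaus.\<close>

definition square_wave :: "real \<Rightarrow> real \<Rightarrow> real \<Rightarrow> real \<Rightarrow> real" where
  "square_wave t K q s = clamp01 t (K * (q - infdist s \<int>))"

lemma infdist_Ints_attained:
  obtains z where "z \<in> \<int>" "infdist (s::real) \<int> = dist s z"
proof -
  have "(\<int>::real set) \<noteq> {}" using Ints_0 by blast
  then show thesis using infdist_attains_inf[OF closed_Ints, of s] that by blast
qed

lemma infdist_Ints_shift: "infdist (s + 1) \<int> = infdist (s::real) \<int>"
proof -
  have le: "infdist (s + of_int n) \<int> \<le> infdist s \<int>" for s :: real and n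
  proof -
    obtain z where z: "z \<in> \<int>" "infdist s \<int> = dist s z"
      by (rule infdist_Ints_attained)
    have "infdist (s + of_int n) \<int> \<le> dist (s + of_int n) (z + of_int n)"
      using z(1) by (intro infdist_le) simp
    then show ?thesis using z(2) by (simp add: dist_real_def)
  qed
  show ?thesis using le[of s 1] le[of "s + 1" "-1"] by simp
qed

text \<open>The mean depends on q in a Lipschitz way. Over the period the wave is constantly t - 1
  for q = -1 and constantly t for q = 2, so some q in between gives mean zero.\<close>

lemma square_wave_exists:
  assumes t: "0 < t" "t < 1" and K: "K \<ge> 1"
  obtains q where "periodic_mean0 (square_wave t K q)"
proof -
  have cd: "continuous_on UNIV (\<lambda>s::real. infdist s \<int>)"
    by (intro continuous_on_infdist continuous_on_id)
  have ch: "continuous_on S (square_wave t K q)" for q S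
    unfolding square_wave_def clamp01_def
    by (intro continuous_intros continuous_on_subset[OF cd]) auto
  define m where "m q = integral {0..1} (square_wave t K q)" for q
  have ii: "square_wave t K q integrable_on {0..1}" for q
    by (rule integrable_continuous_real[OF ch])
  have lip: "\<bar>m q - m q'\<bar> \<le> K * \<bar>q - q'\<bar>" for q q'
  proof -
    have "m q - m q' = integral {0..1} (\<lambda>s. square_wave t K q s - square_wave t K q' s)"
      unfolding m_def by (rule integral_diff[symmetric, OF ii ii])
    also have "norm \<dots> \<le> K * \<bar>q - q'\<bar> * (1 - 0)"
    proof (rule integral_bound)
      show "continuous_on {0..1} (\<lambda>s. square_wave t K q s - square_wave t K q' s)"
        by (intro continuous_intros ch)
      fix s :: real assume "s \<in> {0..1}"
      have "\<bar>square_wave t K q s - square_wave t K q' s\<bar> \<le> \<bar>K * (q - infdist s \<int>) - K * (q' - infdist s \<int>)\<bar>"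
        unfolding square_wave_def by (rule clamp01_lipschitz)
      also have "\<dots> = K * \<bar>q - q'\<bar>" using K by (simp add: abs_mult right_diff_distrib[symmetric])
      finally show "norm (square_wave t K q s - square_wave t K q' s) \<le> K * \<bar>q - q'\<bar>" by simp
    qed simp
    finally show ?thesis by simp
  qed
  have cm: "continuous_on {-1..2} m"
  proof (rule continuous_onI)
    fix x e :: real assume "e > 0"
    have "dist (m x') (m x) \<le> e" if "dist x' x < e / K" for x'
    proof -
      have "dist (m x') (m x) \<le> K * \<bar>x' - x\<bar>" using lip[of x' x] by (simp add: dist_real_def)
      also have "\<dots> \<le> K * (e / K)" using that K by (intro mult_left_mono) (auto simp: dist_real_def)
      finally show ?thesis using K by simp
    qed
    then show "\<exists>d>0. \<forall>x'\<in>{-1..2}. dist x' x < d \<longrightarrow> dist (m x') (m x) \<le> e"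
      using K \<open>e > 0\<close> by (intro exI[of _ "e / K"]) auto
  qed
  have d01: "infdist s \<int> \<le> 1" if "s \<in> {0..1}" for s :: real
    using infdist_le[of 0 "\<int>::real set" s] that by (simp add: dist_real_def)
  have "m (-1) = integral {0..1} (\<lambda>s::real. t - 1)"
    unfolding m_def
  proof (rule Henstock_Kurzweil_Integration.integral_cong)
    fix s :: real assume "s \<in> {0..1}"
    have "K * (- 1 - infdist s \<int>) \<le> K * (-1)"
      using K infdist_nonneg[of s \<int>] by (intro mult_left_mono) auto
    then have "K * (- 1 - infdist s \<int>) \<le> t - 1" using K t by linarith
    then show "square_wave t K (-1) s = t - 1"
      using t by (simp add: square_wave_def clamp01_def max_def min_def)
  qed
  moreover have "m 2 = integral {0..1} (\<lambda>s::real. t)"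
    unfolding m_def
  proof (rule Henstock_Kurzweil_Integration.integral_cong)
    fix s :: real assume s: "s \<in> {0..1}"
    have "K * 1 \<le> K * (2 - infdist s \<int>)"
      using K d01[OF s] by (intro mult_left_mono) auto
    then have "t \<le> K * (2 - infdist s \<int>)" using K t by linarith
    then show "square_wave t K 2 s = t"
      using t by (simp add: square_wave_def clamp01_def max_def min_def)
  qed
  ultimately have "m (-1) \<le> 0" "0 \<le> m 2" using t by simp_all
  then obtain q where q: "m q = 0"
    using IVT'[of m "-1" 0 2, OF _ _ _ cm] by auto
  obtain F where F: "\<And>x. (F has_real_derivative square_wave t K q x) (at x)"
    using ex_antiderivative[OF ch] by blast
  have "(square_wave t K q has_integral F 1 - F 0) {0..1}"
    by (rule fundamental_theorem_of_calculus)
      (use F in \<open>auto simp: has_real_derivative_iff_has_vector_derivative[symmetric] intro: has_field_derivative_at_within\<close>)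
  then have "F 1 = F 0" using q by (simp add: m_def integral_unique)
  then have "periodic_mean0 (square_wave t K q)"
    unfolding periodic_mean0_def using ch F by (auto simp: square_wave_def infdist_Ints_shift)
  then show thesis by (rule that)
qed

text \<open>Outside this region the argument of the clamp is beyond [-1, 1], which contains
  [t - 1, t], so the wave sits on one of its plateaus.\<close>

definition transition :: "real \<Rightarrow> real \<Rightarrow> real \<Rightarrow> bool" where
  "transition K q s \<longleftrightarrow> \<bar>K * (q - infdist s \<int>)\<bar> \<le> 1"

text \<open>The sign \<sigma> selects one of the two slopes of the distance to the integers. On one
  slope, two shifts in transition agree up to 2 / K modulo integers, whereas distinct shifts i / M
  and j / M differ by at least 1 / M modulo integers; K > 2 M makes these incompatible.\<close>

lemma transition_shift_unique:
  fixes M :: nat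
  assumes M: "M > 0" and K: "K > 2 * real M" and ij: "i < M" "j < M" and \<sigma>: "\<sigma> \<in> {1, -1::real}"
    and zi: "zi \<in> \<int>" "\<bar>K * (q - \<sigma> * (s + i / M - zi))\<bar> \<le> 1"
    and zj: "zj \<in> \<int>" "\<bar>K * (q - \<sigma> * (s + j / M - zj))\<bar> \<le> 1"
  shows "i = j"
proof -
  have "real M > 0" using M by simp
  then have K0: "K > 0" using K by linarith
  have e: "\<bar>q - \<sigma> * (s + i / M - zi)\<bar> \<le> 1 / K" "\<bar>q - \<sigma> * (s + j / M - zj)\<bar> \<le> 1 / K"
    using zi(2) zj(2) K0 by (simp_all only: abs_mult abs_of_pos pos_le_divide_eq mult.commute[of _ K])
  have "\<bar>(s + i / M - zi) - (s + j / M - zj)\<bar> \<le> 2 / K"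
  proof -
    have "\<bar>\<sigma> * (s + i / M - zi) - \<sigma> * (s + j / M - zj)\<bar> \<le> 1 / K + 1 / K" using e by linarith
    also have "\<sigma> * (s + i / M - zi) - \<sigma> * (s + j / M - zj) = \<sigma> * ((s + i / M - zi) - (s + j / M - zj))"
      by (simp only: right_diff_distrib)
    also have "\<bar>\<dots>\<bar> = \<bar>(s + i / M - zi) - (s + j / M - zj)\<bar>"
      using \<sigma> by (auto simp only: abs_mult insert_iff empty_iff abs_minus_cancel abs_one mult_1)
    finally show ?thesis by simp
  qed
  then have "\<bar>(real i - real j) / M - (zi - zj)\<bar> \<le> 2 / K"
    by (simp add: diff_divide_distrib add_diff_eq diff_diff_eq2 diff_diff_add add_ac)
  then have "real M * \<bar>(real i - real j) / M - (zi - zj)\<bar> \<le> real M * (2 / K)"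
    by (intro mult_left_mono) auto
  also have "real M * (2 / K) < 1" using K K0 by (simp add: field_simps)
  finally have "\<bar>real M * ((real i - real j) / M - (zi - zj))\<bar> < 1" by (simp only: abs_mult abs_of_nat)
  moreover have "real M * ((real i - real j) / M - (zi - zj)) = (real i - real j) - M * (zi - zj)"
  proof -
    have "real M * ((real i - real j) / M) = real i - real j" using M by simp
    then show ?thesis by (simp only: right_diff_distrib[of "real M" "(real i - real j) / M"])
  qed
  ultimately have lt: "\<bar>(real i - real j) - M * (zi - zj)\<bar> < 1" by (simp only:)
  obtain n where n: "zi - zj = of_int n" using Ints_diff[OF zi(1) zj(1)] by (auto elim: Ints_cases)
  have "\<bar>of_int (int i - int j - int M * n) :: real\<bar> < 1" using lt n by simp
  then have eq: "int i - int j = int M * n" by linarith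
  have "n = 0"
  proof (rule ccontr)
    assume "n \<noteq> 0"
    then have "int M * 1 \<le> int M * \<bar>n\<bar>" by (intro mult_left_mono) auto
    also have "\<dots> = \<bar>int i - int j\<bar>" by (simp add: eq abs_mult)
    also have "\<dots> < int M" using ij by linarith
    finally show False by simp
  qed
  with eq show "i = j" by simp
qed

text \<open>There is at most one shift for each of the two slopes.\<close>

lemma card_transition_le_2:
  fixes M :: nat
  assumes M: "M > 0" and K: "K > 2 * real M"
  shows "card {j. j < M \<and> transition K q (s + j / M)} \<le> 2"
proof -
  define T where "T \<sigma> = {j. j < M \<and> (\<exists>z\<in>\<int>. \<bar>K * (q - \<sigma> * (s + j / M - z))\<bar> \<le> 1)}" for \<sigma> :: real
  have fin: "finite (T \<sigma>)" for \<sigma> unfolding T_def by simp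
  have le1: "card (T \<sigma>) \<le> 1" if "\<sigma> \<in> {1, -1}" for \<sigma>
  proof -
    have "i = j" if ij: "i \<in> T \<sigma>" "j \<in> T \<sigma>" for i j
    proof -
      obtain zi where zi: "i < M" "zi \<in> \<int>" "\<bar>K * (q - \<sigma> * (s + i / M - zi))\<bar> \<le> 1"
        using ij(1) unfolding T_def by blast
      obtain zj where zj: "j < M" "zj \<in> \<int>" "\<bar>K * (q - \<sigma> * (s + j / M - zj))\<bar> \<le> 1"
        using ij(2) unfolding T_def by blast
      show ?thesis
        by (rule transition_shift_unique[OF M K zi(1) zj(1) \<open>\<sigma> \<in> {1, -1}\<close> zi(2,3) zj(2,3)])
    qed
    then show ?thesis using fin by (simp add: card_le_Suc0_iff_eq)
  qed
  have "{j. j < M \<and> transition K q (s + j / M)} \<subseteq> T 1 \<union> T (-1)"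
  proof
    fix j assume j: "j \<in> {j. j < M \<and> transition K q (s + j / M)}"
    obtain z where z: "z \<in> \<int>" "infdist (s + j / M) \<int> = dist (s + j / M) z"
      by (rule infdist_Ints_attained)
    have jM: "j < M" "\<bar>K * (q - dist (s + j / M) z)\<bar> \<le> 1"
      using j by (simp_all add: transition_def z(2))
    have "dist (s + j / M) z = 1 * (s + j / M - z) \<or> dist (s + j / M) z = (-1) * (s + j / M - z)"
      by (simp add: dist_real_def abs_if)
    then show "j \<in> T 1 \<union> T (-1)"
    proof
      assume eq: "dist (s + j / M) z = 1 * (s + j / M - z)"
      have "j \<in> T 1" unfolding T_def using jM(2)[unfolded eq] jM(1) z(1) by blast
      then show ?thesis by blast
    next
      assume eq: "dist (s + j / M) z = (-1) * (s + j / M - z)"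
      have "j \<in> T (-1)" unfolding T_def using jM(2)[unfolded eq] jM(1) z(1) by blast
      then show ?thesis by blast
    qed
  qed
  then have "card {j. j < M \<and> transition K q (s + j / M)} \<le> card (T 1 \<union> T (-1))"
    using fin by (intro card_mono) auto
  also have "\<dots> \<le> card (T 1) + card (T (-1))" by (rule card_Un_le)
  also have "\<dots> \<le> 2" using le1[of 1] le1[of "-1"] by simp
  finally show ?thesis .
qed

text \<open>Pigeonhole over the phase shifts replaces an equidistribution argument.\<close>

lemma transition_region_small:
  fixes U :: "(real^'n) set"
  assumes U: "open U" "bounded U" and M: "M > 0" and K: "K > 2 * real M"
  obtains \<tau> where "{x\<in>U. transition K q (l * (w \<bullet> x) + \<tau>)} \<in> lmeasurable"
    "measure lebesgue {x\<in>U. transition K q (l * (w \<bullet> x) + \<tau>)} \<le> 2 * measure lebesgue U / real M"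
proof -
  define R where "R j = {x\<in>U. transition K q (l * (w \<bullet> x) + j / M)}" for j :: nat
  have lmU: "U \<in> lmeasurable" by (rule lmeasurable_open[OF U(2,1)])
  have cd: "continuous_on UNIV (\<lambda>s::real. infdist s \<int>)"
    by (intro continuous_on_infdist continuous_on_id)
  have lmR: "R j \<in> lmeasurable" for j
  proof -
    have "continuous_on UNIV (\<lambda>x. \<bar>K * (q - infdist (l * (w \<bullet> x) + j / M) \<int>)\<bar>)"
      by (intro continuous_intros continuous_on_compose2[OF cd]) auto
    then have "closed {x. \<bar>K * (q - infdist (l * (w \<bullet> x) + j / M) \<int>)\<bar> \<le> 1}"
      by (intro closed_Collect_le continuous_on_const)
    moreover have "R j = U \<inter> {x. \<bar>K * (q - infdist (l * (w \<bullet> x) + j / M) \<int>)\<bar> \<le> 1}"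
      by (auto simp: R_def transition_def)
    ultimately show ?thesis using lmU by (simp add: fmeasurable_Int_fmeasurable)
  qed
  have int: "integrable lebesgue (\<lambda>x. indicator (R j) x :: real)" for j
    using lmR[of j] by (intro integrable_real_indicator) (auto simp: fmeasurable_def)
  have intU: "integrable lebesgue (\<lambda>x. indicator U x :: real)"
    using lmU by (intro integrable_real_indicator) (auto simp: fmeasurable_def)
  \<comment> \<open>Each point of U lies in at most two of the M regions, so their measures add up
    to at most twice that of U, and some region does not exceed the average.\<close>
  have "(\<Sum>j<M. measure lebesgue (R j)) = (LINT x|lebesgue. (\<Sum>j<M. indicator (R j) x))"
    using int by (simp add: Bochner_Integration.integral_sum)
  also have "\<dots> \<le> (LINT x|lebesgue. 2 * indicator U x)"
  proof (rule integral_mono)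
    show "integrable lebesgue (\<lambda>x. \<Sum>j<M. indicator (R j) x :: real)" using int by simp
    show "integrable lebesgue (\<lambda>x. 2 * indicator U x :: real)" using intU by simp
    fix x
    show "(\<Sum>j<M. indicator (R j) x) \<le> (2 * indicator U x :: real)"
    proof (cases "x \<in> U")
      case True
      have "(\<Sum>j<M. indicator (R j) x :: real) = real (card {j. j < M \<and> transition K q (l * (w \<bullet> x) + j / M)})"
        using True by (simp add: indicator_def R_def sum.If_cases Int_def)
      also have "\<dots> \<le> 2" using card_transition_le_2[OF M K, of q "l * (w \<bullet> x)"] by simp
      finally show ?thesis using True by simp
    next
      case False
      then show ?thesis by (simp add: R_def)
    qed
  qed
  also have "\<dots> = 2 * measure lebesgue U" using lmU by (simp add: fmeasurable_def)
  finally have sum: "(\<Sum>j<M. measure lebesgue (R j)) \<le> 2 * measure lebesgue U" .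
  have "\<exists>j<M. measure lebesgue (R j) \<le> 2 * measure lebesgue U / real M"
  proof (rule ccontr)
    assume "\<not> ?thesis"
    then have "\<And>j. j \<in> {..<M} \<Longrightarrow> 2 * measure lebesgue U / real M < measure lebesgue (R j)" by force
    then have "(\<Sum>j<M. 2 * measure lebesgue U / real M) < (\<Sum>j<M. measure lebesgue (R j))"
      using M by (intro sum_strict_mono) auto
    then show False using sum M by simp
  qed
  then obtain j where "measure lebesgue (R j) \<le> 2 * measure lebesgue U / real M" by blast
  then show thesis using that[of "real j / real M"] lmR[of j] by (simp add: R_def)
qed

section \<open>Plane waves and their modulation by a cut-off\<close>

lemma derivs_le_cmult: "C_order k f \<Longrightarrow> derivs_le k M f S \<Longrightarrow> derivs_le k (\<bar>a\<bar> * M) (\<lambda>x. a * f x) S"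
proof (induction k arbitrary: f)
  case 0
  then show ?case by (simp add: abs_mult mult_left_mono)
next
  case (Suc k)
  have eq: "partial i (\<lambda>x. a * f x) = (\<lambda>x. a * partial i f x)" for i
    using Suc.prems(1) by (intro ext partial_cmult) simp
  have "derivs_le k (\<bar>a\<bar> * M) (partial i (\<lambda>x. a * f x)) S" for i
    unfolding eq by (rule Suc.IH[OF C_order_partial[OF Suc.prems(1)] derivs_le_partial[OF Suc.prems(2)]])
  moreover have "\<bar>a * f x\<bar> \<le> \<bar>a\<bar> * M" if "x \<in> S" for x
    unfolding abs_mult by (intro mult_left_mono derivs_le_bound[OF Suc.prems(2) that]) simp
  ultimately show ?case by simp
qed

locale plane_wave =
  fixes g :: "nat \<Rightarrow> real \<Rightarrow> real" and w :: "real^'n::finite" and l \<tau> :: real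
  assumes g': "\<And>j x. (g (Suc j) has_real_derivative g j x) (at x)" and g0: "continuous_on UNIV (g 0)"
    and l: "l \<ge> 1"
begin

text \<open>The factor 1 / l ^ j cancels the powers of l from j differentiations: each derivative
  lowers j by one and multiplies by a component of w, so an operator of order k turns
  \<open>wave k\<close> into its symbol at w times the profile \<open>g 0\<close>.\<close>

definition wave :: "nat \<Rightarrow> real^'n \<Rightarrow> real" where
  "wave j x = (1 / l ^ j) * g j (l * (w \<bullet> x) + \<tau>)"

lemma partial_wave: "wave (Suc j) differentiable (at x)" "partial i (wave (Suc j)) x = w $ i * wave j x"
proof -
  let ?a = "\<lambda>x. l * (w \<bullet> x) + \<tau>"
  have d: "(\<lambda>x. w \<bullet> x) differentiable (at x)"
    by (rule C_order_differentiable[OF C_order_inner])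
  have da: "?a differentiable (at x)"
    by (intro differentiable_add differentiable_mult differentiable_const d)
  have pa: "partial i ?a x = l * w $ i"
    using partial_add[of "\<lambda>x. l * (w \<bullet> x)" x "\<lambda>x. \<tau>" i] d
    by (simp add: partial_cmult[OF d] partial_inner differentiable_mult)
  have eq: "wave (Suc j) = (\<lambda>x. (1 / l ^ Suc j) * g (Suc j) (?a x))"
    by (rule ext) (simp add: wave_def)
  show "wave (Suc j) differentiable (at x)"
    unfolding eq
    by (intro differentiable_mult differentiable_const partial_compose(1)[where f = "g (Suc j)" and g = ?a, OF g' da])
  show "partial i (wave (Suc j)) x = w $ i * wave j x"
    unfolding eq
    by (subst partial_cmult[OF partial_compose(1)[where f = "g (Suc j)" and g = ?a, OF g' da]],
        subst partial_compose(2)[where f = "g (Suc j)" and g = ?a, OF g' da])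
      (use l in \<open>simp add: pa wave_def\<close>)
qed

lemma partial_wave_fun: "partial i (wave (Suc j)) = (\<lambda>x. w $ i * wave j x)"
  using partial_wave(2) by blast

lemma C_order_wave: "C_order j (wave j)"
proof (induction j)
  case 0
  have "wave 0 = (\<lambda>x. g 0 (l * (w \<bullet> x) + \<tau>))" by (rule ext) (simp add: wave_def)
  then show ?case by (auto intro!: continuous_on_compose2[OF g0] continuous_intros)
next
  case (Suc j)
  then show ?case using partial_wave(1) by (simp add: partial_wave_fun C_order_cmult)
qed

lemma Dop_wave: "Dop k c (wave k) x = g 0 (l * (w \<bullet> x) + \<tau>) *\<^sub>R symb k c w"
proof (induction k arbitrary: c)
  case 0
  then show ?case by (simp add: wave_def)
next
  case (Suc k)
  then show ?case
    by (simp add: partial_wave_fun Dop_cmult[OF C_order_wave] scaleR_sum_right mult.commute)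
qed

text \<open>With at most k derivatives on \<open>wave (Suc k)\<close> at least one factor 1 / l
  remains.\<close>

lemma derivs_le_wave:
  assumes B: "\<And>j x. j \<le> Suc k \<Longrightarrow> \<bar>g j x\<bar> \<le> B" and "B \<ge> 0"
  shows "derivs_le k (B * (1 + norm w) ^ k / l) (wave (Suc k)) UNIV"
  using B
proof (induction k)
  case 0
  have "\<bar>wave (Suc 0) x\<bar> \<le> B / l" for x
    using 0[of 1 "l * (w \<bullet> x) + \<tau>"] l by (simp add: wave_def abs_mult divide_right_mono)
  then show ?case by simp
next
  case (Suc k)
  have val: "\<bar>wave (Suc (Suc k)) x\<bar> \<le> B * (1 + norm w) ^ Suc k / l" for x
  proof -
    have "\<bar>wave (Suc (Suc k)) x\<bar> = (1 / l ^ Suc (Suc k)) * \<bar>g (Suc (Suc k)) (l * (w \<bullet> x) + \<tau>)\<bar>"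
      using l by (simp add: wave_def abs_mult)
    also have "\<dots> \<le> (1 / l) * B"
    proof (rule mult_mono)
      have "l ^ 1 \<le> l ^ Suc (Suc k)" using l by (intro power_increasing) auto
      then show "1 / l ^ Suc (Suc k) \<le> 1 / l" using l by (intro divide_left_mono) auto
    qed (use l Suc.prems in auto)
    also have "\<dots> \<le> (1 / l) * (B * (1 + norm w) ^ Suc k)"
    proof (rule mult_left_mono)
      have "1 \<le> (1 + norm w) ^ Suc k" by (rule one_le_power) simp
      then show "B \<le> B * (1 + norm w) ^ Suc k" using \<open>B \<ge> 0\<close> using mult_left_mono[of 1 "(1 + norm w) ^ Suc k" B] by simp
    qed (use l in simp)
    finally show ?thesis by simp
  qed
  have IH: "derivs_le k (B * (1 + norm w) ^ k / l) (wave (Suc k)) UNIV"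
    using Suc.prems by (intro Suc.IH) simp
  have nn: "0 \<le> B * (1 + norm w) ^ k / l" using \<open>B \<ge> 0\<close> l by simp
  have "derivs_le k (B * (1 + norm w) ^ Suc k / l) (partial i (wave (Suc (Suc k)))) UNIV" for i
  proof -
    have b: "derivs_le k (\<bar>w $ i\<bar> * (B * (1 + norm w) ^ k / l)) (\<lambda>x. w $ i * wave (Suc k) x) UNIV"
      by (rule derivs_le_cmult[OF C_order_Suc_imp[OF C_order_wave] IH])
    have "\<bar>w $ i\<bar> * (B * (1 + norm w) ^ k / l) \<le> (1 + norm w) * (B * (1 + norm w) ^ k / l)"
      using component_le_norm_cart[of w i] by (intro mult_right_mono nn) simp
    also have "\<dots> = B * (1 + norm w) ^ Suc k / l" by simp
    finally show ?thesis
      unfolding partial_wave_fun by (rule derivs_le_mono[OF b _ subset_refl])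
  qed
  with val show ?case by simp
qed

end

text \<open>Terms in which a derivative hits the cut-off keep a factor 1 / l. The constant does not
  depend on l and \<tau>: the frequency is chosen from it first, and the phase afterwards for that
  frequency.\<close>

lemma Dop_modulated_wave:
  fixes c :: "'n::finite list \<Rightarrow> 'b::real_normed_vector"
  assumes g': "\<And>j x. (g (Suc j) has_real_derivative g j x) (at x)" and g0: "continuous_on UNIV (g 0)"
    and B: "\<And>j x. j \<le> k \<Longrightarrow> \<bar>g j x\<bar> \<le> B" "B \<ge> 0" and X: "derivs_le k X \<eta> UNIV" "X \<ge> 0" and \<eta>: "C_order k \<eta>"
  shows "\<exists>C\<ge>0. \<forall>l \<tau> x. l \<ge> 1 \<longrightarrow> norm (Dop k c (\<lambda>x. \<eta> x * plane_wave.wave g w l \<tau> k x) x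
      - (\<eta> x * g 0 (l * (w \<bullet> x) + \<tau>)) *\<^sub>R symb k c w) \<le> C / l"
  using B(1) X(1) \<eta>
proof (induction k arbitrary: c)
  case 0
  have "Dop 0 c (\<lambda>x. \<eta> x * plane_wave.wave g w l \<tau> 0 x) x = (\<eta> x * g 0 (l * (w \<bullet> x) + \<tau>)) *\<^sub>R symb 0 c w"
    if "l \<ge> 1" for l \<tau> x
  proof -
    interpret plane_wave g w l \<tau> by unfold_locales (use g' g0 that in auto)
    show ?thesis by (simp add: wave_def)
  qed
  then show ?case by (intro exI[of _ 0] conjI allI impI) simp_all
next
  case (Suc k)
  have "\<forall>i. \<exists>C\<ge>0. \<forall>l \<tau> x. l \<ge> 1 \<longrightarrow> norm (Dop k (\<lambda>J. c (i # J)) (\<lambda>x. \<eta> x * plane_wave.wave g w l \<tau> k x) x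
      - (\<eta> x * g 0 (l * (w \<bullet> x) + \<tau>)) *\<^sub>R symb k (\<lambda>J. c (i # J)) w) \<le> C / l"
    using Suc.prems(1) by (intro allI Suc.IH derivs_le_Suc_imp[OF Suc.prems(2)] C_order_Suc_imp[OF Suc.prems(3)]) simp
  then have "\<exists>C. \<forall>i. C i \<ge> 0 \<and> (\<forall>l \<tau> x. l \<ge> 1 \<longrightarrow> norm (Dop k (\<lambda>J. c (i # J)) (\<lambda>x. \<eta> x * plane_wave.wave g w l \<tau> k x) x
      - (\<eta> x * g 0 (l * (w \<bullet> x) + \<tau>)) *\<^sub>R symb k (\<lambda>J. c (i # J)) w) \<le> C i / l)"
    by (rule choice)
  then obtain C where C: "\<And>i. C i \<ge> 0" "\<And>i l \<tau> x. l \<ge> 1 \<Longrightarrow> norm (Dop k (\<lambda>J. c (i # J)) (\<lambda>x. \<eta> x * plane_wave.wave g w l \<tau> k x) x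
      - (\<eta> x * g 0 (l * (w \<bullet> x) + \<tau>)) *\<^sub>R symb k (\<lambda>J. c (i # J)) w) \<le> C i / l" by blast
  define E where "E i = Dnorm k (\<lambda>J. c (i # J)) * (2 ^ k * X * (B * (1 + norm w) ^ k))" for i
  define K where "K = (\<Sum>i\<in>UNIV. E i + \<bar>w $ i\<bar> * C i)"
  have E0: "E i \<ge> 0" for i unfolding E_def using B(2) X(2) by (simp add: Dnorm_nonneg)
  have K0: "K \<ge> 0" unfolding K_def using E0 C(1) by (intro sum_nonneg) simp
  have "norm (Dop (Suc k) c (\<lambda>x. \<eta> x * plane_wave.wave g w l \<tau> (Suc k) x) x
      - (\<eta> x * g 0 (l * (w \<bullet> x) + \<tau>)) *\<^sub>R symb (Suc k) c w) \<le> K / l" if l: "l \<ge> 1" for l \<tau> x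
  proof -
    interpret plane_wave g w l \<tau> by unfold_locales (use g' g0 l in auto)
    let ?c = "\<lambda>i J. c (i # J)"
    let ?h = "g 0 (l * (w \<bullet> x) + \<tau>)"
    have d\<eta>: "\<eta> differentiable (at x)" for x using Suc.prems(3) by simp
    \<comment> \<open>The first term is the modulated wave of lower order, handled by the induction
      hypothesis; in the second a derivative has fallen on \<eta>, and only k more act on
      \<open>wave (Suc k)\<close>.\<close>
    have p: "partial i (\<lambda>x. \<eta> x * wave (Suc k) x) = (\<lambda>x. w $ i * (\<eta> x * wave k x) + partial i \<eta> x * wave (Suc k) x)" for i
      by (rule ext) (simp add: partial_mult[OF d\<eta> partial_wave(1)] partial_wave(2))
    have C1: "C_order k (\<lambda>x. \<eta> x * wave k x)"
      by (rule C_order_mult[OF C_order_Suc_imp[OF Suc.prems(3)] C_order_wave])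
    have C2: "C_order k (\<lambda>x. partial i \<eta> x * wave (Suc k) x)" for i
      by (rule C_order_mult[OF C_order_partial[OF Suc.prems(3)] C_order_Suc_imp[OF C_order_wave]])
    have D: "Dop k (?c i) (partial i (\<lambda>x. \<eta> x * wave (Suc k) x)) x
       = w $ i *\<^sub>R Dop k (?c i) (\<lambda>x. \<eta> x * wave k x) x + Dop k (?c i) (\<lambda>x. partial i \<eta> x * wave (Suc k) x) x" for i
      unfolding p by (simp add: Dop_add[OF C_order_cmult[OF C1] C2] Dop_cmult[OF C1])
    have b: "derivs_le k (2 ^ k * X * (B * (1 + norm w) ^ k / l)) (\<lambda>x. partial i \<eta> x * wave (Suc k) x) UNIV" for i
      using Suc.prems(1) B(2) X(2) l
      by (intro derivs_le_mult[OF C_order_partial[OF Suc.prems(3)] C_order_Suc_imp[OF C_order_wave]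
            derivs_le_partial[OF Suc.prems(2)] derivs_le_wave]) simp_all
    have b': "norm (Dop k (?c i) (\<lambda>x. partial i \<eta> x * wave (Suc k) x) x) \<le> E i / l" for i
      using Dop_bound[OF b UNIV_I, of "?c i" i x] by (simp add: E_def)
    have eq: "Dop (Suc k) c (\<lambda>x. \<eta> x * wave (Suc k) x) x - (\<eta> x * ?h) *\<^sub>R symb (Suc k) c w
       = (\<Sum>i\<in>UNIV. Dop k (?c i) (\<lambda>x. partial i \<eta> x * wave (Suc k) x) x
           + w $ i *\<^sub>R (Dop k (?c i) (\<lambda>x. \<eta> x * wave k x) x - (\<eta> x * ?h) *\<^sub>R symb k (?c i) w))"
      by (simp only: Dop.simps symb.simps D scaleR_sum_right sum_subtractf[symmetric])
        (intro sum.cong refl, simp add: scaleR_diff_right mult.commute)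
    have "norm (Dop (Suc k) c (\<lambda>x. \<eta> x * wave (Suc k) x) x - (\<eta> x * ?h) *\<^sub>R symb (Suc k) c w)
       \<le> (\<Sum>i\<in>UNIV. E i / l + \<bar>w $ i\<bar> * (C i / l))"
      unfolding eq
    proof (rule sum_norm_le)
      fix i
      have "norm (w $ i *\<^sub>R (Dop k (?c i) (\<lambda>x. \<eta> x * wave k x) x - (\<eta> x * ?h) *\<^sub>R symb k (?c i) w)) \<le> \<bar>w $ i\<bar> * (C i / l)"
        unfolding norm_scaleR by (intro mult_left_mono C(2) l) simp
      then show "norm (Dop k (?c i) (\<lambda>x. partial i \<eta> x * wave (Suc k) x) x
           + w $ i *\<^sub>R (Dop k (?c i) (\<lambda>x. \<eta> x * wave k x) x - (\<eta> x * ?h) *\<^sub>R symb k (?c i) w)) \<le> E i / l + \<bar>w $ i\<bar> * (C i / l)"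
        by (rule norm_triangle_mono[OF b'])
    qed
    also have "\<dots> = K / l" by (simp add: K_def sum_divide_distrib add_divide_distrib)
    finally show ?thesis .
  qed
  then show ?case by (intro exI[of _ K] conjI K0 allI impI)
qed

section \<open>Oscillation between two values\<close>

lemma square_wave_range: "0 \<le> t \<Longrightarrow> t \<le> 1 \<Longrightarrow> t - 1 \<le> square_wave t K q s \<and> square_wave t K q s \<le> t"
  unfolding square_wave_def by (rule clamp01_range)

lemma square_wave_high: "t \<le> 1 \<Longrightarrow> 1 < K * (q - infdist s \<int>) \<Longrightarrow> square_wave t K q s = t"
  by (simp add: square_wave_def clamp01_def)

lemma square_wave_low: "0 \<le> t \<Longrightarrow> K * (q - infdist s \<int>) < -1 \<Longrightarrow> square_wave t K q s = t - 1"
  by (simp add: square_wave_def clamp01_def)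

text \<open>The balls are disjoint, so at each point at most one summand of \<eta> is nonzero; the
  bounds 0 and 1 of a single radial cut-off carry over.\<close>

lemma packing_cutoff:
  fixes U :: "(real^'n::finite) set"
  assumes F: "packing U \<rho> F" and \<sigma>: "0 < \<sigma>" "\<sigma> < 1"
  obtains \<eta> :: "real^'n \<Rightarrow> real" where "C_order k \<eta>" "vanishes_off (\<Union>p\<in>F. cball (fst p) (snd p)) \<eta>"
    "\<And>x. 0 \<le> \<eta> x \<and> \<eta> x \<le> 1" "\<And>p x. p \<in> F \<Longrightarrow> x \<in> ball (fst p) (\<sigma> * snd p) \<Longrightarrow> \<eta> x = 1"
proof -
  have "0 < 1 - \<sigma>\<^sup>2" "1 - \<sigma>\<^sup>2 < 1" using \<sigma> by (auto simp: power_less_one_iff)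
  then obtain \<beta> :: "real^'n \<Rightarrow> real" where \<beta>: "C_order k \<beta>" "vanishes_off (cball 0 1) \<beta>"
    "\<And>x. norm x ^ 2 \<le> 1 - (1 - \<sigma>\<^sup>2) \<Longrightarrow> \<beta> x = 1" "\<And>x. 0 \<le> \<beta> x" "\<And>x. \<beta> x \<le> 1"
    using cutoff_exists[of "1 - \<sigma>\<^sup>2" k] by metis
  have fF: "finite F" and pos: "\<And>p. p \<in> F \<Longrightarrow> 0 < snd p" using F by (auto simp: packing_def)
  define \<gamma> where "\<gamma> p x = \<beta> ((1 / snd p) *\<^sub>R (x - fst p))" for p :: "(real^'n) \<times> real" and x
  have nrm: "norm ((1 / snd p) *\<^sub>R (x - fst p)) = dist (fst p) x / snd p" if "p \<in> F" for p x
    using pos[OF that] by (simp only: norm_scaleR dist_norm norm_minus_commute[of "fst p"]) simp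
  have \<gamma>0: "\<gamma> p x = 0" if "p \<in> F" "x \<notin> cball (fst p) (snd p)" for p x
  proof -
    have "(1 / snd p) *\<^sub>R (x - fst p) \<notin> cball 0 1"
      using that(2) pos[OF that(1)] unfolding mem_cball_0 nrm[OF that(1)] by (simp add: divide_simps)
    then show ?thesis using \<beta>(2) by (simp add: \<gamma>_def vanishes_off_def)
  qed
  define \<eta> where "\<eta> x = (\<Sum>p\<in>F. \<gamma> p x)" for x
  have single: "\<eta> x = \<gamma> p x" if "p \<in> F" "x \<in> cball (fst p) (snd p)" for p x
  proof -
    have "\<gamma> q x = 0" if q: "q \<in> F - {p}" for q
      using q \<gamma>0[of q x] packing_unique[OF F \<open>p \<in> F\<close> _ \<open>x \<in> cball (fst p) (snd p)\<close>, of q] by blast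
    then show ?thesis using fF that by (simp add: \<eta>_def sum.remove[of F p])
  qed
  have none: "\<eta> x = 0" if "\<And>p. p \<in> F \<Longrightarrow> x \<notin> cball (fst p) (snd p)" for x
    unfolding \<eta>_def using \<gamma>0[OF _ that] by (intro sum.neutral) blast
  show thesis
  proof (rule that[of \<eta>])
    show "C_order k \<eta>"
      unfolding \<eta>_def[abs_def] \<gamma>_def[abs_def] by (intro C_order_sum C_order_affine \<beta>(1))
    show "vanishes_off (\<Union>p\<in>F. cball (fst p) (snd p)) \<eta>"
      unfolding vanishes_off_def
    proof (intro allI impI)
      fix x assume "x \<notin> (\<Union>p\<in>F. cball (fst p) (snd p))"
      then show "\<eta> x = 0" by (intro none) blast
    qed
    show "0 \<le> \<eta> x \<and> \<eta> x \<le> 1" for x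
    proof (cases "\<exists>p\<in>F. x \<in> cball (fst p) (snd p)")
      case True
      then obtain p where p: "p \<in> F" "x \<in> cball (fst p) (snd p)" by blast
      show ?thesis using single[OF p] \<beta>(4,5) by (simp add: \<gamma>_def)
    next
      case False
      then have "\<eta> x = 0" by (intro none) blast
      then show ?thesis by simp
    qed
    fix p x assume p: "p \<in> F" and x: "x \<in> ball (fst p) (\<sigma> * snd p)"
    have "\<sigma> * snd p \<le> 1 * snd p" using \<sigma> pos[OF p] by (intro mult_right_mono) auto
    then have "x \<in> cball (fst p) (snd p)" using x by simp
    then have "\<eta> x = \<gamma> p x" by (rule single[OF p])
    also have "\<dots> = 1"
      unfolding \<gamma>_def
    proof (rule \<beta>(3))
      have "norm ((1 / snd p) *\<^sub>R (x - fst p)) \<le> \<sigma>"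
        unfolding nrm[OF p] using x pos[OF p] by (simp add: divide_simps)
      then have "norm ((1 / snd p) *\<^sub>R (x - fst p)) ^ 2 \<le> \<sigma>\<^sup>2" by (rule power_mono) simp
      then show "norm ((1 / snd p) *\<^sub>R (x - fst p)) ^ 2 \<le> 1 - (1 - \<sigma>\<^sup>2)" by simp
    qed
    finally show "\<eta> x = 1" .
  qed
qed

lemma ex_shrink_factor:
  assumes "\<epsilon> > 0" "m \<ge> (0::real)"
  shows "\<exists>\<sigma>::real. 0 < \<sigma> \<and> \<sigma> < 1 \<and> (1 - \<sigma> ^ N) * m < \<epsilon>"
proof -
  \<comment> \<open>By Bernoulli's inequality (1 - (1 - \<delta>) ^ N) m \<le> N \<delta> m, and the
    choice of \<delta> bounds this by \<epsilon> / 2; the minimum with 1/2 keeps \<sigma> = 1 -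
    \<delta> positive.\<close>
  define \<delta> where "\<delta> = min (1/2) (\<epsilon> / (2 * (real N * m + 1)))"
  have pos: "real N * m + 1 > 0" using assms(2) by (simp add: add_nonneg_pos)
  have \<delta>: "\<delta> \<le> 1/2" "\<delta> \<le> \<epsilon> / (2 * (real N * m + 1))"
    unfolding \<delta>_def by (rule min.cobounded1, rule min.cobounded2)
  have \<delta>0: "0 < \<delta>" using assms(1) pos by (simp add: \<delta>_def)
  have "1 - real N * \<delta> \<le> (1 - \<delta>) ^ N" using Bernoulli_inequality[of "- \<delta>" N] \<delta> \<delta>0 by simp
  then have "(1 - (1 - \<delta>) ^ N) * m \<le> (real N * \<delta>) * m" using assms(2) by (intro mult_right_mono) auto
  also have "\<dots> \<le> \<delta> * (real N * m + 1)" using \<delta>0 by (simp add: algebra_simps)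
  also have "\<dots> \<le> \<epsilon> / (2 * (real N * m + 1)) * (real N * m + 1)"
    using \<delta>(2) pos by (intro mult_right_mono) auto
  also have "\<dots> = \<epsilon> / 2"
  proof -
    have "\<epsilon> / (2 * z) * z = \<epsilon> / 2" if "z > 0" for z using that by simp
    then show ?thesis using pos by blast
  qed
  also have "\<dots> < \<epsilon>" using assms(1) by simp
  finally show ?thesis using \<delta> \<delta>0 by (intro exI[of _ "1 - \<delta>"]) auto
qed

text \<open>The values \<open>a\<close> and \<open>b\<close> are attained exactly on open sets, so that the construction can be iterated there.\<close>

lemma two_value_oscillation:
  fixes A :: "'n::finite \<Rightarrow> real^'d^'m" and \<Omega> :: "(real^'n) set"
  assumes rank_A: "\<forall>w :: real^'n. w \<noteq> 0 \<longrightarrow> rank (op_symbol A w) = CARD('m)"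
    and ab: "b - a \<in> char_cone A" and t: "0 < t" "t < 1"
    and \<Omega>: "open \<Omega>" "bounded \<Omega>" and \<epsilon>: "\<epsilon> > 0" and \<xi>: "\<xi> = t *\<^sub>R a + (1 - t) *\<^sub>R b"
  shows "\<exists>u Wa Wb. bounded_measurable u \<and> open Wa \<and> open Wb \<and> Wa \<subseteq> \<Omega> \<and> Wb \<subseteq> \<Omega> \<and> Wa \<inter> Wb = {} \<and>
    (\<forall>x\<in>Wa. u x = a) \<and> (\<forall>x\<in>Wb. u x = b) \<and>
    measure lebesgue (\<Omega> - Wa - Wb) < \<epsilon> \<and> (\<forall>x. x \<notin> \<Omega> \<longrightarrow> u x = \<xi>) \<and>
    (\<forall>x. \<exists>y\<in>closed_segment a b. norm (u x - y) \<le> \<epsilon>) \<and> negligible {x. \<not> loc_const u x} \<and>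
    distr_free A u \<and> (LINT x|lebesgue. u x - \<xi>) = 0"
proof -
  let ?m = "measure lebesgue"
  define k where "k = CARD('m)"
  define v where "v = b - a"
  obtain w where w: "w \<noteq> 0" "op_symbol A w *v v = 0" using ab by (auto simp: char_cone_def v_def)
  obtain c :: "'n list \<Rightarrow> real^'d" where c: "\<And>w. op_symbol A w *v symb k c w = 0" "symb k c w = v"
    unfolding k_def using annihilating_symbol_exists[OF rank_A[rule_format, OF w(1)] w(2)] by blast
  have lm\<Omega>: "\<Omega> \<in> lmeasurable" by (rule lmeasurable_open[OF \<Omega>(2,1)])
  define B where "B p = cball (fst p) (snd p)" for p :: "(real^'n) \<times> real"
  \<comment> \<open>Budget for the set without exact values: \<epsilon>/4 each for the part outside
    the balls, the shells where the cut-off varies, and the transition layers, and \<epsilon>/8 for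
    each of the two packings of the plateau regions.\<close>
  have e4: "\<epsilon> / 4 > 0" and e8: "\<epsilon> / 8 > 0" using \<epsilon> by simp_all
  obtain F where F: "packing \<Omega> 1 F" "?m (\<Omega> - (\<Union>p\<in>F. B p)) < \<epsilon> / 4"
    unfolding B_def using packing_exists[OF \<Omega> zero_less_one e4] by blast
  have fF: "finite F" and posF: "\<And>p. p \<in> F \<Longrightarrow> 0 < snd p" and BF: "\<And>p. p \<in> F \<Longrightarrow> B p \<subseteq> \<Omega>"
    using F(1) by (auto simp: packing_def B_def)
  obtain \<sigma> where \<sigma>: "0 < \<sigma>" "\<sigma> < 1" "(1 - \<sigma> ^ CARD('n)) * ?m \<Omega> < \<epsilon> / 4"
    using ex_shrink_factor[OF e4 measure_nonneg[of lebesgue \<Omega>], of "CARD('n)"] by blast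
  obtain \<eta> :: "real^'n \<Rightarrow> real" where \<eta>: "C_order k \<eta>" "vanishes_off (\<Union>p\<in>F. B p) \<eta>"
    "\<And>x. 0 \<le> \<eta> x \<and> \<eta> x \<le> 1" "\<And>p x. p \<in> F \<Longrightarrow> x \<in> ball (fst p) (\<sigma> * snd p) \<Longrightarrow> \<eta> x = 1"
    unfolding B_def using packing_cutoff[OF F(1) \<sigma>(1,2), of k] by blast
  have cUB: "compact (\<Union>p\<in>F. B p)" unfolding B_def using fF by (intro compact_UN) auto
  obtain X where X: "X > 0" "derivs_le k X \<eta> UNIV" using derivs_le_exists[OF \<eta>(1,2) cUB] by blast
  obtain M :: nat where M0: "2 * ?m \<Omega> / (\<epsilon> / 4) < real M" using reals_Archimedean2 by blast
  have M: "M > 0" "2 * ?m \<Omega> / real M < \<epsilon> / 4"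
  proof -
    have "0 \<le> 2 * ?m \<Omega> / (\<epsilon> / 4)" using \<epsilon> by simp
    then show "M > 0" using M0 by (metis le_less_trans of_nat_0_less_iff)
    then show "2 * ?m \<Omega> / real M < \<epsilon> / 4"
      using M0 \<epsilon> by (simp add: field_simps)
  qed
  \<comment> \<open>Steep enough for the pigeonhole argument with M shifts, and at least 1 as
    \<open>square_wave_exists\<close> requires.\<close>
  define K where "K = 2 * real M + 1"
  have K: "K > 2 * real M" "K \<ge> 1" by (simp_all add: K_def)
  obtain q where q: "periodic_mean0 (square_wave t K q)" using square_wave_exists[OF t K(2)] by blast
  obtain g where g: "g 0 = square_wave t K q" "\<And>j x. (g (Suc j) has_real_derivative g j x) (at x)"
    "\<And>j. \<exists>B>0. \<forall>x. \<bar>g j x\<bar> \<le> B"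
    using iterated_antiderivatives[OF q] by metis
  have g0: "continuous_on UNIV (g 0)" using q by (simp add: g(1) periodic_mean0_def)
  obtain Bs where Bs: "\<And>j. Bs j > 0" "\<And>j x. \<bar>g j x\<bar> \<le> Bs j" using g(3) by metis
  define Bg where "Bg = (\<Sum>j\<le>k. Bs j)"
  have Bg: "\<bar>g j x\<bar> \<le> Bg" if "j \<le> k" for j x
  proof -
    have "Bs j \<le> Bg" unfolding Bg_def using that Bs(1) by (intro member_le_sum) (auto intro: less_imp_le)
    then show ?thesis using Bs(2)[of j x] by simp
  qed
  have Bg0: "Bg \<ge> 0" unfolding Bg_def using Bs(1) by (intro sum_nonneg) (auto intro: less_imp_le)
  obtain C where C: "C \<ge> 0" "\<And>l \<tau> x. l \<ge> 1 \<Longrightarrow> norm (Dop k c (\<lambda>x. \<eta> x * plane_wave.wave g w l \<tau> k x) x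
      - (\<eta> x * g 0 (l * (w \<bullet> x) + \<tau>)) *\<^sub>R symb k c w) \<le> C / l"
    using Dop_modulated_wave[where g = g and k = k and B = Bg and X = X and \<eta> = \<eta> and c = c and w = w,
        OF g(2) g0 Bg Bg0 X(2) less_imp_le[OF X(1)] \<eta>(1)] by blast
  \<comment> \<open>The modulated wave may deviate from its profile by \<epsilon>/2; the other half
    is left for the piecewise constant approximation.\<close>
  define l where "l = max 1 (2 * C / \<epsilon>)"
  have l: "l \<ge> 1" by (simp add: l_def)
  have Cl: "C / l \<le> \<epsilon> / 2"
  proof -
    have "2 * C / \<epsilon> \<le> l" by (simp add: l_def)
    then show ?thesis using l \<epsilon> by (simp add: field_simps)
  qed
  obtain \<tau> where \<tau>: "{x\<in>\<Omega>. transition K q (l * (w \<bullet> x) + \<tau>)} \<in> lmeasurable"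
    "?m {x\<in>\<Omega>. transition K q (l * (w \<bullet> x) + \<tau>)} \<le> 2 * ?m \<Omega> / real M"
    using transition_region_small[OF \<Omega> M(1) K(1)] by blast
  interpret plane_wave g w l \<tau> by unfold_locales (rule g(2), rule g0, rule l)
  define \<phi> where "\<phi> = (\<lambda>x. \<eta> x * wave k x)"
  define ph where "ph x = l * (w \<bullet> x) + \<tau>" for x
  have C\<phi>: "C_order k \<phi>" unfolding \<phi>_def by (rule C_order_mult[OF \<eta>(1) C_order_wave])
  have v\<phi>: "vanishes_off (\<Union>p\<in>F. B p) \<phi>" using \<eta>(2) by (simp add: \<phi>_def vanishes_off_def)
  have vD\<phi>: "vanishes_off (\<Union>p\<in>F. B p) (Dop k c \<phi>)"
    by (rule Dop_vanishes_off[OF compact_imp_closed[OF cUB] v\<phi>])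
  have D\<phi>: "norm (Dop k c \<phi> x - (\<eta> x * g 0 (ph x)) *\<^sub>R v) \<le> \<epsilon> / 2" for x
    using C(2)[OF l, of \<tau> x] Cl unfolding \<phi>_def ph_def c(2) by linarith
  define Bi where "Bi p = ball (fst p) (\<sigma> * snd p)" for p :: "(real^'n) \<times> real"
  have BiB: "Bi p \<subseteq> B p" if "p \<in> F" for p
  proof -
    have "\<sigma> * snd p \<le> 1 * snd p" using \<sigma> posF[OF that] by (intro mult_right_mono) auto
    then show ?thesis unfolding Bi_def B_def by auto
  qed
  \<comment> \<open>On the inner balls the cut-off is 1, so the field is the pure wave and takes its
    plateau values exactly; after adding \<xi> these are a on \<open>Ia\<close> and b on
    \<open>Ib\<close>.\<close>
  define Ia where "Ia = (\<Union>p\<in>F. Bi p) \<inter> {x. K * (q - infdist (ph x) \<int>) < -1}"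
  define Ib where "Ib = (\<Union>p\<in>F. Bi p) \<inter> {x. 1 < K * (q - infdist (ph x) \<int>)}"
  have cph: "continuous_on UNIV (\<lambda>x. K * (q - infdist (ph x) \<int>))"
    unfolding ph_def by (intro continuous_intros)
  have oBi: "open (\<Union>p\<in>F. Bi p)" unfolding Bi_def by blast
  have oI: "open Ia" "open Ib"
    unfolding Ia_def Ib_def by (intro open_Int oBi open_Collect_less cph continuous_on_const)+
  have UBi: "(\<Union>p\<in>F. Bi p) \<subseteq> \<Omega>" using BiB BF by blast
  have I\<Omega>: "Ia \<subseteq> \<Omega>" "Ib \<subseteq> \<Omega>" "Ia \<inter> Ib = {}" using UBi unfolding Ia_def Ib_def by auto
  have bI: "bounded Ia" "bounded Ib" using I\<Omega> \<Omega>(2) bounded_subset by blast+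
  have exact: "Dop k c \<phi> x = g 0 (ph x) *\<^sub>R v" if "x \<in> (\<Union>p\<in>F. Bi p)" for x
  proof -
    have "Dop k c \<phi> x = Dop k c (wave k) x"
    proof (rule Dop_cong_open[OF oBi that])
      fix y assume "y \<in> (\<Union>p\<in>F. Bi p)"
      then obtain p where "p \<in> F" "y \<in> ball (fst p) (\<sigma> * snd p)" unfolding Bi_def by blast
      then show "\<phi> y = wave k y" using \<eta>(4) by (simp add: \<phi>_def)
    qed
    then show ?thesis by (simp add: Dop_wave ph_def c(2))
  qed
  have exa: "Dop k c \<phi> x = (t - 1) *\<^sub>R v" if "x \<in> Ia" for x
    using that exact[of x] t unfolding Ia_def by (simp add: g(1) square_wave_low)
  have exb: "Dop k c \<phi> x = t *\<^sub>R v" if "x \<in> Ib" for x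
    using that exact[of x] t unfolding Ib_def by (simp add: g(1) square_wave_high)
  \<comment> \<open>The plateau regions are replaced by finite unions of balls, because the
    boundaries of the sets with exact values have to be null sets, and spheres are.\<close>
  obtain Fa where Fa: "packing Ia 1 Fa" "?m (Ia - (\<Union>p\<in>Fa. B p)) < \<epsilon> / 8"
    unfolding B_def using packing_exists[OF oI(1) bI(1) zero_less_one e8] by blast
  obtain Fb where Fb: "packing Ib 1 Fb" "?m (Ib - (\<Union>p\<in>Fb. B p)) < \<epsilon> / 8"
    unfolding B_def using packing_exists[OF oI(2) bI(2) zero_less_one e8] by blast
  have fFa: "finite Fa" and BFa: "\<And>p. p \<in> Fa \<Longrightarrow> B p \<subseteq> Ia" using Fa(1) by (auto simp: packing_def B_def)
  have fFb: "finite Fb" and BFb: "\<And>p. p \<in> Fb \<Longrightarrow> B p \<subseteq> Ib" using Fb(1) by (auto simp: packing_def B_def)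
  define Bo where "Bo p = ball (fst p) (snd p)" for p :: "(real^'n) \<times> real"
  have BoB: "Bo p \<subseteq> B p" for p unfolding Bo_def B_def by auto
  define Wa where "Wa = (\<Union>p\<in>Fa. Bo p)"
  define Wb where "Wb = (\<Union>p\<in>Fb. Bo p)"
  \<comment> \<open>Potentials are modified only on this open set. It avoids the closed balls inside
    the plateau regions, so the exact values survive; apart from spheres, the part of the balls of F
    outside it consists of \<open>Wa\<close> and \<open>Wb\<close>.\<close>
  define U where "U = (\<Union>p\<in>F. Bo p) - (\<Union>p\<in>Fa. B p) - (\<Union>p\<in>Fb. B p)"
  have WaI: "Wa \<subseteq> Ia" using BFa BoB unfolding Wa_def by blast
  have WbI: "Wb \<subseteq> Ib" using BFb BoB unfolding Wb_def by blast
  have oW: "open Wa" "open Wb" unfolding Wa_def Wb_def Bo_def by blast+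
  have clB: "closed (\<Union>p\<in>G. B p)" if "finite G" for G unfolding B_def using that by (intro closed_UN) auto
  have oU: "open U" unfolding U_def Bo_def by (intro open_Diff clB fFa fFb) blast
  have UF: "U \<subseteq> (\<Union>p\<in>F. B p)" using BoB unfolding U_def by blast
  have UB\<Omega>: "(\<Union>p\<in>F. B p) \<subseteq> \<Omega>" using BF by blast
  have bU: "bounded U" using UF UB\<Omega> \<Omega>(2) bounded_subset by blast
  have WU: "Wa \<inter> U = {}" "Wb \<inter> U = {}" using BoB unfolding Wa_def Wb_def U_def by blast+
  have e2: "\<epsilon> / 2 > 0" using \<epsilon> by simp
  obtain d \<psi> where \<psi>: "\<And>n. C_order k (\<psi> n)" "\<And>n x. x \<notin> U \<Longrightarrow> \<psi> n x = \<phi> x"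
    "\<And>n x. norm (Dop k c (\<psi> n) x - Dop k c \<phi> x) \<le> \<epsilon> / 2"
    "\<And>x. (\<lambda>n. Dop k c (\<psi> n) x) \<longlonglongrightarrow> d x"
    "\<And>x. x \<notin> U \<Longrightarrow> d x = Dop k c \<phi> x" "negligible {x\<in>U. \<not> loc_const d x}"
    using piecewise_constant_approximation[OF C\<phi> oU bU e2, of c] by blast
  have dD: "norm (d x - Dop k c \<phi> x) \<le> \<epsilon> / 2" for x
    by (rule LIMSEQ_le_const2[OF tendsto_norm[OF tendsto_diff[OF \<psi>(4) tendsto_const]]]) (use \<psi>(3) in blast)
  have d0: "d x = 0" if "x \<notin> (\<Union>p\<in>F. B p)" for x
  proof -
    have "x \<notin> U" using UF that by blast
    then have "d x = Dop k c \<phi> x" by (rule \<psi>(5))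
    then show ?thesis using vD\<phi> that unfolding vanishes_off_def by simp
  qed
  have da: "d x = (t - 1) *\<^sub>R v" if "x \<in> Wa" for x
  proof -
    have "x \<notin> U" "x \<in> Ia" using WU(1) WaI that by blast+
    then show ?thesis using \<psi>(5)[of x] exa[of x] by simp
  qed
  have db: "d x = t *\<^sub>R v" if "x \<in> Wb" for x
  proof -
    have "x \<notin> U" "x \<in> Ib" using WU(2) WbI that by blast+
    then show ?thesis using \<psi>(5)[of x] exb[of x] by simp
  qed
  obtain R where R0: "\<forall>x\<in>(\<Union>p\<in>F. B p). norm x \<le> R"
    using compact_imp_bounded[OF cUB] unfolding bounded_iff by blast
  have R: "(\<Union>p\<in>F. B p) \<subseteq> cball 0 R"
    using R0 by (intro subsetI) (simp only: mem_cball_0)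
  have v\<psi>: "vanishes_off (cball 0 R) (\<psi> n)" for n
    unfolding vanishes_off_def
  proof (intro allI impI)
    fix x :: "real^'n" assume "x \<notin> cball 0 R"
    then have nx: "x \<notin> (\<Union>p\<in>F. B p)" using R by blast
    then have "x \<notin> U" using UF by blast
    then have "\<psi> n x = \<phi> x" by (rule \<psi>(2))
    then show "\<psi> n x = 0" using v\<phi> nx unfolding vanishes_off_def by simp
  qed
  have vD\<psi>: "vanishes_off (cball 0 R) (Dop k c (\<psi> n))" for n
    by (rule Dop_vanishes_off[OF closed_cball v\<psi>])
  have cD\<phi>: "continuous_on UNIV (Dop k c \<phi>)" by (rule continuous_Dop[OF C\<phi>])
  obtain N where N: "N > 0" "\<And>x. norm (Dop k c \<phi> x) \<le> N"
    using bounded_continuous_vanishes_off[OF cD\<phi> vD\<phi> cUB] by metis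
  have bD\<psi>: "norm (Dop k c (\<psi> n) x) \<le> N + \<epsilon> / 2" for n x
    using norm_triangle_sub[of "Dop k c (\<psi> n) x" "Dop k c \<phi> x"] N(2)[of x] \<psi>(3)[of n x] by linarith
  have mD\<psi>: "Dop k c (\<psi> n) \<in> borel_measurable lebesgue" for n
    by (rule continuous_borel_lebesgue[OF continuous_Dop[OF \<psi>(1)]])
  have md: "d \<in> borel_measurable lebesgue" by (rule borel_measurable_LIMSEQ_metric[OF mD\<psi> \<psi>(4)])
  have bmd: "bounded_measurable d"
    unfolding bounded_measurable_def
  proof
    have "norm (d x) \<le> N + \<epsilon> / 2" for x
      using norm_triangle_sub[of "d x" "Dop k c \<phi> x"] N(2)[of x] dD[of x] by linarith
    then show "bounded (range d)" by (auto simp: bounded_iff)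
  qed (rule md)
  have free: "distr_free A d"
    by (rule distr_free_limit[OF mD\<psi> bD\<psi> distr_free_Dop[OF c(1) \<psi>(1)] \<psi>(4)])
  have mean: "(LINT x|lebesgue. d x) = 0"
  proof -
    have "(\<lambda>n. LINT x|lebesgue. Dop k c (\<psi> n) x) \<longlonglongrightarrow> (LINT x|lebesgue. d x)"
    proof (rule integral_dominated_convergence[where w = "\<lambda>x. (N + \<epsilon> / 2) * indicator (cball 0 R) x"])
      show "integrable lebesgue (\<lambda>x::real^'n. (N + \<epsilon> / 2) * indicator (cball 0 R) x :: real)"
        using emeasure_cball_ne_top[of "0::real^'n" R]
        by (intro integrable_mult_right integrable_real_indicator) (auto simp: less_top)
      show "AE x in lebesgue. norm (Dop k c (\<psi> n) x) \<le> (N + \<epsilon> / 2) * indicator (cball 0 R) x" for n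
      proof (rule AE_I2)
        fix x
        show "norm (Dop k c (\<psi> n) x) \<le> (N + \<epsilon> / 2) * indicator (cball 0 R) x"
          using bD\<psi>[of n x] vD\<psi>[of n] by (cases "x \<in> cball 0 R") (auto simp: vanishes_off_def)
      qed
    qed (auto intro: md mD\<psi> \<psi>(4))
    moreover have "(LINT x|lebesgue. Dop k c (\<psi> n) x) = 0" for n
    proof -
      \<comment> \<open>m is positive as the cardinality of a type, so the operator has positive
        order and its fields integrate to zero.\<close>
      obtain k' where "k = Suc k'" using zero_less_card_finite[where 'a = 'm] unfolding k_def by (metis gr0_implies_Suc)
      then show ?thesis using integral_Dop_eq_0[of k' "\<psi> n" R c] \<psi>(1)[of n] v\<psi>[of n] by (simp only:)
    qed
    ultimately show ?thesis by (simp add: LIMSEQ_const_iff)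
  qed
  have neg: "negligible {x. \<not> loc_const d x}"
  proof -
    have "negligible (\<Union>p\<in>F \<union> Fa \<union> Fb. sphere (fst p) (snd p))"
      using fF fFa fFb by (intro negligible_Union) (auto intro: negligible_sphere)
    moreover have "{x. \<not> loc_const d x} \<subseteq> {x\<in>U. \<not> loc_const d x} \<union> (\<Union>p\<in>F \<union> Fa \<union> Fb. sphere (fst p) (snd p))"
    proof
      fix x assume "x \<in> {x. \<not> loc_const d x}"
      then have nl: "\<not> loc_const d x" by simp
      have nWa: "x \<notin> Wa"
      proof
        assume "x \<in> Wa"
        from loc_constI[OF oW(1) this da] show False using nl by simp
      qed
      have nWb: "x \<notin> Wb"
      proof
        assume "x \<in> Wb"
        from loc_constI[OF oW(2) this db] show False using nl by simp
      qed
      have oB: "open (- (\<Union>p\<in>F. B p))" by (rule open_Compl[OF clB[OF fF]])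
      have d0': "d y = 0" if "y \<in> - (\<Union>p\<in>F. B p)" for y using that by (intro d0) simp
      have xF: "x \<in> (\<Union>p\<in>F. B p)"
      proof (rule ccontr)
        assume "x \<notin> (\<Union>p\<in>F. B p)"
        then have "x \<in> - (\<Union>p\<in>F. B p)" by simp
        from loc_constI[OF oB this d0'] show False using nl by simp
      qed
      have sph: "x \<in> (\<Union>p\<in>F \<union> Fa \<union> Fb. sphere (fst p) (snd p))" if "p \<in> F \<union> Fa \<union> Fb" "x \<in> B p" "x \<notin> Bo p" for p
        using that unfolding B_def Bo_def by (intro UN_I[of p]) auto
      show "x \<in> {x\<in>U. \<not> loc_const d x} \<union> (\<Union>p\<in>F \<union> Fa \<union> Fb. sphere (fst p) (snd p))"
      proof (cases "x \<in> U")
        case True then show ?thesis using nl by blast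
      next
        case False
        then have "(\<forall>p\<in>F. x \<notin> Bo p) \<or> (\<exists>p\<in>Fa. x \<in> B p) \<or> (\<exists>p\<in>Fb. x \<in> B p)"
          unfolding U_def by blast
        then have "\<exists>p\<in>F \<union> Fa \<union> Fb. x \<in> B p \<and> x \<notin> Bo p"
          using xF nWa nWb unfolding Wa_def Wb_def by blast
        then show ?thesis using sph by blast
      qed
    qed
    ultimately show ?thesis using negligible_subset[OF negligible_Un[OF \<psi>(6)]] by blast
  qed
  have meas: "?m (\<Omega> - Wa - Wb) < \<epsilon>"
  proof -
    let ?S1 = "\<Omega> - (\<Union>p\<in>F. B p)"
    let ?S2 = "(\<Union>p\<in>F. B p) - (\<Union>p\<in>F. cball (fst p) (\<sigma> * snd p))"
    let ?S3 = "{x\<in>\<Omega>. transition K q (l * (w \<bullet> x) + \<tau>)}"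
    let ?S4 = "Ia - (\<Union>p\<in>Fa. B p)"
    let ?S5 = "Ib - (\<Union>p\<in>Fb. B p)"
    let ?N = "(\<Union>p\<in>Fa \<union> Fb. sphere (fst p) (snd p)) \<union> (\<Union>p\<in>F. sphere (fst p) (\<sigma> * snd p))"
    have nN: "negligible ?N"
      using fF fFa fFb by (intro negligible_Un negligible_Union) (auto intro: negligible_sphere)
    have lmN: "?N \<in> lmeasurable" "?m ?N = 0" using nN by (auto simp: negligible_imp_measurable negligible_imp_measure0)
    have lmUB: "(\<Union>p\<in>F. B p) \<in> lmeasurable" by (rule lmeasurable_compact[OF cUB])
    have setUB: "(\<Union>p\<in>G. B p) \<in> sets lebesgue" if "finite G" for G
      unfolding B_def using that by (intro sets.finite_UN) auto
    have lm1: "?S1 \<in> lmeasurable" by (intro fmeasurable_Diff lm\<Omega> setUB fF)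
    have setS: "(\<Union>p\<in>F. cball (fst p) (\<sigma> * snd p)) \<in> sets lebesgue" using fF by (intro sets.finite_UN) auto
    have lm2: "?S2 \<in> lmeasurable" by (intro fmeasurable_Diff lmUB setS)
    have lm4: "?S4 \<in> lmeasurable" by (intro fmeasurable_Diff lmeasurable_open bI oI setUB fFa)
    have lm5: "?S5 \<in> lmeasurable" by (intro fmeasurable_Diff lmeasurable_open bI oI setUB fFb)
    have S2: "?m ?S2 \<le> (1 - \<sigma> ^ CARD('n)) * ?m \<Omega>"
    proof -
      have sub: "cball (fst p) (\<sigma> * snd p) \<subseteq> B p" if "p \<in> F" for p
      proof -
        have "\<sigma> * snd p \<le> 1 * snd p" using \<sigma> posF[OF that] by (intro mult_right_mono) auto
        then show ?thesis unfolding B_def by auto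
      qed
      have dj: "disjoint_family_on B F" using F(1) unfolding packing_def B_def by blast
      have dj': "disjoint_family_on (\<lambda>p. cball (fst p) (\<sigma> * snd p)) F"
        using dj sub unfolding disjoint_family_on_def by blast
      have mB: "?m (\<Union>p\<in>F. B p) = (\<Sum>p\<in>F. ?m (B p))"
      proof (rule measure_finite_Union[OF fF _ dj])
        show "B ` F \<subseteq> sets lebesgue" unfolding B_def by auto
        show "emeasure lebesgue (B p) \<noteq> \<infinity>" for p by (simp add: B_def emeasure_cball_ne_top)
      qed
      have mS: "?m (\<Union>p\<in>F. cball (fst p) (\<sigma> * snd p)) = (\<Sum>p\<in>F. ?m (cball (fst p) (\<sigma> * snd p)))"
        using fF dj' by (intro measure_finite_Union) (auto simp: emeasure_cball_ne_top)
      have "?m (cball (fst p) (\<sigma> * snd p)) = \<sigma> ^ CARD('n) * ?m (B p)" if "p \<in> F" for p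
        using measure_cball_scale[of "snd p" \<sigma> "fst p"] posF[OF that] \<sigma> by (simp add: B_def)
      then have "?m (\<Union>p\<in>F. cball (fst p) (\<sigma> * snd p)) = \<sigma> ^ CARD('n) * ?m (\<Union>p\<in>F. B p)"
        by (simp add: mB mS sum_distrib_left)
      moreover have "?m ?S2 = ?m (\<Union>p\<in>F. B p) - ?m (\<Union>p\<in>F. cball (fst p) (\<sigma> * snd p))"
      proof (rule measurable_measure_Diff[OF lmUB setS])
        show "(\<Union>p\<in>F. cball (fst p) (\<sigma> * snd p)) \<subseteq> (\<Union>p\<in>F. B p)" using sub by blast
      qed
      ultimately have "?m ?S2 = (1 - \<sigma> ^ CARD('n)) * ?m (\<Union>p\<in>F. B p)" by (simp add: algebra_simps)
      also have "\<dots> \<le> (1 - \<sigma> ^ CARD('n)) * ?m \<Omega>"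
      proof (rule mult_left_mono)
        show "?m (\<Union>p\<in>F. B p) \<le> ?m \<Omega>"
          using UB\<Omega> by (intro measure_mono_fmeasurable lm\<Omega> setUB fF)
        show "0 \<le> 1 - \<sigma> ^ CARD('n)" using power_le_one[of \<sigma> "CARD('n)"] \<sigma> by simp
      qed
      finally show ?thesis .
    qed
    \<comment> \<open>The five sets match the budget above; the spheres in \<open>?N\<close> absorb
      the difference between open and closed balls.\<close>
    have "\<Omega> - Wa - Wb \<subseteq> ?S1 \<union> (?S2 \<union> (?S3 \<union> (?S4 \<union> (?S5 \<union> ?N))))"
    proof
      fix x assume x: "x \<in> \<Omega> - Wa - Wb"
      show "x \<in> ?S1 \<union> (?S2 \<union> (?S3 \<union> (?S4 \<union> (?S5 \<union> ?N))))"
      proof (cases "x \<in> (\<Union>p\<in>F. Bi p)")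
        case False
        then show ?thesis
        proof (cases "x \<in> (\<Union>p\<in>F. B p) \<and> x \<in> (\<Union>p\<in>F. cball (fst p) (\<sigma> * snd p))")
          case True
          then obtain p where "p \<in> F" "x \<in> cball (fst p) (\<sigma> * snd p)" "x \<notin> Bi p"
            using \<open>x \<notin> (\<Union>p\<in>F. Bi p)\<close> by blast
          then have "x \<in> (\<Union>p\<in>F. sphere (fst p) (\<sigma> * snd p))"
            unfolding Bi_def by (intro UN_I[of p]) auto
          then show ?thesis by blast
        qed (use x in blast)
      next
        case True
        have "transition K q (l * (w \<bullet> x) + \<tau>) \<or> x \<in> Ia \<or> x \<in> Ib"
          using True unfolding transition_def Ia_def Ib_def ph_def by (auto simp: abs_le_iff)
        moreover have "x \<in> ?S4 \<union> ?N" if "x \<in> Ia"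
        proof (cases "x \<in> (\<Union>p\<in>Fa. B p)")
          case True
          then obtain p where "p \<in> Fa" "x \<in> B p" "x \<notin> Bo p" using x unfolding Wa_def by blast
          then have "x \<in> (\<Union>p\<in>Fa \<union> Fb. sphere (fst p) (snd p))"
            unfolding B_def Bo_def by (intro UN_I[of p]) auto
          then show ?thesis by blast
        qed (use that in blast)
        moreover have "x \<in> ?S5 \<union> ?N" if "x \<in> Ib"
        proof (cases "x \<in> (\<Union>p\<in>Fb. B p)")
          case True
          then obtain p where "p \<in> Fb" "x \<in> B p" "x \<notin> Bo p" using x unfolding Wb_def by blast
          then have "x \<in> (\<Union>p\<in>Fa \<union> Fb. sphere (fst p) (snd p))"
            unfolding B_def Bo_def by (intro UN_I[of p]) auto
          then show ?thesis by blast
        qed (use that in blast)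
        ultimately show ?thesis using x by blast
      qed
    qed
    then have "?m (\<Omega> - Wa - Wb) \<le> ?m (?S1 \<union> (?S2 \<union> (?S3 \<union> (?S4 \<union> (?S5 \<union> ?N)))))"
      by (rule measure_mono_fmeasurable)
        (intro fmeasurableD fmeasurable_Diff lm\<Omega> fmeasurable.Un lm1 lm2 \<tau>(1) lm4 lm5 lmN(1)
          lmeasurable_open[THEN fmeasurableD] oW bounded_subset[OF bI(1) WaI] bounded_subset[OF bI(2) WbI])+
    also have "\<dots> \<le> ?m ?S1 + (?m ?S2 + (?m ?S3 + (?m ?S4 + (?m ?S5 + ?m ?N))))"
      by (intro order_trans[OF measure_Un_le] add_left_mono order_refl
          fmeasurableD fmeasurable.Un lm1 lm2 \<tau>(1) lm4 lm5 lmN(1))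
    also have "\<dots> < \<epsilon>" using F(2) S2 \<sigma>(3) \<tau>(2) M(2) Fa(2) Fb(2) lmN(2) by linarith
    finally show ?thesis .
  qed
  have \<xi>a: "\<xi> + (t - 1) *\<^sub>R v = a" and \<xi>b: "\<xi> + t *\<^sub>R v = b" by (simp_all add: \<xi> v_def algebra_simps)
  show ?thesis
  proof (rule exI[of _ "\<lambda>x. \<xi> + d x"], rule exI[of _ Wa], rule exI[of _ Wb], intro conjI allI impI ballI)
    show "bounded_measurable (\<lambda>x. \<xi> + d x)" by (intro bounded_measurable_add bounded_measurable_const bmd)
    show "open Wa" "open Wb" by (fact oW)+
    show "Wa \<subseteq> \<Omega>" "Wb \<subseteq> \<Omega>" "Wa \<inter> Wb = {}" using WaI WbI I\<Omega> by blast+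
    show "\<xi> + d x = a" if "x \<in> Wa" for x using da[OF that] \<xi>a by simp
    show "\<xi> + d x = b" if "x \<in> Wb" for x using db[OF that] \<xi>b by simp
    show "?m (\<Omega> - Wa - Wb) < \<epsilon>" by (fact meas)
    show "\<xi> + d x = \<xi>" if "x \<notin> \<Omega>" for x using d0[of x] that UB\<Omega> by auto
    show "\<exists>y\<in>closed_segment a b. norm (\<xi> + d x - y) \<le> \<epsilon>" for x
    proof
      let ?s = "\<eta> x * g 0 (ph x)"
      have r: "t - 1 \<le> g 0 (ph x)" "g 0 (ph x) \<le> t"
        using square_wave_range[of t K q "ph x"] t by (simp_all add: g(1))
      have "t - 1 \<le> ?s"
      proof -
        have "\<eta> x * (t - 1) \<le> ?s" by (rule mult_left_mono[OF r(1)]) (use \<eta>(3) in blast)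
        moreover have "1 * (t - 1) \<le> \<eta> x * (t - 1)"
          by (rule mult_right_mono_neg) (use \<eta>(3)[of x] t in auto)
        ultimately show ?thesis by simp
      qed
      moreover have "?s \<le> t"
      proof -
        have "?s \<le> \<eta> x * t" by (rule mult_left_mono[OF r(2)]) (use \<eta>(3) in blast)
        moreover have "\<eta> x * t \<le> 1 * t" by (rule mult_right_mono) (use \<eta>(3)[of x] t in auto)
        ultimately show ?thesis by simp
      qed
      \<comment> \<open>The coefficient of b: s in [t - 1, t] becomes s + 1 - t in [0, 1].\<close>
      moreover have "\<xi> + ?s *\<^sub>R v = (1 - (?s + (1 - t))) *\<^sub>R a + (?s + (1 - t)) *\<^sub>R b"
        by (simp add: \<xi> v_def algebra_simps)
      ultimately show "\<xi> + ?s *\<^sub>R v \<in> closed_segment a b"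
        unfolding in_segment by (intro exI[of _ "?s + (1 - t)"]) auto
      have "norm (\<xi> + d x - (\<xi> + ?s *\<^sub>R v)) = norm ((d x - Dop k c \<phi> x) + (Dop k c \<phi> x - ?s *\<^sub>R v))" by simp
      also have "\<dots> \<le> \<epsilon> / 2 + \<epsilon> / 2" by (rule norm_triangle_mono[OF dD D\<phi>])
      finally show "norm (\<xi> + d x - (\<xi> + ?s *\<^sub>R v)) \<le> \<epsilon>" by simp
    qed
    show "negligible {x. \<not> loc_const (\<lambda>x. \<xi> + d x) x}"
    proof (rule negligible_subset[OF neg])
      have "loc_const (\<lambda>x. \<xi> + d x) x" if "loc_const d x" for x
        by (rule loc_const_add[OF loc_constI[OF open_UNIV UNIV_I refl] that])
      then show "{x. \<not> loc_const (\<lambda>x. \<xi> + d x) x} \<subseteq> {x. \<not> loc_const d x}" by blast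
    qed
    show "distr_free A (\<lambda>x. \<xi> + d x)"
      by (rule distr_free_add[OF bounded_measurable_const bmd distr_free_const free])
    show "(LINT x|lebesgue. \<xi> + d x - \<xi>) = 0" using mean by simp
  qed
qed

section \<open>The hull and its compatible fields\<close>

text \<open>The convex function max(0, |x| - R) is \<Lambda>-convex for any \<Lambda> and vanishes
  on E. Boundedness of the hull supplies the uniform bound on all fields with values in it.\<close>

lemma Lam_hull_subset_convex:
  assumes "\<And>x. x \<in> E \<Longrightarrow> norm x \<le> R"
  shows "Lam_hull \<Lambda> E \<subseteq> cball 0 R"
proof
  fix \<xi> assume \<xi>: "\<xi> \<in> Lam_hull \<Lambda> E"
  define G where "G x = ereal (max 0 (norm x - R))" for x :: "real^'a"
  have "Lam_convex \<Lambda> G"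
    unfolding Lam_convex_def
  proof (intro conjI allI impI)
    show "G x \<noteq> -\<infinity>" for x by (simp add: G_def del: ereal_max)
    fix a b :: "real^'a" and t :: real assume "0 \<le> t \<and> t \<le> 1 \<and> b - a \<in> \<Lambda>"
    then have t: "0 \<le> t" "t \<le> 1" by auto
    have "norm (t *\<^sub>R a + (1 - t) *\<^sub>R b) \<le> t * norm a + (1 - t) * norm b"
      using norm_triangle_ineq[of "t *\<^sub>R a" "(1 - t) *\<^sub>R b"] t by simp
    then have "norm (t *\<^sub>R a + (1 - t) *\<^sub>R b) - R \<le> t * (norm a - R) + (1 - t) * (norm b - R)"
      by (simp add: algebra_simps)
    also have "\<dots> \<le> t * max 0 (norm a - R) + (1 - t) * max 0 (norm b - R)"
      using t by (intro add_mono mult_left_mono) auto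
    finally have "max 0 (norm (t *\<^sub>R a + (1 - t) *\<^sub>R b) - R)
       \<le> t * max 0 (norm a - R) + (1 - t) * max 0 (norm b - R)"
      using t by (intro max.boundedI) auto
    then show "G (t *\<^sub>R a + (1 - t) *\<^sub>R b) \<le> ereal t * G a + ereal (1 - t) * G b"
      unfolding G_def times_ereal.simps(1) plus_ereal.simps(1) ereal_less_eq(3) .
  qed
  moreover have "\<forall>\<eta>\<in>E. G \<eta> = 0"
  proof
    fix \<eta> assume "\<eta> \<in> E"
    then have "max 0 (norm \<eta> - R) = 0" using assms by simp
    then show "G \<eta> = 0" unfolding G_def zero_ereal_def by (simp only:)
  qed
  ultimately have "G \<xi> \<le> 0" using \<xi> unfolding Lam_hull_def by blast
  then have "max 0 (norm \<xi> - R) \<le> 0" unfolding G_def zero_ereal_def ereal_less_eq(3) .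
  then show "\<xi> \<in> cball 0 R" by (simp add: mem_cball_0)
qed

text \<open>The constant 1 is admissible, since the condition on an empty set is void. Hence a hull
  with interior points forces E to be nonempty, so that \<open>infdist\<close> to E is a genuine
  distance.\<close>

lemma Lam_hull_empty: "Lam_hull \<Lambda> {} = {}"
proof -
  have "Lam_convex \<Lambda> (\<lambda>x::real^'a. 1)"
    unfolding Lam_convex_def
  proof (intro conjI allI impI)
    fix a b :: "real^'a" and t :: real
    have "ereal t * 1 + ereal (1 - t) * 1 = 1" by (simp add: one_ereal_def)
    then show "1 \<le> ereal t * 1 + ereal (1 - t) * (1::ereal)" by simp
  qed simp
  then have "\<xi> \<notin> Lam_hull \<Lambda> {}" for \<xi> :: "real^'a"
    unfolding Lam_hull_def by (auto intro!: exI[of _ "\<lambda>x. 1"])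
  then show ?thesis by blast
qed

lemma Lam_hull_superset: "E \<subseteq> Lam_hull \<Lambda> E"
  unfolding Lam_hull_def by auto

text \<open>Keeps the segments between values already reached inside the hull, and hence inside the
  open set K.\<close>

lemma Lam_hull_segment:
  assumes "a \<in> Lam_hull \<Lambda> E" "b \<in> Lam_hull \<Lambda> E" "b - a \<in> \<Lambda>" "0 \<le> t" "t \<le> 1"
  shows "t *\<^sub>R a + (1 - t) *\<^sub>R b \<in> Lam_hull \<Lambda> E"
  unfolding Lam_hull_def
proof (intro CollectI allI impI)
  fix G assume G: "Lam_convex \<Lambda> G \<and> (\<forall>\<eta>\<in>E. G \<eta> = 0)"
  then have "G a \<le> 0" "G b \<le> 0" using assms(1,2) unfolding Lam_hull_def by blast+
  then have "ereal t * G a \<le> ereal t * 0" "ereal (1 - t) * G b \<le> ereal (1 - t) * 0"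
    using assms(4,5) by (intro ereal_mult_left_mono; simp)+
  then have "ereal t * G a + ereal (1 - t) * G b \<le> 0"
    using add_mono[of "ereal t * G a" 0 "ereal (1 - t) * G b" 0] by simp
  moreover have "G (t *\<^sub>R a + (1 - t) *\<^sub>R b) \<le> ereal t * G a + ereal (1 - t) * G b"
    using G assms(3-5) unfolding Lam_convex_def by blast
  ultimately show "G (t *\<^sub>R a + (1 - t) *\<^sub>R b) \<le> 0" by (rule order_trans[rotated])
qed

text \<open>The indicator function of a set closed under \<open>\<Lambda>\<close>-segments is \<open>\<Lambda>\<close>-convex.\<close>

lemma Lam_hull_induct:
  fixes \<xi> :: "real^'a"
  assumes \<xi>: "\<xi> \<in> Lam_hull \<Lambda> E" and base: "\<And>x. x \<in> E \<Longrightarrow> P x"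
    and step: "\<And>a b t. P a \<Longrightarrow> P b \<Longrightarrow> b - a \<in> \<Lambda> \<Longrightarrow> 0 < t \<Longrightarrow> t < 1 \<Longrightarrow> P (t *\<^sub>R a + (1 - t) *\<^sub>R b)"
  shows "P \<xi>"
proof -
  define G where "G x = (if P x then 0 else \<infinity> :: ereal)" for x
  have "Lam_convex \<Lambda> G"
    unfolding Lam_convex_def
  proof (intro conjI allI impI)
    show "G x \<noteq> -\<infinity>" for x by (simp add: G_def)
    fix a b :: "real^'a" and t :: real assume H: "0 \<le> t \<and> t \<le> 1 \<and> b - a \<in> \<Lambda>"
    show "G (t *\<^sub>R a + (1 - t) *\<^sub>R b) \<le> ereal t * G a + ereal (1 - t) * G b"
    \<comment> \<open>At the end points 0 * \<infinity> = 0 would let an infinite value disappear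
      from the right side, but there the combination is itself one of the two points.\<close>
    proof (cases "t = 0 \<or> t = 1")
      case True
      then show ?thesis by (auto simp: zero_ereal_def[symmetric] one_ereal_def[symmetric])
    next
      case False
      then have t: "0 < t" "t < 1" using H by auto
      show ?thesis
      proof (cases "P a \<and> P b")
        case True
        then have "P (t *\<^sub>R a + (1 - t) *\<^sub>R b)" using step t H by blast
        then show ?thesis using True by (simp add: G_def)
      next
        case False
        then have eq: "ereal t * G a + ereal (1 - t) * G b = \<infinity>" using t by (auto simp: G_def)
        show ?thesis unfolding eq by simp
      qed
    qed
  qed
  moreover have "\<forall>\<eta>\<in>E. G \<eta> = 0" using base by (simp add: G_def)
  ultimately have "G \<xi> \<le> 0" using \<xi> unfolding Lam_hull_def by blast
  then show ?thesis by (simp add: G_def split: if_splits)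
qed

section \<open>Fields that relax a boundary value\<close>

definition compatible_field ::
    "('n::finite \<Rightarrow> real^'d^'m) \<Rightarrow> (real^'d) set \<Rightarrow> (real^'n) set \<Rightarrow> real^'d \<Rightarrow> (real^'n \<Rightarrow> real^'d) \<Rightarrow> bool" where
  "compatible_field A K \<Omega> \<xi> u \<longleftrightarrow> bounded_measurable u \<and> (\<forall>x. u x \<in> K) \<and> negligible {x. \<not> loc_const u x} \<and>
     (\<forall>x. x \<notin> \<Omega> \<longrightarrow> u x = \<xi>) \<and> distr_free A u \<and> (LINT x|lebesgue. u x - \<xi>) = 0"

definition relaxes_to ::
    "('n::finite \<Rightarrow> real^'d^'m) \<Rightarrow> (real^'d) set \<Rightarrow> (real^'d) set \<Rightarrow> real^'d \<Rightarrow> bool" where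
  "relaxes_to A K F \<xi> \<longleftrightarrow> (\<forall>\<Omega> \<epsilon>. open \<Omega> \<and> bounded \<Omega> \<and> \<epsilon> > 0 \<longrightarrow>
     (\<exists>u W. compatible_field A K \<Omega> \<xi> u \<and> open W \<and> W \<subseteq> \<Omega> \<and> (\<forall>x\<in>W. u x \<in> F) \<and> measure lebesgue (\<Omega> - W) < \<epsilon>))"

lemma relaxes_to_self:
  fixes A :: "'n::finite \<Rightarrow> real^'d^'m"
  assumes "\<xi> \<in> F" "\<xi> \<in> K" shows "relaxes_to A K F \<xi>"
  unfolding relaxes_to_def
proof (intro allI impI)
  fix \<Omega> :: "(real^'n) set" and \<epsilon> :: real assume *: "open \<Omega> \<and> bounded \<Omega> \<and> \<epsilon> > 0"
  have "loc_const (\<lambda>x. \<xi>) x" for x :: "real^'n" by (rule loc_constI[OF open_UNIV UNIV_I refl])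
  then have "compatible_field A K \<Omega> \<xi> (\<lambda>x. \<xi>)"
    using assms distr_free_const[of A \<xi>] by (simp add: compatible_field_def)
  then show "\<exists>u W. compatible_field A K \<Omega> \<xi> u \<and> open W \<and> W \<subseteq> \<Omega> \<and> (\<forall>x\<in>W. u x \<in> F) \<and> measure lebesgue (\<Omega> - W) < \<epsilon>"
    using * assms by (intro exI[of _ "\<lambda>x. \<xi>"] exI[of _ \<Omega>]) simp
qed

lemma bounded_measurable_vanishes_integrable:
  assumes "bounded_measurable f" "vanishes_off S f" "bounded S"
  shows "integrable lebesgue f"
proof -
  obtain M where M: "\<And>x. norm (f x) \<le> M" using assms(1) unfolding bounded_measurable_def bounded_iff by auto
  obtain R where R: "\<forall>x\<in>S. norm x \<le> R" using assms(3) unfolding bounded_iff by blast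
  show ?thesis
  proof (rule Bochner_Integration.integrable_bound)
    show "integrable lebesgue (\<lambda>x::'a. M * indicator (cball 0 R) x :: real)"
      using emeasure_cball_ne_top[of "0::'a" R]
      by (intro integrable_mult_right integrable_real_indicator) (auto simp: less_top)
    show "f \<in> borel_measurable lebesgue" using assms(1) by (simp add: bounded_measurable_def)
    have "norm (f x) \<le> norm (M * indicator (cball 0 R) x :: real)" for x
    proof (cases "x \<in> S")
      case True
      then have "x \<in> cball 0 R" using R by (simp only: mem_cball_0)
      then show ?thesis using M[of x] by simp
    next
      case False
      then show ?thesis using assms(2) by (simp add: vanishes_off_def)
    qed
    then show "AE x in lebesgue. norm (f x) \<le> norm (M * indicator (cball 0 R) x :: real)" by (rule AE_I2)
  qed
qed

text \<open>Fields are defined on the whole space and equal their boundary value outside S.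
  Inserting v into a region where u equals \<zeta> is therefore the addition of v - \<zeta>, and
  linearity gives the equation and the mean without matching conditions at the boundary.\<close>

lemma distr_free_glue:
  assumes "bounded_measurable u" "distr_free A u" "(LINT x|lebesgue. u x - \<xi>) = 0" "vanishes_off S (\<lambda>x. u x - \<xi>)" "bounded S"
    and "bounded_measurable v" "distr_free A v" "(LINT x|lebesgue. v x - \<zeta>) = 0" "vanishes_off S (\<lambda>x. v x - \<zeta>)"
  shows "bounded_measurable (\<lambda>x. u x + (v x - \<zeta>))" "distr_free A (\<lambda>x. u x + (v x - \<zeta>))"
    "(LINT x|lebesgue. (u x + (v x - \<zeta>)) - \<xi>) = 0"
proof -
  have bv: "bounded_measurable (\<lambda>x. v x + - \<zeta>)" by (intro bounded_measurable_add assms(6) bounded_measurable_const)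
  have bv': "bounded_measurable (\<lambda>x. v x - \<zeta>)" by (intro bounded_measurable_diff assms(6) bounded_measurable_const)
  have bu': "bounded_measurable (\<lambda>x. u x - \<xi>)" by (intro bounded_measurable_diff assms(1) bounded_measurable_const)
  show "bounded_measurable (\<lambda>x. u x + (v x - \<zeta>))" by (intro bounded_measurable_add assms(1) bv')
  have "distr_free A (\<lambda>x. v x + - \<zeta>)"
    by (rule distr_free_add[OF assms(6) bounded_measurable_const assms(7) distr_free_const])
  from distr_free_add[OF assms(1) bv assms(2) this]
  show "distr_free A (\<lambda>x. u x + (v x - \<zeta>))" by simp
  have "integrable lebesgue (\<lambda>x. u x - \<xi>)" "integrable lebesgue (\<lambda>x. v x - \<zeta>)"
    by (rule bounded_measurable_vanishes_integrable[OF bu' assms(4,5)], rule bounded_measurable_vanishes_integrable[OF bv' assms(9,5)])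
  then have "(LINT x|lebesgue. (u x - \<xi>) + (v x - \<zeta>)) = 0" using assms(3,8) by simp
  then show "(LINT x|lebesgue. (u x + (v x - \<zeta>)) - \<xi>) = 0" by (simp add: algebra_simps)
qed

lemma negligible_loc_const_add_diff:
  assumes "negligible {x. \<not> loc_const u x}" "negligible {x. \<not> loc_const v x}"
  shows "negligible {x. \<not> loc_const (\<lambda>x. u x + (v x - (\<zeta>::'b::real_normed_vector))) x}"
proof (rule negligible_subset[OF negligible_Un[OF assms]])
  have "loc_const (\<lambda>x. u x + (v x - \<zeta>)) x" if "loc_const u x" "loc_const v x" for x
  proof -
    have "loc_const (\<lambda>x. v x + - \<zeta>) x"
      by (rule loc_const_add[OF that(2) loc_constI[OF open_UNIV UNIV_I refl]])
    from loc_const_add[OF that(1) this] show ?thesis by simp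
  qed
  then show "{x. \<not> loc_const (\<lambda>x. u x + (v x - \<zeta>)) x} \<subseteq> {x. \<not> loc_const u x} \<union> {x. \<not> loc_const v x}" by blast
qed

text \<open>An oscillation between a and b is followed by relaxations of a on \<open>Wa\<close> and
  of b on \<open>Wb\<close>. Off these sets the values stay near the segment, hence in K by
  openness.\<close>

lemma relaxes_to_convex_combination:
  fixes A :: "'n::finite \<Rightarrow> real^'d^'m"
  assumes rank_A: "\<forall>w :: real^'n. w \<noteq> 0 \<longrightarrow> rank (op_symbol A w) = CARD('m)"
    and K: "open K" "closed_segment a b \<subseteq> K"
    and a: "relaxes_to A K F a" and b: "relaxes_to A K F b"
    and ab: "b - a \<in> char_cone A" and t: "0 < t" "t < 1"
  shows "relaxes_to A K F (t *\<^sub>R a + (1 - t) *\<^sub>R b)"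
  unfolding relaxes_to_def
proof (intro allI impI)
  fix \<Omega> :: "(real^'n) set" and \<epsilon> :: real assume *: "open \<Omega> \<and> bounded \<Omega> \<and> \<epsilon> > 0"
  then have \<Omega>: "open \<Omega>" "bounded \<Omega>" and \<epsilon>: "\<epsilon> > 0" by auto
  let ?m = "measure lebesgue"
  let ?\<xi> = "t *\<^sub>R a + (1 - t) *\<^sub>R b"
  obtain \<rho> where \<rho>: "\<rho> > 0" "\<And>y z. y \<in> closed_segment a b \<Longrightarrow> dist y z < \<rho> \<Longrightarrow> z \<in> K"
  proof -
    have "compact (closed_segment a b)" by simp
    from compact_subset_open_imp_ball_epsilon_subset[OF this K(1,2)]
    obtain e where e: "e > 0" "(\<Union>y\<in>closed_segment a b. ball y e) \<subseteq> K" by blast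
    show thesis
    proof (rule that[OF e(1)])
      fix y z assume "y \<in> closed_segment a b" "dist y z < e"
      then have "z \<in> (\<Union>y\<in>closed_segment a b. ball y e)" by (intro UN_I[of y]) simp_all
      then show "z \<in> K" using e(2) by blast
    qed
  qed
  \<comment> \<open>Half of \<rho> gives the strict distance to the segment needed to stay in K;
    \<epsilon>/3 is one of three shares of the measure left over, the others coming from
    \<open>Wa\<close> and \<open>Wb\<close>.\<close>
  define e where "e = min (\<rho> / 2) (\<epsilon> / 3)"
  have e: "e > 0" "e < \<rho>" "e \<le> \<epsilon> / 3" using \<rho>(1) \<epsilon> by (auto simp: e_def min_def)
  from two_value_oscillation[OF rank_A ab t \<Omega> e(1) refl]
  obtain u Wa Wb where "bounded_measurable u \<and> open Wa \<and> open Wb \<and> Wa \<subseteq> \<Omega> \<and> Wb \<subseteq> \<Omega> \<and> Wa \<inter> Wb = {} \<and>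
    (\<forall>x\<in>Wa. u x = a) \<and> (\<forall>x\<in>Wb. u x = b) \<and>
    ?m (\<Omega> - Wa - Wb) < e \<and> (\<forall>x. x \<notin> \<Omega> \<longrightarrow> u x = ?\<xi>) \<and>
    (\<forall>x. \<exists>y\<in>closed_segment a b. norm (u x - y) \<le> e) \<and> negligible {x. \<not> loc_const u x} \<and>
    distr_free A u \<and> (LINT x|lebesgue. u x - ?\<xi>) = 0" by (elim exE)
  then have u: "bounded_measurable u" "open Wa" "open Wb" "Wa \<subseteq> \<Omega>" "Wb \<subseteq> \<Omega>" "Wa \<inter> Wb = {}"
    "\<And>x. x \<in> Wa \<Longrightarrow> u x = a" "\<And>x. x \<in> Wb \<Longrightarrow> u x = b"
    "?m (\<Omega> - Wa - Wb) < e" "\<And>x. x \<notin> \<Omega> \<Longrightarrow> u x = ?\<xi>"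
    "\<And>x. \<exists>y\<in>closed_segment a b. norm (u x - y) \<le> e" "negligible {x. \<not> loc_const u x}"
    "distr_free A u" "(LINT x|lebesgue. u x - ?\<xi>) = 0"
    by blast+
  have bW: "bounded Wa" "bounded Wb" using u(4,5) \<Omega>(2) bounded_subset by blast+
  have e3: "\<epsilon> / 3 > 0" using \<epsilon> by simp
  obtain ua Va where ua: "compatible_field A K Wa a ua" "open Va" "Va \<subseteq> Wa" "\<forall>x\<in>Va. ua x \<in> F" "?m (Wa - Va) < \<epsilon> / 3"
    using a u(2) bW(1) e3 unfolding relaxes_to_def by blast
  obtain ub Vb where ub: "compatible_field A K Wb b ub" "open Vb" "Vb \<subseteq> Wb" "\<forall>x\<in>Vb. ub x \<in> F" "?m (Wb - Vb) < \<epsilon> / 3"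
    using b u(3) bW(2) e3 unfolding relaxes_to_def by blast
  have fa: "bounded_measurable ua" "\<And>x. ua x \<in> K" "negligible {x. \<not> loc_const ua x}" "\<And>x. x \<notin> Wa \<Longrightarrow> ua x = a"
    "distr_free A ua" "(LINT x|lebesgue. ua x - a) = 0"
    using ua(1) unfolding compatible_field_def by blast+
  have fb: "bounded_measurable ub" "\<And>x. ub x \<in> K" "negligible {x. \<not> loc_const ub x}" "\<And>x. x \<notin> Wb \<Longrightarrow> ub x = b"
    "distr_free A ub" "(LINT x|lebesgue. ub x - b) = 0"
    using ub(1) unfolding compatible_field_def by blast+
  have v0: "vanishes_off \<Omega> (\<lambda>x. u x - ?\<xi>)" using u(10) by (simp add: vanishes_off_def)
  have va: "vanishes_off \<Omega> (\<lambda>x. ua x - a)" unfolding vanishes_off_def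
  proof (intro allI impI)
    fix x assume "x \<notin> \<Omega>" then have "x \<notin> Wa" using u(4) by blast
    then show "ua x - a = 0" using fa(4) by simp
  qed
  have vb: "vanishes_off \<Omega> (\<lambda>x. ub x - b)" unfolding vanishes_off_def
  proof (intro allI impI)
    fix x assume "x \<notin> \<Omega>" then have "x \<notin> Wb" using u(5) by blast
    then show "ub x - b = 0" using fb(4) by simp
  qed
  define u1 where "u1 x = u x + (ua x - a)" for x
  define u2 where "u2 x = u1 x + (ub x - b)" for x
  note g1 = distr_free_glue[OF u(1,13,14) v0 \<Omega>(2) fa(1,5,6) va, folded u1_def]
  have v1: "vanishes_off \<Omega> (\<lambda>x. u1 x - ?\<xi>)"
    using v0 va unfolding vanishes_off_def u1_def by (auto simp: algebra_simps)
  note g2 = distr_free_glue[OF g1(1,2,3) v1 \<Omega>(2) fb(1,5,6) vb, folded u2_def]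
  have neg: "negligible {x. \<not> loc_const u2 x}"
    unfolding u2_def[abs_def] u1_def[abs_def]
    by (intro negligible_loc_const_add_diff u(12) fa(3) fb(3))
  have on_a: "u2 x = ua x" if "x \<in> Wa" for x
  proof -
    have "x \<notin> Wb" using that u(6) by blast
    then show ?thesis using u(7)[OF that] fb(4)[of x] by (simp add: u2_def u1_def)
  qed
  have on_b: "u2 x = ub x" if "x \<in> Wb" for x
  proof -
    have "x \<notin> Wa" using that u(6) by blast
    then show ?thesis using u(8)[OF that] fa(4)[of x] by (simp add: u2_def u1_def)
  qed
  have off: "u2 x = u x" if "x \<notin> Wa" "x \<notin> Wb" for x
    using fa(4)[OF that(1)] fb(4)[OF that(2)] by (simp add: u2_def u1_def)
  have inK: "u2 x \<in> K" for x
  proof (cases "x \<in> Wa \<or> x \<in> Wb")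
    case True
    then show ?thesis using on_a on_b fa(2) fb(2) by metis
  next
    case False
    obtain y where y: "y \<in> closed_segment a b" "norm (u x - y) \<le> e" using u(11) by blast
    have "dist y (u x) < \<rho>" using y(2) e(2) by (simp add: dist_norm norm_minus_commute)
    then have "u x \<in> K" by (rule \<rho>(2)[OF y(1)])
    then show ?thesis using off False by simp
  qed
  have derivs_le: "u2 x = ?\<xi>" if "x \<notin> \<Omega>" for x
  proof -
    have "x \<notin> Wa" "x \<notin> Wb" using that u(4,5) by blast+
    then show ?thesis using off u(10)[OF that] by simp
  qed
  have cf: "compatible_field A K \<Omega> ?\<xi> u2"
    unfolding compatible_field_def using g2 inK neg derivs_le by blast
  have lm: "X \<in> lmeasurable" if "open X" "X \<subseteq> \<Omega>" for X
    using that \<Omega>(2) by (intro lmeasurable_open) (auto intro: bounded_subset)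
  have l: "\<Omega> \<in> lmeasurable" "Wa \<in> lmeasurable" "Wb \<in> lmeasurable" "Va \<in> lmeasurable" "Vb \<in> lmeasurable"
    using ua(2,3) ub(2,3) u(2-5) \<Omega>(1) by (intro lm; blast)+
  have "?m (\<Omega> - (Va \<union> Vb)) \<le> ?m ((\<Omega> - Wa - Wb) \<union> ((Wa - Va) \<union> (Wb - Vb)))"
    by (rule measure_mono_fmeasurable)
      (blast, (intro fmeasurable.Un fmeasurable_Diff fmeasurableD l | rule fmeasurableD)+)
  also have "\<dots> \<le> ?m (\<Omega> - Wa - Wb) + (?m (Wa - Va) + ?m (Wb - Vb))"
    by (intro order_trans[OF measure_Un_le] add_left_mono order_refl
        fmeasurableD[OF fmeasurable.Un] fmeasurableD[OF fmeasurable_Diff] fmeasurable_Diff l fmeasurableD[OF l(2)] fmeasurableD[OF l(3)] fmeasurableD[OF l(4)] fmeasurableD[OF l(5)])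
  also have "\<dots> < \<epsilon>" using u(9) e(3) ua(5) ub(5) by linarith
  finally have m: "?m (\<Omega> - (Va \<union> Vb)) < \<epsilon>" .
  have W: "open (Va \<union> Vb)" "Va \<union> Vb \<subseteq> \<Omega>" using ua(2,3) ub(2,3) u(4,5) by blast+
  have "\<forall>x\<in>Va \<union> Vb. u2 x \<in> F"
  proof
    fix x assume "x \<in> Va \<union> Vb"
    then show "u2 x \<in> F"
    proof
      assume x: "x \<in> Va" then have "x \<in> Wa" using ua(3) by blast
      then show ?thesis using on_a ua(4) x by simp
    next
      assume x: "x \<in> Vb" then have "x \<in> Wb" using ub(3) by blast
      then show ?thesis using on_b ub(4) x by simp
    qed
  qed
  with cf W m show "\<exists>u W. compatible_field A K \<Omega> ?\<xi> u \<and> open W \<and> W \<subseteq> \<Omega> \<and> (\<forall>x\<in>W. u x \<in> F) \<and> ?m (\<Omega> - W) < \<epsilon>"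
    by (intro exI[of _ u2] exI[of _ "Va \<union> Vb"]) simp
qed

text \<open>Membership in the hull is carried along in the induction, because
  \<open>relaxes_to_convex_combination\<close> needs the whole segment inside K.\<close>

lemma relaxes_to_hull:
  fixes A :: "'n::finite \<Rightarrow> real^'d^'m"
  assumes rank_A: "\<forall>w :: real^'n. w \<noteq> 0 \<longrightarrow> rank (op_symbol A w) = CARD('m)"
    and K: "open K" "Lam_hull (char_cone A) F \<subseteq> K" and \<xi>: "\<xi> \<in> Lam_hull (char_cone A) F"
  shows "relaxes_to A K F \<xi>"
proof -
  have "\<xi> \<in> Lam_hull (char_cone A) F \<and> relaxes_to A K F \<xi>"
    using \<xi>
  proof (rule Lam_hull_induct)
    fix x assume x: "x \<in> F"
    then have "x \<in> Lam_hull (char_cone A) F" using Lam_hull_superset by blast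
    then show "x \<in> Lam_hull (char_cone A) F \<and> relaxes_to A K F x"
      using relaxes_to_self[OF x] K(2) by blast
  next
    fix a b t assume a: "a \<in> Lam_hull (char_cone A) F \<and> relaxes_to A K F a"
      and b: "b \<in> Lam_hull (char_cone A) F \<and> relaxes_to A K F b"
      and ab: "b - a \<in> char_cone A" and t: "0 < (t::real)" "t < 1"
    have "closed_segment a b \<subseteq> Lam_hull (char_cone A) F"
    proof
      fix y assume "y \<in> closed_segment a b"
      then obtain s where s: "0 \<le> s" "s \<le> 1" "y = (1 - s) *\<^sub>R a + s *\<^sub>R b" unfolding in_segment by blast
      have "(1 - s) *\<^sub>R a + (1 - (1 - s)) *\<^sub>R b \<in> Lam_hull (char_cone A) F"
        using a b s by (intro Lam_hull_segment ab) auto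
      then show "y \<in> Lam_hull (char_cone A) F" using s(3) by simp
    qed
    then have "closed_segment a b \<subseteq> K" using K(2) by blast
    then have "relaxes_to A K F (t *\<^sub>R a + (1 - t) *\<^sub>R b)"
      using a b by (intro relaxes_to_convex_combination[OF rank_A K(1) _ _ _ ab t]) auto
    moreover have "t *\<^sub>R a + (1 - t) *\<^sub>R b \<in> Lam_hull (char_cone A) F"
      using a b t by (intro Lam_hull_segment ab) auto
    ultimately show "t *\<^sub>R a + (1 - t) *\<^sub>R b \<in> Lam_hull (char_cone A) F \<and> relaxes_to A K F (t *\<^sub>R a + (1 - t) *\<^sub>R b)"
      by blast
  qed
  then show ?thesis by blast
qed

text \<open>The pieces are the nonempty interiors of the level sets. They are countably many as
  disjoint open sets in a separable space, even if u takes uncountably many values on the null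
  set.\<close>

lemma Linf_piecI:
  fixes u :: "real^'n \<Rightarrow> real^'d"
  assumes "bounded (range u)" "negligible {x. \<not> loc_const u x}"
  shows "u \<in> Linf_piec"
proof -
  define \<U> where "\<U> = {interior (u -` {c}) | c. interior (u -` {c}) \<noteq> {}}"
  have op: "open U" if "U \<in> \<U>" for U using that unfolding \<U>_def by auto
  have dj: "disjoint \<U>"
    unfolding disjoint_def
  proof (intro ballI impI)
    fix U V assume "U \<in> \<U>" "V \<in> \<U>" "U \<noteq> V"
    then obtain c d where cd: "U = interior (u -` {c})" "V = interior (u -` {d})" "c \<noteq> d"
      unfolding \<U>_def by blast
    have "U \<subseteq> u -` {c}" "V \<subseteq> u -` {d}" unfolding cd by (rule interior_subset)+
    then show "U \<inter> V = {}" using cd(3) by blast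
  qed
  have "countable \<U>" by (rule countable_disjoint_open_subsets[OF op dj])
  moreover have "u constant_on U" if U: "U \<in> \<U>" for U
  proof -
    obtain c where "U = interior (u -` {c})" using U unfolding \<U>_def by blast
    then have "U \<subseteq> u -` {c}" using interior_subset by blast
    then have "\<forall>x\<in>U. u x = c" by blast
    then show ?thesis unfolding constant_on_def by blast
  qed
  moreover have "- \<Union>\<U> \<subseteq> {x. \<not> loc_const u x}"
  proof
    fix x assume x: "x \<in> - \<Union>\<U>"
    have "\<not> loc_const u x"
    proof
      assume "loc_const u x"
      then obtain V where V: "open V" "x \<in> V" "\<forall>y\<in>V. u y = u x" unfolding loc_const_def by blast
      have "V \<subseteq> u -` {u x}" using V(3) by blast
      then have "x \<in> interior (u -` {u x})" using V(1,2) by (meson interiorI)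
      then have "x \<in> \<Union>\<U>" unfolding \<U>_def by blast
      then show False using x by blast
    qed
    then show "x \<in> {x. \<not> loc_const u x}" by simp
  qed
  then have "negligible (- \<Union>\<U>)" by (rule negligible_subset[OF assms(2)])
  ultimately show ?thesis
    unfolding Linf_piec_def using assms(1) dj op by blast
qed

section \<open>Localisation and weak convergence\<close>

lemma mult_half_divide: "z > 0 \<Longrightarrow> z * (r / (2 * z)) = r / 2" for z r :: real
  by simp

lemma distr_free_sum:
  fixes A :: "'n::finite \<Rightarrow> real^'d^'m"
  assumes "finite P" "\<And>p. p \<in> P \<Longrightarrow> bounded_measurable (w p)" "\<And>p. p \<in> P \<Longrightarrow> distr_free A (w p)"
  shows "bounded_measurable (\<lambda>x. \<Sum>p\<in>P. w p x) \<and> distr_free A (\<lambda>x. \<Sum>p\<in>P. w p x)"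
  using assms
proof (induction P rule: finite_induct)
  case empty
  show ?case using distr_free_const[of A 0] by simp
next
  case (insert p P)
  have IH: "bounded_measurable (\<lambda>x. \<Sum>p\<in>P. w p x)" "distr_free A (\<lambda>x. \<Sum>p\<in>P. w p x)"
    using insert.IH insert.prems by simp_all
  have p: "bounded_measurable (w p)" "distr_free A (w p)" using insert.prems by simp_all
  have "bounded_measurable (\<lambda>x. w p x + (\<Sum>p\<in>P. w p x))" by (rule bounded_measurable_add[OF p(1) IH(1)])
  moreover have "distr_free A (\<lambda>x. w p x + (\<Sum>p\<in>P. w p x))" by (rule distr_free_add[OF p(1) IH(1) p(2) IH(2)])
  ultimately show ?case using insert.hyps by simp
qed

lemma loc_const_sum:
  "finite P \<Longrightarrow> (\<And>p. p \<in> P \<Longrightarrow> loc_const (w p) x) \<Longrightarrow> loc_const (\<lambda>x. \<Sum>p\<in>P. w p x :: 'b::real_normed_vector) x"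
proof (induction P rule: finite_induct)
  case empty
  show ?case by (rule loc_constI[OF open_UNIV UNIV_I]) simp
next
  case (insert p P)
  have "loc_const (\<lambda>x. w p x + (\<Sum>p\<in>P. w p x)) x"
    using insert by (intro loc_const_add) simp_all
  then show ?case using insert.hyps by simp
qed

text \<open>Relaxation is carried out separately in small disjoint balls, so the deviation from
  \<xi> has mean zero on each of these balls of radius below e. This locality turns into weak*
  convergence as e tends to 0.\<close>

lemma localized_field:
  fixes A :: "'n::finite \<Rightarrow> real^'d^'m" and \<Omega> :: "(real^'n) set"
  assumes rel: "relaxes_to A K F \<xi>" and \<xi>K: "\<xi> \<in> K" and \<Omega>: "open \<Omega>" "bounded \<Omega>" and e: "e > 0"
  shows "\<exists>u P W. packing \<Omega> e P \<and> bounded_measurable u \<and> (\<forall>x. u x \<in> K) \<and> negligible {x. \<not> loc_const u x} \<and>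
    distr_free A u \<and> open W \<and> W \<subseteq> \<Omega> \<and> (\<forall>x\<in>W. u x \<in> F) \<and> measure lebesgue (\<Omega> - W) < e \<and>
    (\<forall>x. (\<forall>p\<in>P. x \<notin> cball (fst p) (snd p)) \<longrightarrow> u x = \<xi>) \<and>
    (\<forall>p\<in>P. (LINT x|lebesgue. indicator (cball (fst p) (snd p)) x *\<^sub>R (u x - \<xi>)) = 0)"
proof -
  let ?m = "measure lebesgue"
  define B where "B p = cball (fst p) (snd p)" for p :: "(real^'n) \<times> real"
  define Bo where "Bo p = ball (fst p) (snd p)" for p :: "(real^'n) \<times> real"
  have BoB: "Bo p \<subseteq> B p" for p unfolding Bo_def B_def by auto
  have e2: "e / 2 > 0" using e by simp
  obtain P where P: "packing \<Omega> e P" "?m (\<Omega> - (\<Union>p\<in>P. B p)) < e / 2"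
    unfolding B_def using packing_exists[OF \<Omega> e e2] by blast
  have fP: "finite P" and BP: "\<And>p. p \<in> P \<Longrightarrow> B p \<subseteq> \<Omega>" using P(1) by (auto simp: packing_def B_def)
  \<comment> \<open>The share e/2 is distributed over the balls of P; adding 1 avoids division by
    zero if P is empty.\<close>
  define \<epsilon> where "\<epsilon> = e / (2 * (real (card P) + 1))"
  have \<epsilon>: "\<epsilon> > 0" using e by (simp add: \<epsilon>_def)
  have "\<forall>p. \<exists>v. compatible_field A K (Bo p) \<xi> (fst v) \<and> open (snd v) \<and> snd v \<subseteq> Bo p \<and> (\<forall>x\<in>snd v. fst v x \<in> F) \<and> ?m (Bo p - snd v) < \<epsilon>"
  proof
    fix p
    have "open (Bo p) \<and> bounded (Bo p) \<and> \<epsilon> > 0" using \<epsilon> by (simp add: Bo_def)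
    then obtain u W where "compatible_field A K (Bo p) \<xi> u \<and> open W \<and> W \<subseteq> Bo p \<and> (\<forall>x\<in>W. u x \<in> F) \<and> ?m (Bo p - W) < \<epsilon>"
      using rel unfolding relaxes_to_def by blast
    then show "\<exists>v. compatible_field A K (Bo p) \<xi> (fst v) \<and> open (snd v) \<and> snd v \<subseteq> Bo p \<and> (\<forall>x\<in>snd v. fst v x \<in> F) \<and> ?m (Bo p - snd v) < \<epsilon>"
      by (intro exI[of _ "(u, W)"]) simp
  qed
  then have "\<exists>v. \<forall>p. compatible_field A K (Bo p) \<xi> (fst (v p)) \<and> open (snd (v p)) \<and> snd (v p) \<subseteq> Bo p \<and> (\<forall>x\<in>snd (v p). fst (v p) x \<in> F) \<and> ?m (Bo p - snd (v p)) < \<epsilon>"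
    by (rule choice)
  then obtain v where v: "\<And>p. compatible_field A K (Bo p) \<xi> (fst (v p))" "\<And>p. open (snd (v p))" "\<And>p. snd (v p) \<subseteq> Bo p"
    "\<And>p. \<forall>x\<in>snd (v p). fst (v p) x \<in> F" "\<And>p. ?m (Bo p - snd (v p)) < \<epsilon>" by blast
  define w where "w p x = fst (v p) x - \<xi>" for p x
  have c: "bounded_measurable (fst (v p))" "\<And>x. fst (v p) x \<in> K" "negligible {x. \<not> loc_const (fst (v p)) x}"
    "\<And>x. x \<notin> Bo p \<Longrightarrow> fst (v p) x = \<xi>" "distr_free A (fst (v p))" "(LINT x|lebesgue. fst (v p) x - \<xi>) = 0" for p
    using v(1)[of p] unfolding compatible_field_def by blast+
  have w_alt: "w p = (\<lambda>x. fst (v p) x + - \<xi>)" for p by (rule ext) (simp add: w_def)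
  have bw: "bounded_measurable (w p)" and dw: "distr_free A (w p)" for p
    unfolding w_alt by (intro bounded_measurable_add bounded_measurable_const c, intro distr_free_add bounded_measurable_const distr_free_const c)
  have lw: "loc_const (w p) x" if "loc_const (fst (v p)) x" for p x
    unfolding w_alt by (rule loc_const_add[OF that loc_constI[OF open_UNIV UNIV_I refl]])
  have w0: "w p x = 0" if "x \<notin> B p" for p x
  proof -
    have "x \<notin> Bo p" using that BoB by blast
    then show ?thesis using c(4) by (simp add: w_def)
  qed
  define u where "u x = \<xi> + (\<Sum>p\<in>P. w p x)" for x
  have single: "u x = fst (v p) x" if "p \<in> P" "x \<in> B p" for p x
  proof -
    have "w q x = 0" if q: "q \<in> P - {p}" for q
      using q w0[of x q] packing_unique[OF P(1) \<open>p \<in> P\<close> _ \<open>x \<in> B p\<close>[unfolded B_def], of q] unfolding B_def by blast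
    then have "(\<Sum>q\<in>P. w q x) = w p x" using fP that(1) by (simp add: sum.remove[of P p])
    then show ?thesis by (simp add: u_def w_def)
  qed
  have none: "u x = \<xi>" if "\<forall>p\<in>P. x \<notin> B p" for x
  proof -
    have "(\<Sum>p\<in>P. w p x) = 0" using that w0 by (intro sum.neutral) blast
    then show ?thesis by (simp add: u_def)
  qed
  have s: "bounded_measurable (\<lambda>x. \<Sum>p\<in>P. w p x)" "distr_free A (\<lambda>x. \<Sum>p\<in>P. w p x)"
    using distr_free_sum[where w = w and A = A, OF fP bw dw] by blast+
  have bu: "bounded_measurable u" unfolding u_def[abs_def] by (rule bounded_measurable_add[OF bounded_measurable_const s(1)])
  have du: "distr_free A u" unfolding u_def[abs_def] by (rule distr_free_add[OF bounded_measurable_const s(1) distr_free_const s(2)])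
  have uK: "u x \<in> K" for x
  proof (cases "\<exists>p\<in>P. x \<in> B p")
    case True
    then obtain p where "p \<in> P" "x \<in> B p" by blast
    then show ?thesis using single c(2) by simp
  next
    case False
    then show ?thesis using none[of x] \<xi>K by simp
  qed
  have neg: "negligible {x. \<not> loc_const u x}"
  proof (rule negligible_subset)
    show "negligible (\<Union>p\<in>P. {x. \<not> loc_const (fst (v p)) x})" using fP c(3) by (intro negligible_Union) auto
    have "loc_const u x" if "\<forall>p\<in>P. loc_const (fst (v p)) x" for x
      unfolding u_def[abs_def]
    proof (rule loc_const_add[OF loc_constI[OF open_UNIV UNIV_I refl] loc_const_sum[OF fP]])
      fix p assume "p \<in> P" then show "loc_const (w p) x" using that lw by blast
    qed
    then show "{x. \<not> loc_const u x} \<subseteq> (\<Union>p\<in>P. {x. \<not> loc_const (fst (v p)) x})" by blast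
  qed
  define W where "W = (\<Union>p\<in>P. snd (v p))"
  have W: "open W" "W \<subseteq> \<Omega>" unfolding W_def using v(2,3) BoB BP by blast+
  have WF: "\<forall>x\<in>W. u x \<in> F"
  proof
    fix x assume "x \<in> W"
    then obtain p where p: "p \<in> P" "x \<in> snd (v p)" unfolding W_def by blast
    then have "x \<in> B p" using v(3) BoB by blast
    then show "u x \<in> F" using single[OF p(1)] v(4) p(2) by simp
  qed
  have mW: "?m (\<Omega> - W) < e"
  proof -
    let ?S1 = "\<Omega> - (\<Union>p\<in>P. B p)"
    let ?S2 = "\<Union>p\<in>P. Bo p - snd (v p)"
    let ?N = "\<Union>p\<in>P. sphere (fst p) (snd p)"
    have nN: "negligible ?N" using fP by (intro negligible_Union) (auto intro: negligible_sphere)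
    have lmN: "?N \<in> lmeasurable" "?m ?N = 0" using nN by (auto simp: negligible_imp_measurable negligible_imp_measure0)
    have lm\<Omega>: "\<Omega> \<in> lmeasurable" by (rule lmeasurable_open[OF \<Omega>(2,1)])
    have setUB: "(\<Union>p\<in>P. B p) \<in> sets lebesgue" unfolding B_def using fP by (intro sets.finite_UN) auto
    have lm1: "?S1 \<in> lmeasurable" by (rule fmeasurable_Diff[OF lm\<Omega> setUB])
    have lmd: "Bo p - snd (v p) \<in> lmeasurable" for p
    proof (rule fmeasurable_Diff)
      show "Bo p \<in> lmeasurable" unfolding Bo_def by (intro lmeasurable_open) auto
      show "snd (v p) \<in> sets lebesgue" using v(2)[of p] by simp
    qed
    have lm2: "?S2 \<in> lmeasurable" using fP lmd by (intro fmeasurable.finite_UN) auto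
    have "?m ?S2 \<le> (\<Sum>p\<in>P. ?m (Bo p - snd (v p)))"
      using fP lmd by (intro measure_UNION_le) (auto intro: fmeasurableD)
    also have "\<dots> \<le> (\<Sum>p\<in>P. \<epsilon>)" using v(5) by (intro sum_mono less_imp_le)
    also have "\<dots> \<le> e / 2"
    proof -
      have "real (card P) * \<epsilon> \<le> (real (card P) + 1) * \<epsilon>" using \<epsilon> by (intro mult_right_mono) auto
      also have "\<dots> = e / 2" unfolding \<epsilon>_def by (rule mult_half_divide) simp
      finally show ?thesis by simp
    qed
    finally have m2: "?m ?S2 \<le> e / 2" .
    have "\<Omega> - W \<subseteq> ?S1 \<union> (?S2 \<union> ?N)"
    proof
      fix x assume x: "x \<in> \<Omega> - W"
      show "x \<in> ?S1 \<union> (?S2 \<union> ?N)"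
      proof (cases "\<exists>p\<in>P. x \<in> B p")
        case True
        then obtain p where p: "p \<in> P" "x \<in> B p" by blast
        have "x \<notin> snd (v p)" using x p(1) unfolding W_def by blast
        moreover have "x \<in> sphere (fst p) (snd p)" if "x \<notin> Bo p" using that p(2) unfolding B_def Bo_def by auto
        ultimately show ?thesis using p(1) by blast
      qed (use x in blast)
    qed
    then have "?m (\<Omega> - W) \<le> ?m (?S1 \<union> (?S2 \<union> ?N))"
    proof (rule measure_mono_fmeasurable)
      show "\<Omega> - W \<in> sets lebesgue" using \<Omega>(1) W(1) by simp
      show "?S1 \<union> (?S2 \<union> ?N) \<in> lmeasurable" by (intro fmeasurable.Un lm1 lm2 lmN)
    qed
    also have "\<dots> \<le> ?m ?S1 + (?m ?S2 + ?m ?N)"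
      by (intro order_trans[OF measure_Un_le] add_left_mono order_refl
          fmeasurableD fmeasurable.Un lm1 lm2 lmN(1))
    also have "\<dots> < e" using P(2) m2 lmN(2) by linarith
    finally show ?thesis .
  qed
  have mean: "(LINT x|lebesgue. indicator (B p) x *\<^sub>R (u x - \<xi>)) = 0" if p: "p \<in> P" for p
  proof -
    have "indicator (B p) x *\<^sub>R (u x - \<xi>) = fst (v p) x - \<xi>" for x
    proof (cases "x \<in> B p")
      case True then show ?thesis using single[OF p] by simp
    next
      case False then show ?thesis using w0[of x p] by (simp add: w_def)
    qed
    then show ?thesis using c(6)[of p] by simp
  qed
  have uK': "\<forall>x. u x \<in> K" using uK by blast
  have none': "\<forall>x. (\<forall>p\<in>P. x \<notin> cball (fst p) (snd p)) \<longrightarrow> u x = \<xi>"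
    using none unfolding B_def by blast
  have mean': "\<forall>p\<in>P. (LINT x|lebesgue. indicator (cball (fst p) (snd p)) x *\<^sub>R (u x - \<xi>)) = 0"
    using mean unfolding B_def by blast
  show ?thesis
    by (rule exI[of _ u], rule exI[of _ P], rule exI[of _ W])
      (intro conjI P(1) bu neg du W WF mW uK' none' mean')
qed

text \<open>Balls contained in U contribute zero. A ball that meets both U and its complement has
  diameter below 2 e, so its part in U lies in the boundary layer, where the bound M is
  used.\<close>

lemma mean_zero_balls_integral_bound:
  fixes w :: "real^'n::finite \<Rightarrow> real^'d" and U :: "(real^'n) set"
  assumes P: "packing \<Omega> e P" and w: "bounded_measurable w" "\<And>x. norm (w x) \<le> M"
    and off: "\<And>x. (\<forall>p\<in>P. x \<notin> cball (fst p) (snd p)) \<Longrightarrow> w x = 0"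
    and mean: "\<And>p. p \<in> P \<Longrightarrow> (LINT x|lebesgue. indicator (cball (fst p) (snd p)) x *\<^sub>R w x) = 0"
    and U: "open U" "bounded U"
  shows "norm (LINT x|lebesgue. indicator U x *\<^sub>R w x) \<le> M * measure lebesgue {x\<in>U. infdist x (- U) \<le> 2 * e}"
proof -
  define B where "B p = cball (fst p) (snd p)" for p :: "(real^'n) \<times> real"
  let ?T = "{x\<in>U. infdist x (- U) \<le> 2 * e}"
  have fP: "finite P" and re: "\<And>p. p \<in> P \<Longrightarrow> snd p < e" using P by (auto simp: packing_def)
  have M0: "M \<ge> 0" using w(2)[of 0] norm_ge_zero order_trans by blast
  define f where "f p x = indicator (U \<inter> B p) x *\<^sub>R w x" for p x
  have lmU: "U \<in> lmeasurable" by (rule lmeasurable_open[OF U(2,1)])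
  have lmT: "?T \<in> lmeasurable"
  proof -
    have "closed {x. infdist x (- U) \<le> 2 * e}"
      by (intro closed_Collect_le continuous_on_infdist continuous_on_id continuous_on_const)
    moreover have "?T = U \<inter> {x. infdist x (- U) \<le> 2 * e}" by blast
    ultimately show ?thesis using lmU by (simp add: fmeasurable_Int_fmeasurable)
  qed
  have intf: "integrable lebesgue (f p)" for p
  proof (rule bounded_measurable_vanishes_integrable[of _ U])
    have "(\<lambda>x. indicator (U \<inter> B p) x *\<^sub>R w x) \<in> borel_measurable lebesgue"
      using w(1) U(1) unfolding bounded_measurable_def B_def
      by (intro borel_measurable_scaleR borel_measurable_indicator) auto
    moreover have "norm (indicator (U \<inter> B p) x *\<^sub>R w x) \<le> M" for x
      using w(2)[of x] M0 by (simp add: indicator_def)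
    ultimately show "bounded_measurable (f p)" unfolding bounded_measurable_def f_def[abs_def] bounded_iff by blast
  qed (use U in \<open>auto simp: f_def vanishes_off_def\<close>)
  have split: "indicator U x *\<^sub>R w x = (\<Sum>p\<in>P. f p x)" for x
  proof (cases "\<exists>p\<in>P. x \<in> B p")
    case True
    then obtain p where p: "p \<in> P" "x \<in> B p" by blast
    have "f q x = 0" if q: "q \<in> P - {p}" for q
    proof -
      have "x \<notin> B q" using q packing_unique[OF P p(1) _ p(2)[unfolded B_def], of q] unfolding B_def by blast
      then show ?thesis by (simp add: f_def)
    qed
    then have "(\<Sum>p\<in>P. f p x) = f p x" using fP p(1) by (simp add: sum.remove[of P p])
    also have "\<dots> = indicator U x *\<^sub>R w x" using p(2) by (simp add: f_def indicator_def)
    finally show ?thesis by simp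
  next
    case False
    then have "w x = 0" by (intro off) (simp add: B_def)
    then show ?thesis by (simp add: f_def)
  qed
  define Q where "Q = {p\<in>P. \<not> B p \<subseteq> U}"
  have "(LINT x|lebesgue. f p x) = 0" if "p \<in> P - Q" for p
  proof -
    have "U \<inter> B p = B p" using that unfolding Q_def by blast
    then show ?thesis using mean[of p] that by (simp add: f_def B_def)
  qed
  then have "(LINT x|lebesgue. indicator U x *\<^sub>R w x) = (\<Sum>p\<in>Q. LINT x|lebesgue. f p x)"
    using fP intf unfolding split
    by (subst Bochner_Integration.integral_sum) (auto simp: Q_def intro!: sum.mono_neutral_right)
  also have "\<dots> = (LINT x|lebesgue. (\<Sum>p\<in>Q. f p x))"
    using intf by (simp add: Bochner_Integration.integral_sum)
  finally have eq: "(LINT x|lebesgue. indicator U x *\<^sub>R w x) = (LINT x|lebesgue. (\<Sum>p\<in>Q. f p x))" .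
  have "norm (LINT x|lebesgue. (\<Sum>p\<in>Q. f p x)) \<le> (LINT x|lebesgue. M * indicator ?T x)"
  proof (rule Bochner_Integration.integral_norm_bound_integral)
    show "integrable lebesgue (\<lambda>x. \<Sum>p\<in>Q. f p x)" using intf by (intro Bochner_Integration.integrable_sum)
    show "integrable lebesgue (\<lambda>x. M * indicator ?T x :: real)"
      using lmT by (intro integrable_mult_right integrable_real_indicator) (auto simp: fmeasurable_def)
    fix x
    show "norm (\<Sum>p\<in>Q. f p x) \<le> M * indicator ?T x"
    proof (cases "\<exists>p\<in>Q. x \<in> U \<inter> B p")
      case True
      then obtain p where p: "p \<in> Q" "x \<in> U" "x \<in> B p" by blast
      then have pP: "p \<in> P" and "\<not> B p \<subseteq> U" by (auto simp: Q_def)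
      then obtain y where y: "y \<in> B p" "y \<notin> U" by blast
      have "infdist x (- U) \<le> dist x y" using y(2) by (intro infdist_le) simp
      also have "\<dots> \<le> dist (fst p) x + dist (fst p) y" by (rule dist_triangle3)
      also have "\<dots> \<le> 2 * e" using p(3) y(1) re[OF pP] by (simp add: B_def)
      finally have xT: "x \<in> ?T" using p(2) by simp
      have "f q x = 0" if q: "q \<in> Q - {p}" for q
      proof -
        have "q \<in> P" using q by (simp add: Q_def)
        then have "x \<notin> B q" using q packing_unique[OF P pP _ p(3)[unfolded B_def], of q] unfolding B_def by blast
        then show ?thesis by (simp add: f_def)
      qed
      moreover have "finite Q" using fP by (simp add: Q_def)
      ultimately have "(\<Sum>p\<in>Q. f p x) = f p x" using p(1) by (simp add: sum.remove[of Q p])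
      then show ?thesis using xT w(2)[of x] p(2,3) by (simp add: f_def)
    next
      case False
      then have "(\<Sum>p\<in>Q. f p x) = 0" by (intro sum.neutral) (auto simp: f_def)
      then show ?thesis using M0 by simp
    qed
  qed
  also have "\<dots> = M * measure lebesgue ?T" using lmT by (simp add: fmeasurable_def)
  finally show ?thesis unfolding eq .
qed

lemma boundary_layer_vanishes:
  fixes U :: "(real^'n) set"
  assumes U: "open U" "bounded U"
  shows "(\<lambda>n. measure lebesgue {x\<in>U. infdist x (- U) \<le> 2 * inverse (real (Suc n))}) \<longlonglongrightarrow> 0"
proof -
  define T where "T n = {x\<in>U. infdist x (- U) \<le> 2 * inverse (real (Suc n))}" for n
  \<comment> \<open>For an empty complement \<open>infdist\<close> would be 0 everywhere and the
    layer would be all of U.\<close>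
  have ne: "- U \<noteq> {}"
  proof
    assume "- U = {}"
    then have "U = UNIV" by blast
    then show False using U(2) not_bounded_UNIV by blast
  qed
  have lmU: "U \<in> lmeasurable" by (rule lmeasurable_open[OF U(2,1)])
  have lmT: "T n \<in> lmeasurable" for n
  proof -
    have "closed {x. infdist x (- U) \<le> 2 * inverse (real (Suc n))}"
      by (intro closed_Collect_le continuous_on_infdist continuous_on_id continuous_on_const)
    moreover have "T n = U \<inter> {x. infdist x (- U) \<le> 2 * inverse (real (Suc n))}" by (auto simp: T_def)
    ultimately show ?thesis using lmU by (simp add: fmeasurable_Int_fmeasurable)
  qed
  have "(\<lambda>n. measure lebesgue (T n)) \<longlonglongrightarrow> measure lebesgue (\<Inter>n. T n)"
  proof (rule Lim_measure_decseq)
    show "range T \<subseteq> sets lebesgue" using lmT by (auto intro: fmeasurableD)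
    show "emeasure lebesgue (T n) \<noteq> \<infinity>" for n using lmT[of n] by (auto simp: fmeasurable_def)
    show "decseq T"
      unfolding decseq_def
    proof (intro allI impI subsetI)
      fix m n :: nat and x assume "m \<le> n" "x \<in> T n"
      then have "inverse (real (Suc n)) \<le> inverse (real (Suc m))" by (intro le_imp_inverse_le) auto
      moreover have "x \<in> U" "infdist x (- U) \<le> 2 * inverse (real (Suc n))"
        using \<open>x \<in> T n\<close> by (simp_all only: T_def mem_Collect_eq)
      ultimately have "x \<in> U \<and> infdist x (- U) \<le> 2 * inverse (real (Suc m))" by linarith
      then show "x \<in> T m" by (simp only: T_def mem_Collect_eq)
    qed
  qed
  moreover have "(\<Inter>n. T n) = {}"
  proof (rule ccontr)
    assume "(\<Inter>n. T n) \<noteq> {}"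
    then obtain x where x: "\<And>n. x \<in> T n" by blast
    have "infdist x (- U) > 0"
      using x[of 0] U(1) ne by (subst infdist_pos_not_in_closed) (auto simp: T_def)
    then obtain n where "inverse (real (Suc n)) < infdist x (- U) / 2" using reals_Archimedean[of "infdist x (- U) / 2"] by auto
    then show False using x[of n] by (simp add: T_def)
  qed
  ultimately show ?thesis by (simp add: T_def)
qed

lemma integrable_inner_bounded_measurable:
  assumes g: "integrable lebesgue g" and w: "bounded_measurable w"
  shows "integrable lebesgue (\<lambda>x. g x \<bullet> w x)"
proof -
  obtain M where M: "\<And>x. norm (w x) \<le> M" using w unfolding bounded_measurable_def bounded_iff by auto
  show ?thesis
  proof (rule Bochner_Integration.integrable_bound)
    show "integrable lebesgue (\<lambda>x. M * norm (g x))" using g by (intro integrable_mult_right integrable_norm)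
    have "w \<in> borel_measurable lebesgue" using w by (simp add: bounded_measurable_def)
    then show "(\<lambda>x. g x \<bullet> w x) \<in> borel_measurable lebesgue"
      by (rule borel_measurable_inner[OF borel_measurable_integrable[OF g]])
    have "norm (g x \<bullet> w x) \<le> norm (M * norm (g x))" for x
    proof -
      have "norm (g x \<bullet> w x) \<le> norm (g x) * norm (w x)" by (simp add: Cauchy_Schwarz_ineq2)
      also have "\<dots> \<le> norm (g x) * M" by (intro mult_left_mono M) simp
      also have "\<dots> \<le> norm (M * norm (g x))" by (metis abs_ge_self mult.commute real_norm_def)
      finally show ?thesis .
    qed
    then show "AE x in lebesgue. norm (g x \<bullet> w x) \<le> norm (M * norm (g x))" by (rule AE_I2)
  qed
qed

text \<open>Convergence against indicators of bounded open sets extends to all of L^1: the sequence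
  is uniformly bounded, so by \<open>approx\<close> the admissible g form a closed subset of L^1,
  and outer regularity passes from open to measurable sets.\<close>

lemma weak_null_sequence:
  fixes w :: "nat \<Rightarrow> real^'n::finite \<Rightarrow> real^'d" and g :: "real^'n \<Rightarrow> real^'d"
  assumes w: "\<And>n. bounded_measurable (w n)" "\<And>n x. norm (w n x) \<le> M" and \<Omega>: "open \<Omega>" "bounded \<Omega>"
    and off: "\<And>n x. x \<notin> \<Omega> \<Longrightarrow> w n x = 0"
    and null: "\<And>U. open U \<Longrightarrow> bounded U \<Longrightarrow> (\<lambda>n. LINT x|lebesgue. indicator U x *\<^sub>R w n x) \<longlonglongrightarrow> 0"
    and g: "integrable lebesgue g"
  shows "(\<lambda>n. LINT x|lebesgue. g x \<bullet> w n x) \<longlonglongrightarrow> 0"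
proof -
  have M0: "M \<ge> 0" using w(2)[of 0 0] norm_ge_zero order_trans by blast
  have mw: "w n \<in> borel_measurable lebesgue" for n using w(1)[of n] by (simp add: bounded_measurable_def)
  have int: "integrable lebesgue (\<lambda>x. g x \<bullet> w n x)" if "integrable lebesgue g" for g :: "real^'n \<Rightarrow> real^'d" and n
    by (rule integrable_inner_bounded_measurable[OF that w(1)])
  have le: "norm (LINT x|lebesgue. g x \<bullet> w n x) \<le> M * (LINT x|lebesgue. norm (g x))"
    if "integrable lebesgue g" for g :: "real^'n \<Rightarrow> real^'d" and n
  proof -
    have "norm (LINT x|lebesgue. g x \<bullet> w n x) \<le> (LINT x|lebesgue. M * norm (g x))"
    proof (rule Bochner_Integration.integral_norm_bound_integral[OF int[OF that]])
      show "integrable lebesgue (\<lambda>x. M * norm (g x))" using that by (intro integrable_mult_right integrable_norm)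
      fix x
      have "norm (g x \<bullet> w n x) \<le> norm (g x) * norm (w n x)" by (simp add: Cauchy_Schwarz_ineq2)
      also have "\<dots> \<le> norm (g x) * M" by (intro mult_left_mono w(2)) simp
      finally show "norm (g x \<bullet> w n x) \<le> M * norm (g x)" by (simp add: mult.commute)
    qed
    then show ?thesis by simp
  qed
  have approx: "(\<lambda>n. LINT x|lebesgue. g x \<bullet> w n x) \<longlonglongrightarrow> 0"
    if g: "integrable lebesgue g" and ex: "\<And>r. r > 0 \<Longrightarrow> \<exists>h. integrable lebesgue h \<and>
      (\<lambda>n. LINT x|lebesgue. h x \<bullet> w n x) \<longlonglongrightarrow> 0 \<and> (LINT x|lebesgue. norm (g x - h x)) < r"
    for g :: "real^'n \<Rightarrow> real^'d"
  proof (rule LIMSEQ_I)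
    fix r :: real assume r: "r > 0"
    then have "r / (2 * (M + 1)) > 0" using M0 by simp
    then obtain h where h: "integrable lebesgue h" "(\<lambda>n. LINT x|lebesgue. h x \<bullet> w n x) \<longlonglongrightarrow> 0"
      "(LINT x|lebesgue. norm (g x - h x)) < r / (2 * (M + 1))" using ex by blast
    have "r / 2 > 0" using r by simp
    then obtain N where N: "\<And>n. n \<ge> N \<Longrightarrow> norm ((LINT x|lebesgue. h x \<bullet> w n x) - 0) < r / 2"
      using LIMSEQ_D[OF h(2)] by blast
    have "norm ((LINT x|lebesgue. g x \<bullet> w n x) - 0) < r" if n: "n \<ge> N" for n
    proof -
      have gh: "integrable lebesgue (\<lambda>x. g x - h x)" using g h(1) by simp
      have eq: "(LINT x|lebesgue. g x \<bullet> w n x) = (LINT x|lebesgue. (g x - h x) \<bullet> w n x) + (LINT x|lebesgue. h x \<bullet> w n x)"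
        using int[OF gh, of n] int[OF h(1), of n]
        by (subst Bochner_Integration.integral_add[symmetric]) (simp_all add: inner_diff_left)
      have "M * (LINT x|lebesgue. norm (g x - h x)) \<le> (M + 1) * (LINT x|lebesgue. norm (g x - h x))"
        by (intro mult_right_mono) auto
      also have "\<dots> \<le> (M + 1) * (r / (2 * (M + 1)))" using h(3) M0 by (intro mult_left_mono) auto
      also have "\<dots> = r / 2"
        by (rule mult_half_divide) (use M0 in simp)
      finally have "norm (LINT x|lebesgue. (g x - h x) \<bullet> w n x) \<le> r / 2"
        using le[OF gh, of n] by linarith
      then show ?thesis using N[OF n] norm_triangle_ineq[of "LINT x|lebesgue. (g x - h x) \<bullet> w n x" "LINT x|lebesgue. h x \<bullet> w n x"]
        unfolding eq by simp
    qed
    then show "\<exists>N. \<forall>n\<ge>N. norm ((LINT x|lebesgue. g x \<bullet> w n x) - 0) < r" by blast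
  qed
  have openc: "(\<lambda>n. LINT x|lebesgue. (indicator U x *\<^sub>R c) \<bullet> w n x) \<longlonglongrightarrow> 0"
    if "open U" "bounded U" for U and c :: "real^'d"
  proof -
    have i: "integrable lebesgue (\<lambda>x. indicator U x *\<^sub>R w n x)" for n
    proof (rule bounded_measurable_vanishes_integrable[of _ U])
      have "(\<lambda>x. indicator U x *\<^sub>R w n x) \<in> borel_measurable lebesgue"
        using mw that(1) by (intro borel_measurable_scaleR borel_measurable_indicator) auto
      moreover have "norm (indicator U x *\<^sub>R w n x) \<le> M" for x
        using w(2)[of n x] M0 by (simp add: indicator_def)
      ultimately show "bounded_measurable (\<lambda>x. indicator U x *\<^sub>R w n x)" unfolding bounded_measurable_def bounded_iff by blast
    qed (use that in \<open>auto simp: vanishes_off_def\<close>)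
    have "(\<lambda>n. c \<bullet> (LINT x|lebesgue. indicator U x *\<^sub>R w n x)) \<longlonglongrightarrow> c \<bullet> 0"
      by (intro tendsto_inner tendsto_const null that)
    moreover have "c \<bullet> (LINT x|lebesgue. indicator U x *\<^sub>R w n x) = (LINT x|lebesgue. (indicator U x *\<^sub>R c) \<bullet> w n x)" for n
      by (subst integral_inner_right[OF i, symmetric]) simp
    ultimately show ?thesis by simp
  qed
  show ?thesis
    using g
  proof (induction rule: integrable_induct)
    \<comment> \<open>Intersecting with \<Omega>, outside which all \<open>w n\<close> vanish, makes
      the approximating open sets bounded.\<close>
    case (base A c)
    have lmA: "A \<in> lmeasurable" using base by (simp add: fmeasurable_def)
    have lm\<Omega>: "\<Omega> \<in> lmeasurable" by (rule lmeasurable_open[OF \<Omega>(2,1)])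
    have lmA\<Omega>: "A \<inter> \<Omega> \<in> lmeasurable" using lmA lm\<Omega> by (simp add: fmeasurable_Int_fmeasurable fmeasurableD)
    have iA: "integrable lebesgue (\<lambda>x. indicator X x *\<^sub>R c)" if "X \<in> lmeasurable" for X :: "(real^'n) set"
      using that by (intro integrable_scaleR_left integrable_real_indicator) (auto simp: fmeasurable_def)
    have "(\<lambda>n. LINT x|lebesgue. (indicator (A \<inter> \<Omega>) x *\<^sub>R c) \<bullet> w n x) \<longlonglongrightarrow> 0"
    proof (rule approx[OF iA[OF lmA\<Omega>]])
      fix r :: real assume r: "r > 0"
      define d where "d = r / (norm c + 1)"
      have d: "d > 0" using r by (simp add: d_def add_nonneg_pos)
      obtain T where T: "open T" "A \<inter> \<Omega> \<subseteq> T" "T - A \<inter> \<Omega> \<in> lmeasurable" "emeasure lebesgue (T - A \<inter> \<Omega>) < ennreal d"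
        using sets_lebesgue_outer_open[OF fmeasurableD[OF lmA\<Omega>] d] by blast
      define U where "U = T \<inter> \<Omega>"
      have U: "open U" "bounded U" using T(1) \<Omega> by (auto simp: U_def)
      have lmU: "U \<in> lmeasurable" by (rule lmeasurable_open[OF U(2,1)])
      have AU: "A \<inter> \<Omega> \<subseteq> U" using T(2) by (auto simp: U_def)
      have lmD: "U - A \<inter> \<Omega> \<in> lmeasurable" by (rule fmeasurable_Diff[OF lmU fmeasurableD[OF lmA\<Omega>]])
      have "measure lebesgue (U - A \<inter> \<Omega>) \<le> measure lebesgue (T - A \<inter> \<Omega>)"
        by (rule measure_mono_fmeasurable[OF _ fmeasurableD[OF lmD] T(3)]) (auto simp: U_def)
      also have "\<dots> < d"
      proof -
        have "ennreal (measure lebesgue (T - A \<inter> \<Omega>)) < ennreal d"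
          using T(3,4) by (simp add: emeasure_eq_measure2)
        then show ?thesis using ennreal_less_iff measure_nonneg by blast
      qed
      finally have md: "measure lebesgue (U - A \<inter> \<Omega>) < d" .
      have "norm (indicator (A \<inter> \<Omega>) x *\<^sub>R c - indicator U x *\<^sub>R c) = norm c * indicator (U - A \<inter> \<Omega>) x" for x
        using AU by (auto simp: indicator_def)
      then have "(LINT x|lebesgue. norm (indicator (A \<inter> \<Omega>) x *\<^sub>R c - indicator U x *\<^sub>R c)) = norm c * measure lebesgue (U - A \<inter> \<Omega>)"
        using lmD by (simp add: fmeasurable_def)
      also have "\<dots> \<le> norm c * d" using md by (intro mult_left_mono) auto
      also have "\<dots> < (norm c + 1) * d" using d by (simp add: algebra_simps)
      also have "\<dots> = r"
      proof -
        have "norm c + 1 \<noteq> 0" using norm_ge_zero[of c] by linarith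
        then show ?thesis by (simp add: d_def)
      qed
      finally show "\<exists>h. integrable lebesgue h \<and> (\<lambda>n. LINT x|lebesgue. h x \<bullet> w n x) \<longlonglongrightarrow> 0 \<and>
          (LINT x|lebesgue. norm (indicator (A \<inter> \<Omega>) x *\<^sub>R c - h x)) < r"
        using openc[OF U, of c] iA[OF lmU] by (intro exI[of _ "\<lambda>x. indicator U x *\<^sub>R c"]) simp
    qed
    moreover have "(indicator (A \<inter> \<Omega>) x *\<^sub>R c) \<bullet> w n x = (indicator A x *\<^sub>R c) \<bullet> w n x" for n x
      using off[of x n] by (cases "x \<in> \<Omega>") (simp_all add: indicator_def)
    ultimately show ?case by (simp only:)
  next
    case (add f g)
    have "(\<lambda>n. (LINT x|lebesgue. f x \<bullet> w n x) + (LINT x|lebesgue. g x \<bullet> w n x)) \<longlonglongrightarrow> 0 + 0"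
      by (intro tendsto_add add.IH)
    then show ?case
      using int[OF add.hyps(1)] int[OF add.hyps(2)] by (simp add: inner_add_left)
  next
    case (lim f s)
    show ?case
    proof (rule approx[OF lim.hyps(4)])
      fix r :: real assume r: "r > 0"
      \<comment> \<open>The approximating simple functions satisfy |s i| \<le> 2 |f|, hence the
        dominating function 3 |f|.\<close>
      have "(\<lambda>i. LINT x|lebesgue. norm (f x - s i x)) \<longlonglongrightarrow> (LINT x|(lebesgue :: (real^'n) measure). (0::real))"
      proof (rule integral_dominated_convergence[where w = "\<lambda>x. 3 * norm (f x)"])
        show "integrable lebesgue (\<lambda>x. 3 * norm (f x))" using lim.hyps(4) by (intro integrable_mult_right integrable_norm)
        show "(\<lambda>x. norm (f x - s i x)) \<in> borel_measurable lebesgue" for i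
          using lim.hyps(1)[of i] lim.hyps(4)
          by (intro borel_measurable_integrable integrable_norm Bochner_Integration.integrable_diff)
        show "AE x in lebesgue. (\<lambda>i. norm (f x - s i x)) \<longlonglongrightarrow> 0"
        proof (rule AE_I2)
          fix x
          have "(\<lambda>i. norm (f x - s i x)) \<longlonglongrightarrow> norm (f x - f x)"
            by (intro tendsto_norm tendsto_diff tendsto_const lim.hyps(2)) simp
          then show "(\<lambda>i. norm (f x - s i x)) \<longlonglongrightarrow> 0" by simp
        qed
        show "AE x in lebesgue. norm (norm (f x - s i x)) \<le> 3 * norm (f x)" for i
        proof (rule AE_I2)
          fix x
          have "norm (f x - s i x) \<le> norm (f x) + norm (s i x)" by (rule norm_triangle_ineq4)
          also have "\<dots> \<le> norm (f x) + 2 * norm (f x)" by (intro add_left_mono lim.hyps(3)) simp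
          finally show "norm (norm (f x - s i x)) \<le> 3 * norm (f x)" by simp
        qed
      qed simp
      then have "(\<lambda>i. LINT x|lebesgue. norm (f x - s i x)) \<longlonglongrightarrow> 0" by simp
      from LIMSEQ_D[OF this r] obtain i where "norm ((LINT x|lebesgue. norm (f x - s i x)) - 0) < r" by blast
      then have "(LINT x|lebesgue. norm (f x - s i x)) < r" by simp
      then show "\<exists>h. integrable lebesgue h \<and> (\<lambda>n. LINT x|lebesgue. h x \<bullet> w n x) \<longlonglongrightarrow> 0 \<and> (LINT x|lebesgue. norm (f x - h x)) < r"
        using lim.hyps(1)[of i] lim.IH[of i] by blast
    qed
  qed
qed

section \<open>Assembling the relaxing sequence\<close>

lemma set_integral_infdist_bound:
  fixes u :: "real^'n::finite \<Rightarrow> real^'d"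
  assumes u: "bounded_measurable u" and \<Omega>: "open \<Omega>" "bounded \<Omega>" and W: "open W" "W \<subseteq> \<Omega>"
    and d: "\<And>x. x \<in> W \<Longrightarrow> infdist (u x) E \<le> d" "0 \<le> d" and D: "\<And>x. infdist (u x) E \<le> D"
  shows "0 \<le> (LINT x:\<Omega>|lebesgue. infdist (u x) E)"
    "(LINT x:\<Omega>|lebesgue. infdist (u x) E) \<le> d * measure lebesgue \<Omega> + D * measure lebesgue (\<Omega> - W)"
proof -
  have D0: "0 \<le> D" using D[of 0] infdist_nonneg[of "u 0" E] by linarith
  have lm\<Omega>: "\<Omega> \<in> lmeasurable" by (rule lmeasurable_open[OF \<Omega>(2,1)])
  have lmD: "\<Omega> - W \<in> lmeasurable" by (rule fmeasurable_Diff[OF lm\<Omega>]) (use W in simp)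
  have i1: "integrable lebesgue (\<lambda>x. indicator \<Omega> x :: real)" "integrable lebesgue (\<lambda>x. indicator (\<Omega> - W) x :: real)"
    using lm\<Omega> lmD by (intro integrable_real_indicator; simp add: fmeasurable_def)+
  have "(\<lambda>x. infdist (u x) E) \<in> borel_measurable lebesgue"
    using u unfolding bounded_measurable_def
    by (intro measurable_compose[OF _ borel_measurable_continuous_onI[OF continuous_on_infdist[OF continuous_on_id]]]) blast
  then have m: "(\<lambda>x. indicator \<Omega> x *\<^sub>R infdist (u x) E) \<in> borel_measurable lebesgue"
    using \<Omega>(1) by (intro borel_measurable_scaleR borel_measurable_indicator) auto
  have "norm (indicator \<Omega> x *\<^sub>R infdist (u x) E) \<le> D" for x
    using D[of x] D0 infdist_nonneg[of "u x" E] by (simp add: indicator_def)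
  then have "bounded_measurable (\<lambda>x. indicator \<Omega> x *\<^sub>R infdist (u x) E)" unfolding bounded_measurable_def bounded_iff using m by blast
  then have int: "integrable lebesgue (\<lambda>x. indicator \<Omega> x *\<^sub>R infdist (u x) E)"
    by (rule bounded_measurable_vanishes_integrable[OF _ _ \<Omega>(2)]) (simp add: vanishes_off_def)
  show "0 \<le> (LINT x:\<Omega>|lebesgue. infdist (u x) E)"
    unfolding set_lebesgue_integral_def by (intro Bochner_Integration.integral_nonneg) (simp add: infdist_nonneg)
  have "(LINT x|lebesgue. indicator \<Omega> x *\<^sub>R infdist (u x) E) \<le> (LINT x|lebesgue. d * indicator \<Omega> x + D * indicator (\<Omega> - W) x)"
  proof (rule integral_mono[OF int])
    show "integrable lebesgue (\<lambda>x. d * indicator \<Omega> x + D * indicator (\<Omega> - W) x :: real)"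
      using i1 by (intro Bochner_Integration.integrable_add integrable_mult_right)
    fix x
    show "indicator \<Omega> x *\<^sub>R infdist (u x) E \<le> d * indicator \<Omega> x + D * indicator (\<Omega> - W) x"
    proof (cases "x \<in> W")
      case True
      then have "x \<in> \<Omega>" using W(2) by blast
      then show ?thesis using d(1)[OF True] True by simp
    next
      case False
      then show ?thesis using D[of x] d(2) by (cases "x \<in> \<Omega>") simp_all
    qed
  qed
  also have "\<dots> = d * measure lebesgue \<Omega> + D * measure lebesgue (\<Omega> - W)"
    using i1 lm\<Omega> lmD by (simp add: fmeasurable_def)
  finally show "(LINT x:\<Omega>|lebesgue. infdist (u x) E) \<le> d * measure lebesgue \<Omega> + D * measure lebesgue (\<Omega> - W)"
    unfolding set_lebesgue_integral_def .
qed

theorem theorem3p15: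
  fixes A :: "'n::finite \<Rightarrow> real^'d^'m"
    and E :: "(real^'d) set"
    and E\<delta> :: "real \<Rightarrow> (real^'d) set"
  assumes rank_A: "\<And>w :: real^'n. w \<noteq> 0 \<Longrightarrow> rank (op_symbol A w) = CARD('m)"
    and compact_E: "compact E"
    and int_ne: "interior (Lam_hull (char_cone A) E) \<noteq> {}"
    and approx: "\<And>\<epsilon>. \<epsilon> > 0 \<Longrightarrow>
      \<exists>\<delta>\<^sub>0>0. \<forall>\<delta>. 0 < \<delta> \<and> \<delta> \<le> \<delta>\<^sub>0 \<longrightarrow> E\<delta> \<delta> \<subseteq> {\<xi>. infdist \<xi> E \<le> \<epsilon>}"
    and inner: "\<And>\<delta>. \<delta> > 0 \<Longrightarrow>
      Lam_hull (char_cone A) (E\<delta> \<delta>) \<subseteq> interior (Lam_hull (char_cone A) E)"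
    and exhaust: "\<And>\<xi>. \<xi> \<in> interior (Lam_hull (char_cone A) E) \<Longrightarrow>
      \<exists>\<delta>\<^sub>1>0. \<forall>\<delta>. 0 < \<delta> \<and> \<delta> \<le> \<delta>\<^sub>1 \<longrightarrow> \<xi> \<in> Lam_hull (char_cone A) (E\<delta> \<delta>)"
  shows "relaxation_property A (Lam_hull (char_cone A) E) E"
  unfolding relaxation_property_def
proof (intro allI impI)
  let ?L = "Lam_hull (char_cone A)"
  let ?K = "interior (?L E)"
  fix \<Omega> :: "(real^'n) set" and \<xi> :: "real^'d"
  assume H: "bounded \<Omega> \<and> open \<Omega> \<and> \<xi> \<in> ?K"
  then have \<Omega>: "open \<Omega>" "bounded \<Omega>" and \<xi>: "\<xi> \<in> ?K" by auto
  \<comment> \<open>A point of E is needed to bound the distance to E on \<open>?K\<close>.\<close>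
  have "E \<noteq> {}"
  proof
    assume "E = {}"
    then have "?L E = {}" by (simp only: Lam_hull_empty)
    then show False using int_ne by simp
  qed
  then obtain x0 where x0: "x0 \<in> E" by blast
  obtain R where R: "\<And>x. x \<in> E \<Longrightarrow> norm x \<le> R"
    using compact_imp_bounded[OF compact_E] unfolding bounded_iff by blast
  have KR: "norm x \<le> R" if "x \<in> ?K" for x
  proof -
    have "x \<in> cball 0 R" using that interior_subset Lam_hull_subset_convex[OF R] by blast
    then show ?thesis by (simp only: mem_cball_0)
  qed
  have rankA: "\<forall>w :: real^'n. w \<noteq> 0 \<longrightarrow> rank (op_symbol A w) = CARD('m)" using rank_A by blast
  define e where "e n = inverse (real (Suc n))" for n
  have e: "e n > 0" for n by (simp add: e_def)
  have e0: "e \<longlonglongrightarrow> 0" unfolding e_def by (rule LIMSEQ_inverse_real_of_nat)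
  \<comment> \<open>Weak* convergence concerns the whole sequence and cannot be imposed index by
    index; it is replaced here by an estimate for a single field, valid for all bounded open U at
    once.\<close>
  define S where "S n u \<longleftrightarrow> bounded_measurable u \<and> (\<forall>x. u x \<in> ?K) \<and> negligible {x. \<not> loc_const u x} \<and> distr_free A u \<and>
    (\<forall>x. x \<notin> \<Omega> \<longrightarrow> u x = \<xi>) \<and> 0 \<le> (LINT x:\<Omega>|lebesgue. infdist (u x) E) \<and>
    (LINT x:\<Omega>|lebesgue. infdist (u x) E) \<le> e n * (measure lebesgue \<Omega> + 2 * R) \<and>
    (\<forall>U. open U \<and> bounded U \<longrightarrow> norm (LINT x|lebesgue. indicator U x *\<^sub>R (u x - \<xi>))
       \<le> (2 * R) * measure lebesgue {x\<in>U. infdist x (- U) \<le> 2 * e n})" for n u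
  have "\<exists>u. S n u" for n
  proof -
    obtain \<delta>0 where \<delta>0: "\<delta>0 > 0" "\<forall>\<delta>. 0 < \<delta> \<and> \<delta> \<le> \<delta>0 \<longrightarrow> E\<delta> \<delta> \<subseteq> {\<xi>. infdist \<xi> E \<le> e n}"
      using approx[OF e[of n]] by (elim exE conjE) (rule that)
    obtain \<delta>1 where \<delta>1: "\<delta>1 > 0" "\<forall>\<delta>. 0 < \<delta> \<and> \<delta> \<le> \<delta>1 \<longrightarrow> \<xi> \<in> ?L (E\<delta> \<delta>)"
      using exhaust[OF \<xi>] by (elim exE conjE) (rule that)
    \<comment> \<open>Small enough for both purposes: \<open>E\<delta> \<delta>\<close> lies close
      to E by \<open>approx\<close>, and \<xi> lies in its hull by \<open>exhaust\<close>. By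
      \<open>inner\<close> that hull is contained in the open set \<open>?K\<close>.\<close>
    define \<delta> where "\<delta> = min \<delta>0 \<delta>1"
    have \<delta>: "0 < \<delta>" "\<delta> \<le> \<delta>0" "\<delta> \<le> \<delta>1" using \<delta>0(1) \<delta>1(1) by (auto simp: \<delta>_def)
    have rel: "relaxes_to A ?K (E\<delta> \<delta>) \<xi>"
      by (rule relaxes_to_hull[OF rankA open_interior inner[OF \<delta>(1)] \<delta>1(2)[rule_format, OF conjI[OF \<delta>(1,3)]]])
    obtain u P W where u: "packing \<Omega> (e n) P" "bounded_measurable u" "\<forall>x. u x \<in> ?K" "negligible {x. \<not> loc_const u x}"
      "distr_free A u" "open W" "W \<subseteq> \<Omega>" "\<forall>x\<in>W. u x \<in> E\<delta> \<delta>" "measure lebesgue (\<Omega> - W) < e n"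
      "\<forall>x. (\<forall>p\<in>P. x \<notin> cball (fst p) (snd p)) \<longrightarrow> u x = \<xi>"
      "\<forall>p\<in>P. (LINT x|lebesgue. indicator (cball (fst p) (snd p)) x *\<^sub>R (u x - \<xi>)) = 0"
      using localized_field[OF rel \<xi> \<Omega> e[of n]] by (elim exE conjE) (rule that)
    have off: "u x = \<xi>" if "x \<notin> \<Omega>" for x
    proof -
      have "\<forall>p\<in>P. x \<notin> cball (fst p) (snd p)" using u(1) that unfolding packing_def by blast
      then show ?thesis by (rule u(10)[THEN spec, THEN mp])
    qed
    have iW: "infdist (u x) E \<le> e n" if "x \<in> W" for x
    proof -
      have "u x \<in> {\<xi>. infdist \<xi> E \<le> e n}"
        by (rule subsetD[OF \<delta>0(2)[rule_format, OF conjI[OF \<delta>(1,2)]] u(8)[rule_format, OF that]])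
      then show ?thesis by simp
    qed
    \<comment> \<open>E and \<open>?K\<close> both lie in the ball of radius R, so the distance is
      at most 2 R.\<close>
    have iD: "infdist (u x) E \<le> 2 * R" for x
    proof -
      have "infdist (u x) E \<le> dist (u x) x0" by (rule infdist_le[OF x0])
      also have "\<dots> \<le> norm (u x) + norm x0" unfolding dist_norm by (rule norm_triangle_ineq4)
      also have "\<dots> \<le> 2 * R" using KR[of "u x"] u(3) R[OF x0] by simp
      finally show ?thesis .
    qed
    note b = set_integral_infdist_bound[OF u(2) \<Omega> u(6,7) iW less_imp_le[OF e] iD]
    have "R \<ge> 0" using R[OF x0] norm_ge_zero[of x0] by linarith
    \<comment> \<open>The integral of the distance splits: the integrand is at most
      \<open>e n\<close> on W and at most 2 R on the rest, whose measure is below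
      \<open>e n\<close>.\<close>
    then have "2 * R * measure lebesgue (\<Omega> - W) \<le> 2 * R * e n" using u(9) by (intro mult_left_mono) auto
    then have b2: "(LINT x:\<Omega>|lebesgue. infdist (u x) E) \<le> e n * (measure lebesgue \<Omega> + 2 * R)"
      using b(2) by (simp add: algebra_simps)
    have bw: "bounded_measurable (\<lambda>x. u x - \<xi>)" by (intro bounded_measurable_diff u(2) bounded_measurable_const)
    have nw: "norm (u x - \<xi>) \<le> 2 * R" for x
    proof -
      have "norm (u x - \<xi>) \<le> norm (u x) + norm \<xi>" by (rule norm_triangle_ineq4)
      then show ?thesis using KR[of "u x"] u(3) KR[OF \<xi>] by simp
    qed
    have "norm (LINT x|lebesgue. indicator U x *\<^sub>R (u x - \<xi>)) \<le> (2 * R) * measure lebesgue {x\<in>U. infdist x (- U) \<le> 2 * e n}"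
      if U: "open U \<and> bounded U" for U
    proof (rule mean_zero_balls_integral_bound[OF u(1) bw nw])
      show "u x - \<xi> = 0" if "\<forall>p\<in>P. x \<notin> cball (fst p) (snd p)" for x
        using u(10)[THEN spec, THEN mp, OF that] by simp
      show "(LINT x|lebesgue. indicator (cball (fst p) (snd p)) x *\<^sub>R (u x - \<xi>)) = 0" if "p \<in> P" for p
        by (rule u(11)[rule_format, OF that])
      show "open U" "bounded U" using U by simp_all
    qed
    then have "S n u"
      unfolding S_def by (intro conjI allI impI u(2,4,5) u(3)[rule_format] off b(1) b2)
    then show ?thesis by (intro exI[of _ u])
  qed
  then have "\<forall>n. \<exists>u. S n u" by blast
  then have "\<exists>u. \<forall>n. S n (u n)" by (rule choice)
  then obtain u where "\<forall>n. S n (u n)" by (elim exE)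
  note Sn = this[rule_format, unfolded S_def]
  note u = Sn[THEN conjunct1] Sn[THEN conjunct2, THEN conjunct1, rule_format]
    Sn[THEN conjunct2, THEN conjunct2, THEN conjunct1]
    Sn[THEN conjunct2, THEN conjunct2, THEN conjunct2, THEN conjunct1]
    Sn[THEN conjunct2, THEN conjunct2, THEN conjunct2, THEN conjunct2, THEN conjunct1, rule_format]
    Sn[THEN conjunct2, THEN conjunct2, THEN conjunct2, THEN conjunct2, THEN conjunct2, THEN conjunct1]
    Sn[THEN conjunct2, THEN conjunct2, THEN conjunct2, THEN conjunct2, THEN conjunct2, THEN conjunct2, THEN conjunct1]
    Sn[THEN conjunct2, THEN conjunct2, THEN conjunct2, THEN conjunct2, THEN conjunct2, THEN conjunct2, THEN conjunct2, rule_format, OF conjI]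
  have bw: "bounded_measurable (\<lambda>x. u n x - \<xi>)" for n by (intro bounded_measurable_diff u(1) bounded_measurable_const)
  have weak: "weak_star_Linf u (\<lambda>_. \<xi>)"
    unfolding weak_star_Linf_def
  proof (intro allI impI)
    fix g :: "real^'n \<Rightarrow> real^'d" assume g: "integrable lebesgue g"
    have "(\<lambda>n. LINT x|lebesgue. g x \<bullet> (u n x - \<xi>)) \<longlonglongrightarrow> 0"
    proof (rule weak_null_sequence[OF bw _ \<Omega> _ _ g])
      show "norm (u n x - \<xi>) \<le> 2 * R" for n x
      proof -
        have "norm (u n x - \<xi>) \<le> norm (u n x) + norm \<xi>" by (rule norm_triangle_ineq4)
        then show ?thesis using KR[OF u(2), of n x] KR[OF \<xi>] by simp
      qed
      show "u n x - \<xi> = 0" if "x \<notin> \<Omega>" for n x using u(5)[OF that] by simp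
      fix U :: "(real^'n) set" assume U: "open U" "bounded U"
      have "(\<lambda>n. (2 * R) * measure lebesgue {x\<in>U. infdist x (- U) \<le> 2 * e n}) \<longlonglongrightarrow> (2 * R) * 0"
        unfolding e_def by (intro tendsto_mult tendsto_const boundary_layer_vanishes U)
      then have "(\<lambda>n. (2 * R) * measure lebesgue {x\<in>U. infdist x (- U) \<le> 2 * e n}) \<longlonglongrightarrow> 0" by simp
      then show "(\<lambda>n. LINT x|lebesgue. indicator U x *\<^sub>R (u n x - \<xi>)) \<longlonglongrightarrow> 0"
        by (rule Lim_null_comparison[rotated]) (intro always_eventually allI u(8) U)
    qed
    then have "(\<lambda>n. (LINT x|lebesgue. g x \<bullet> (u n x - \<xi>)) + (LINT x|lebesgue. g x \<bullet> \<xi>)) \<longlonglongrightarrow> 0 + (LINT x|lebesgue. g x \<bullet> \<xi>)"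
      by (intro tendsto_add tendsto_const)
    moreover have "(LINT x|lebesgue. g x \<bullet> (u n x - \<xi>)) + (LINT x|lebesgue. g x \<bullet> \<xi>) = (LINT x|lebesgue. g x \<bullet> u n x)" for n
    proof -
      have "(LINT x|lebesgue. g x \<bullet> (u n x - \<xi>)) + (LINT x|lebesgue. g x \<bullet> \<xi>)
          = (LINT x|lebesgue. g x \<bullet> (u n x - \<xi>) + g x \<bullet> \<xi>)"
        by (rule Bochner_Integration.integral_add[symmetric])
          (intro integrable_inner_bounded_measurable g bw bounded_measurable_const)+
      then show ?thesis by (simp add: inner_diff_right)
    qed
    ultimately show "(\<lambda>n. LINT x|lebesgue. g x \<bullet> u n x) \<longlonglongrightarrow> (LINT x|lebesgue. g x \<bullet> \<xi>)" by simp
  qed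
  have lim: "(\<lambda>n. LINT x:\<Omega>|lebesgue. infdist (u n x) E) \<longlonglongrightarrow> 0"
  proof (rule tendsto_sandwich[where f = "\<lambda>n. 0" and h = "\<lambda>n. e n * (measure lebesgue \<Omega> + 2 * R)"])
    show "\<forall>\<^sub>F n in sequentially. 0 \<le> (LINT x:\<Omega>|lebesgue. infdist (u n x) E)"
      by (intro always_eventually allI u(6))
    show "\<forall>\<^sub>F n in sequentially. (LINT x:\<Omega>|lebesgue. infdist (u n x) E) \<le> e n * (measure lebesgue \<Omega> + 2 * R)"
      by (intro always_eventually allI u(7))
    have "(\<lambda>n. e n * (measure lebesgue \<Omega> + 2 * R)) \<longlonglongrightarrow> 0 * (measure lebesgue \<Omega> + 2 * R)"
      by (intro tendsto_mult tendsto_const e0)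
    then show "(\<lambda>n. e n * (measure lebesgue \<Omega> + 2 * R)) \<longlonglongrightarrow> 0" by simp
  qed simp
  show "\<exists>u :: nat \<Rightarrow> real^'n \<Rightarrow> real^'d.
          (\<forall>n. u n \<in> Linf_piec) \<and> weak_star_Linf u (\<lambda>_. \<xi>) \<and> (\<forall>n x. x \<notin> \<Omega> \<longrightarrow> u n x = \<xi>) \<and>
          (\<forall>n. distr_free A (u n)) \<and>
          (\<forall>n. AE x in lebesgue. x \<in> \<Omega> \<longrightarrow> u n x \<in> E \<union> ?K) \<and>
          (\<lambda>n. LINT x:\<Omega>|lebesgue. infdist (u n x) E) \<longlonglongrightarrow> 0"
  proof (rule exI[of _ u], intro conjI allI weak lim u(4))
    show "u n \<in> Linf_piec" for n
      using u(1)[of n] by (intro Linf_piecI u(3)) (simp add: bounded_measurable_def)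
    show "x \<notin> \<Omega> \<longrightarrow> u n x = \<xi>" for n x using u(5) by blast
    show "AE x in lebesgue. x \<in> \<Omega> \<longrightarrow> u n x \<in> E \<union> ?K" for n
      using u(2)[of n] by (intro AE_I2) blast
  qed
qed

end
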